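(* The following four convergence results hold. (i) (General, possibly time-dependent data; arbitrary $P\in\mathcal{S}^n_+$.) Given any $T>0$, $$\lim_{\Vert\Delta\Vert\to 0}\ \max_{i=0,\ldots,N}\ \Vert E^T(t_i)-E^{T,\Delta}_i\Vert_{\mathbb{R}^{n\times n}}=0$$ for all time partitions $\Delta=\{t_i\}_{i=0,\ldots,N}$ of $[0,T]$; that is, for every $\varepsilon>0$ there exists $\delta>0$ such that for every time partition $\Delta=\{t_i\}_{i=0,\ldots,N}$ of $[0,T]$ with $0<\Vert\Delta\Vert\le\delta$ one has $\max_{i=0,\ldots,N}\Vert E^T(t_i)-E^{T,\Delta}_i\Vert_{\mathbb{R}^{n\times n}}\le\varepsilon$. (ii) Assume that $P=0_{\mathbb{R}^{n\times n}}$, that the setting is autonomous, that $Q\in\mathcal{S}^n_{++}$, and that optimizability holds. Then $$\lim_{T\to+\infty}E^T(t)=E^\infty\qquad\forall t\ge 0.$$ (iii) Assume that $P=0_{\mathbb{R}^{n\times n}}$ and that the setting is autonomous. Let $h>0$, let $\Delta=\{t_i\}_{i\in\mathbb{N}}$, $t_i=ih$, be the $h$-uniform time partition of $[0,+\infty)$, and for every $N\in\mathbb{N}^*$ let $\Delta_N:=\Delta\cap[0,t_N]$ be the corresponding $h$-uniform time partition of $[0,t_N]$. If $Q\in\mathcal{S}^n_{++}$ and $h$-optimizability holds, then $$\lim_{N\to+\infty}E^{t_N,\Delta_N}_i=E^{\infty,\Delta}\qquad\forall i\in\mathbb{N}.$$ (iv) Assume that the setting is autonomous, that $Q\in\mathcal{S}^n_{++}$,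 and that optimizability holds. Let $\overline{h}>0$ be a uniform $h$-optimizability threshold (as defined in the context). Then $$\lim_{h\to 0}E^{\infty,\Delta}=E^\infty,$$ where, for $0<h\le\overline{h}$, $\Delta=\{ih\}_{i\in\mathbb{N}}$ denotes the $h$-uniform time partition of $[0,+\infty)$.
   Context: **Notation and data.** $\mathbb{N}=\{0,1,2,\dots\}$, $\mathbb{N}^*=\mathbb{N}\setminus\{0\}$, $\mathbb{R}_+=[0,+\infty)$. For $p\in\mathbb{N}^*$, $\mathcal{S}^p_+$ (resp. $\mathcal{S}^p_{++}$) is the set of symmetric positive semi-definite (resp. positive definite) real $p\times p$ matrices. Let $n,m\in\mathbb{N}^*$, $P\in\mathcal{S}^n_+$, and for $t\in\mathbb{R}$ let $A(t)\in\mathbb{R}^{n\times n}$, $B(t)\in\mathbb{R}^{n\times m}$, $Q(t)\in\mathcal{S}^n_+$, $R(t)\in\mathcal{S}^m_{++}$ depend continuously on $t$. $\Phi(\cdot,\cdot)$ is the state-transition matrix of $A(\cdot)$: $\partial_t\Phi(t,s)=A(t)\Phi(t,s)$, $\Phi(s,s)=I_n$. The setting is *autonomous* when $A,B,Q,R$ are constant in $t$; then $\Phi(t,s)=e^{(t-s)A}$. $\Vert\cdot\Vert_{\mathbb{R}^{n\times n}}$ is the operator norm induced by the Euclidean norm. **The map $\mathcal{F}$.** For $(t,E,h)\in\mathbb{R}\times\mathcal{S}^n_+\times\mathbb{R}_+$, $$\mathcal{F}(t,E,h):=\mathcal{M}\,\mathcal{N}^{-1}\mathcal{M}^\top-\mathcal{G},\quad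 \mathcal{M}=\mathcal{M}_1+\mathcal{M}_2,\ \ \mathcal{N}=\mathcal{N}_1+\mathcal{N}_2+\mathcal{N}_3,\ \ \mathcal{G}=\mathcal{G}_1+\mathcal{G}_2,$$ all evaluated at $(t,E,h)$, where for $h>0$: - $\mathcal{M}_1=\Phi(t,t-h)^\top E\big(\frac1h\int_{t-h}^t\Phi(t,\tau)B(\tau)\,d\tau\big)$, - $\mathcal{M}_2=\frac1h\int_{t-h}^t\Phi(\tau,t-h)^\top Q(\tau)\big(\int_{t-h}^\tau\Phi(\tau,\xi)B(\xi)\,d\xi\big)d\tau$, - $\mathcal{N}_1=\frac1h\int_{t-h}^tR(\tau)\,d\tau$, - $\mathcal{N}_2=\frac1h\int_{t-h}^t\big(\int_{t-h}^\tau B(\xi)^\top\Phi(\tau,\xi)^\top d\xi\big)Q(\tau)\big(\int_{t-h}^\tau\Phi(\tau,\xi)B(\xi)\,d\xi\big)d\tau$, - $\mathcal{N}_3=\frac1h\big(\int_{t-h}^tB(\tau)^\top\Phi(t,\tau)^\top d\tau\big)E\big(\int_{t-h}^t\Phi(t,\tau)B(\tau)\,d\tau\big)$, - $\mathcal{G}_1=\frac1h\int_{t-h}^t\Phi(\tau,t-h)^\top Q(\tau)\Phi(\tau,t-h)\,d\tau$, - $\mathcal{G}_2=\frac1h\big(\Phi(t,t-h)^\top E\,\Phi(t,t-h)-E\big)$, and for $h=0$: $\mathcal{M}_1=EB(t)$, $\mathcal{M}_2=0$, $\mathcal{N}_1=R(t)$, $\mathcal{N}_2=\mathcal{N}_3=0$,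 $\mathcal{G}_1=Q(t)$, $\mathcal{G}_2=A(t)^\top E+EA(t)$. Thus $\mathcal{F}(t,E,0)=EB(t)R(t)^{-1}B(t)^\top E-Q(t)-A(t)^\top E-EA(t)$. In the autonomous setting $\mathcal{F}$ does not depend on $t$ and is written $\mathcal{F}(E,h)$. **Time partitions.** A time partition of $[0,T]$ is a finite set $\Delta=\{t_i\}_{i=0,\ldots,N}$, $N\in\mathbb{N}^*$, with $0=t_0<t_1<\dots<t_N=T$; $h_i:=t_i-t_{i-1}$ and $\Vert\Delta\Vert:=\max_{1\le i\le N}h_i$. It is $h$-uniform if $h_i=h$ for all $i$. The $h$-uniform time partition of $[0,+\infty)$ is $\{ih\}_{i\in\mathbb{N}}$. $\mathrm{PC}^\Delta([0,+\infty),\mathbb{R}^m)$ is the set of functions $u:[0,+\infty)\to\mathbb{R}^m$ with $u(t)=u_i\in\mathbb{R}^m$ for all $t\in[t_i,t_{i+1})$, $i\in\mathbb{N}$. $\mathrm{AC}([0,+\infty),\mathbb{R}^n)$ is the set of functions absolutely continuous on $[0,T]$ for every $T>0$. **Finite-horizon Riccati matrices** (known to be well defined). For $T>0$, $E^T:[0,T]\to\mathcal{S}^n_+$ is the unique solution of $\dot{E^T}(t)=\mathcal{F}(t,E^T(t),0)$ for $t\in[0,T]$, $E^T(T)=P$. For a time partition $\Delta=\{t_i\}_{i=0,\ldots,N}$ of $[0,T]$, $E^{T,\Delta}=(E^{T,\Delta}_i)_{i=0,\ldots,N}\subset\mathcal{S}^n_+$ is the unique solution of $E^{T,\Delta}_{i+1}-E^{T,\Delta}_i=h_{i+1}\mathcal{F}(t_{i+1},E^{T,\Delta}_{i+1},h_{i+1})$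 for $i=0,\ldots,N-1$, $E^{T,\Delta}_N=P$. **Optimizability (autonomous setting).** - *Optimizability*: for every $x_0\in\mathbb{R}^n$ there is $(x,u)\in\mathrm{AC}([0,+\infty),\mathbb{R}^n)\times\mathrm{L}^2([0,+\infty),\mathbb{R}^m)$ with $\dot x(t)=Ax(t)+Bu(t)$ for a.e. $t\ge0$, $x(0)=x_0$ and $\int_0^{+\infty}(\langle Qx,x\rangle_{\mathbb{R}^n}+\langle Ru,u\rangle_{\mathbb{R}^m})\,d\tau<+\infty$. - *$h$-optimizability* ($h>0$): the same property with $u\in\mathrm{PC}^\Delta([0,+\infty),\mathbb{R}^m)$ instead of $u\in\mathrm{L}^2$, where $\Delta$ is the $h$-uniform time partition of $[0,+\infty)$. **Infinite-horizon Riccati matrices (autonomous setting, $Q\in\mathcal{S}^n_{++}$).** Under optimizability, $E^\infty$ denotes the unique $E\in\mathcal{S}^n_+$ with $\mathcal{F}(E,0)=0_{\mathbb{R}^{n\times n}}$ (it belongs to $\mathcal{S}^n_{++}$). Under $h$-optimizability, with $\Delta$ the $h$-uniform time partition of $[0,+\infty)$, $E^{\infty,\Delta}$ denotes the unique $E\in\mathcal{S}^n_+$ with $\mathcal{F}(E,h)=0_{\mathbb{R}^{n\times n}}$ (it belongs to $\mathcal{S}^n_{++}$). **Uniform $h$-optimizability threshold.** Under $Q\in\mathcal{S}^n_{++}$ and optimizability, $\overline h>0$ is such a threshold if there exists $\overline c\ge0$ such that, for every $0<h\le\overline h$, with $\Delta$ the $h$-uniform time partition of $[0,+\infty)$, and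 every $x_0\in\mathbb{R}^n$, there is $(x,u)\in\mathrm{AC}([0,+\infty),\mathbb{R}^n)\times\mathrm{PC}^\Delta([0,+\infty),\mathbb{R}^m)$ with $\dot x=Ax+Bu$ a.e. on $[0,+\infty)$, $x(0)=x_0$ and $\int_0^{+\infty}(\langle Qx,x\rangle_{\mathbb{R}^n}+\langle Ru,u\rangle_{\mathbb{R}^m})\,d\tau\le\overline c\,\langle E^\infty x_0,x_0\rangle_{\mathbb{R}^n}$. Such an $\overline h$ exists under these assumptions; in particular $h$-optimizability holds for all $0<h\le\overline h$. *)

theory Defs
  imports "HOL-Analysis.Analysis"
begin

definition sym_psd :: "(real^'p^'p) set" where
  "sym_psd = {M. transpose M = M \<and> (\<forall>x. 0 \<le> (M *v x) \<bullet> x)}"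

definition sym_pd :: "(real^'p^'p) set" where
  "sym_pd = {M. transpose M = M \<and> (\<forall>x. x \<noteq> 0 \<longrightarrow> 0 < (M *v x) \<bullet> x)}"

text \<open>The operator norm induced by the Euclidean norm. (The library's \<^const>\<open>norm\<close> on matrices
  is the Frobenius norm.)\<close>

definition opnorm :: "real^'n^'n \<Rightarrow> real" where
  "opnorm M = onorm (\<lambda>v. M *v v)"

definition state_transition :: "(real \<Rightarrow> real^'n^'n) \<Rightarrow> real \<Rightarrow> real \<Rightarrow> real^'n^'n" where
  "state_transition A = (THE \<Phi>. \<forall>s. \<Phi> s s = mat 1 \<and>
     (\<forall>t. ((\<lambda>\<tau>. \<Phi> \<tau> s) has_vector_derivative (A t ** \<Phi> t s)) (at t)))"

context
  fixes A :: "real \<Rightarrow> real^'n^'n" and B :: "real \<Rightarrow> real^'m^'n"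
    and Q :: "real \<Rightarrow> real^'n^'n" and R :: "real \<Rightarrow> real^'m^'m"
begin

definition input_map :: "real \<Rightarrow> real \<Rightarrow> real^'m^'n" where
  "input_map s t = integral {s..t} (\<lambda>\<xi>. state_transition A t \<xi> ** B \<xi>)"

definition ricM1 :: "real \<Rightarrow> real^'n^'n \<Rightarrow> real \<Rightarrow> real^'m^'n" where
  "ricM1 t E h = (if h = 0 then E ** B t
     else transpose (state_transition A t (t - h)) ** E ** ((1 / h) *\<^sub>R input_map (t - h) t))"

definition ricM2 :: "real \<Rightarrow> real^'n^'n \<Rightarrow> real \<Rightarrow> real^'m^'n" where
  "ricM2 t E h = (if h = 0 then 0
     else (1 / h) *\<^sub>R integral {t - h..t} (\<lambda>\<tau>.
       transpose (state_transition A \<tau> (t - h)) ** Q \<tau> ** input_map (t - h) \<tau>))"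

definition ricN1 :: "real \<Rightarrow> real^'n^'n \<Rightarrow> real \<Rightarrow> real^'m^'m" where
  "ricN1 t E h = (if h = 0 then R t else (1 / h) *\<^sub>R integral {t - h..t} R)"

definition ricN2 :: "real \<Rightarrow> real^'n^'n \<Rightarrow> real \<Rightarrow> real^'m^'m" where
  "ricN2 t E h = (if h = 0 then 0
     else (1 / h) *\<^sub>R integral {t - h..t} (\<lambda>\<tau>.
       integral {t - h..\<tau>} (\<lambda>\<xi>. transpose (B \<xi>) ** transpose (state_transition A \<tau> \<xi>))
         ** Q \<tau> ** input_map (t - h) \<tau>))"

definition ricN3 :: "real \<Rightarrow> real^'n^'n \<Rightarrow> real \<Rightarrow> real^'m^'m" where
  "ricN3 t E h = (if h = 0 then 0
     else (1 / h) *\<^sub>R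
       (integral {t - h..t} (\<lambda>\<tau>. transpose (B \<tau>) ** transpose (state_transition A t \<tau>))
         ** E ** input_map (t - h) t))"

definition ricG1 :: "real \<Rightarrow> real^'n^'n \<Rightarrow> real \<Rightarrow> real^'n^'n" where
  "ricG1 t E h = (if h = 0 then Q t
     else (1 / h) *\<^sub>R integral {t - h..t} (\<lambda>\<tau>.
       transpose (state_transition A \<tau> (t - h)) ** Q \<tau> ** state_transition A \<tau> (t - h)))"

definition ricG2 :: "real \<Rightarrow> real^'n^'n \<Rightarrow> real \<Rightarrow> real^'n^'n" where
  "ricG2 t E h = (if h = 0 then transpose (A t) ** E + E ** A t
     else (1 / h) *\<^sub>R
       (transpose (state_transition A t (t - h)) ** E ** state_transition A t (t - h) - E))"

definition ric :: "real \<Rightarrow> real^'n^'n \<Rightarrow> real \<Rightarrow> real^'n^'n" where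
  "ric t E h =
     (let M = ricM1 t E h + ricM2 t E h;
          N = ricN1 t E h + ricN2 t E h + ricN3 t E h;
          G = ricG1 t E h + ricG2 t E h
      in M ** matrix_inv N ** transpose M - G)"

text \<open>Solutions are extensional functions, that is, arbitrary but fixed off their domain;
  this makes them unique as total functions.\<close>

definition finite_riccati :: "real^'n^'n \<Rightarrow> real \<Rightarrow> real \<Rightarrow> real^'n^'n" where
  "finite_riccati P T = (THE E. E \<in> {0..T} \<rightarrow>\<^sub>E sym_psd \<and>
     (\<forall>t\<in>{0..T}. (E has_vector_derivative ric t (E t) 0) (at t within {0..T})) \<and>
     E T = P)"

text \<open>A time partition is given by its number of steps \<open>N\<close> and its enumeration
  \<open>\<theta> 0 < \<dots> < \<theta> N\<close>; the values of \<open>\<theta>\<close> beyond \<open>N\<close> are irrelevant.\<close>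

definition discrete_riccati :: "real^'n^'n \<Rightarrow> nat \<Rightarrow> (nat \<Rightarrow> real) \<Rightarrow> nat \<Rightarrow> real^'n^'n" where
  "discrete_riccati P N \<theta> = (THE E. E \<in> {..N} \<rightarrow>\<^sub>E sym_psd \<and>
     (\<forall>i<N. E (Suc i) - E i =
        (\<theta> (Suc i) - \<theta> i) *\<^sub>R ric (\<theta> (Suc i)) (E (Suc i)) (\<theta> (Suc i) - \<theta> i)) \<and>
     E N = P)"

definition autonomous :: bool where
  "autonomous \<longleftrightarrow> (\<forall>t. A t = A 0 \<and> B t = B 0 \<and> Q t = Q 0 \<and> R t = R 0)"

text \<open>Only used in the autonomous setting, where \<^const>\<open>ric\<close> does not depend on its time argument,
  here taken to be \<open>0\<close>. The value at \<open>h = 0\<close> is the continuous-time matrix, and the value at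
  \<open>h > 0\<close> the one of the \<open>h\<close>-uniform time partition of the half-line.\<close>

definition infinite_riccati :: "real \<Rightarrow> real^'n^'n" where
  "infinite_riccati h = (THE E. E \<in> sym_psd \<and> ric 0 E h = 0)"

end

definition time_partition :: "real \<Rightarrow> nat \<Rightarrow> (nat \<Rightarrow> real) \<Rightarrow> bool" where
  "time_partition T N \<theta> \<longleftrightarrow> 1 \<le> N \<and> \<theta> 0 = 0 \<and> \<theta> N = T \<and> (\<forall>i<N. \<theta> i < \<theta> (Suc i))"

definition mesh :: "nat \<Rightarrow> (nat \<Rightarrow> real) \<Rightarrow> real" where
  "mesh N \<theta> = (MAX i\<in>{1..N}. \<theta> i - \<theta> (i - 1))"

definition abs_cont_on :: "real set \<Rightarrow> (real \<Rightarrow> 'a::real_normed_vector) \<Rightarrow> bool" where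
  "abs_cont_on S f \<longleftrightarrow>
     (\<forall>\<epsilon>>0. \<exists>\<delta>>0. \<forall>I. finite I \<and> (\<forall>(a, b)\<in>I. a \<le> b \<and> {a..b} \<subseteq> S) \<and>
        disjoint_family_on (\<lambda>(a, b). {a<..<b}) I \<and> (\<Sum>(a, b)\<in>I. b - a) < \<delta> \<longrightarrow>
        (\<Sum>(a, b)\<in>I. norm (f b - f a)) < \<epsilon>)"

text \<open>Functions on the half-line are represented by total functions whose values at negative
  times are irrelevant.\<close>

definition AC :: "(real \<Rightarrow> 'a::real_normed_vector) set" where
  "AC = {x. \<forall>T>0. abs_cont_on {0..T} x}"

definition L2 :: "(real \<Rightarrow> 'a::euclidean_space) set" where
  "L2 = {u. set_borel_measurable lebesgue {0..} u \<and>
            set_integrable lebesgue {0..} (\<lambda>t. (norm (u t))\<^sup>2)}"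

definition PC :: "real \<Rightarrow> (real \<Rightarrow> 'a) set" where
  "PC h = {u. \<exists>v. \<forall>i. \<forall>t\<in>{real i * h..<real (Suc i) * h}. u t = v i}"

definition trajectory ::
  "(real \<Rightarrow> real^'n^'n) \<Rightarrow> (real \<Rightarrow> real^'m^'n) \<Rightarrow> real^'n
    \<Rightarrow> (real \<Rightarrow> real^'n) \<Rightarrow> (real \<Rightarrow> real^'m) \<Rightarrow> bool" where
  "trajectory A B x0 x u \<longleftrightarrow> x \<in> AC \<and> x 0 = x0 \<and>
     (AE t in lebesgue. 0 \<le> t \<longrightarrow> (x has_vector_derivative (A t *v x t + B t *v u t)) (at t))"

definition cost ::
  "(real \<Rightarrow> real^'n^'n) \<Rightarrow> (real \<Rightarrow> real^'m^'m) \<Rightarrow> (real \<Rightarrow> real^'n) \<Rightarrow> (real \<Rightarrow> real^'m)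
    \<Rightarrow> ennreal" where
  "cost Q R x u =
     (\<integral>\<^sup>+t\<in>{0..}. ennreal ((Q t *v x t) \<bullet> x t + (R t *v u t) \<bullet> u t) \<partial>lebesgue)"

definition optimizable ::
  "(real \<Rightarrow> real^'n^'n) \<Rightarrow> (real \<Rightarrow> real^'m^'n) \<Rightarrow> (real \<Rightarrow> real^'n^'n) \<Rightarrow> (real \<Rightarrow> real^'m^'m)
    \<Rightarrow> bool" where
  "optimizable A B Q R \<longleftrightarrow>
     (\<forall>x0. \<exists>x. \<exists>u\<in>L2. trajectory A B x0 x u \<and> cost Q R x u < \<infinity>)"

definition h_optimizable ::
  "(real \<Rightarrow> real^'n^'n) \<Rightarrow> (real \<Rightarrow> real^'m^'n) \<Rightarrow> (real \<Rightarrow> real^'n^'n) \<Rightarrow> (real \<Rightarrow> real^'m^'m)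
    \<Rightarrow> real \<Rightarrow> bool" where
  "h_optimizable A B Q R h \<longleftrightarrow>
     (\<forall>x0. \<exists>x. \<exists>u\<in>PC h. trajectory A B x0 x u \<and> cost Q R x u < \<infinity>)"

definition uniform_threshold ::
  "(real \<Rightarrow> real^'n^'n) \<Rightarrow> (real \<Rightarrow> real^'m^'n) \<Rightarrow> (real \<Rightarrow> real^'n^'n) \<Rightarrow> (real \<Rightarrow> real^'m^'m)
    \<Rightarrow> real \<Rightarrow> bool" where
  "uniform_threshold A B Q R hbar \<longleftrightarrow> 0 < hbar \<and>
     (\<exists>c\<ge>0. \<forall>h. 0 < h \<and> h \<le> hbar \<longrightarrow>
        (\<forall>x0. \<exists>x. \<exists>u\<in>PC h. trajectory A B x0 x u \<and>
           cost Q R x u \<le> ennreal (c * ((infinite_riccati A B Q R 0 *v x0) \<bullet> x0))))"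

end

theory Submission
  imports Defs
begin

text \<open>For \<open>h > 0\<close> the matrix \<open>S E = E - h \<F>(t, E, h)\<close> is the Schur complement of the quadratic form which gives
  the cost of a constant control on \<open>[t - h, t]\<close> with final cost \<open>E\<close>. So \<open>\<langle>S E x, x\<rangle>\<close> is the minimum of
  that cost, whence \<open>S\<close> preserves \<open>sym_psd\<close>, is monotone in the Loewner order and is bounded by the cost
  of the zero control.

  (i) By the last bound all discrete solutions stay in a fixed ball of \<open>sym_psd\<close>. As \<open>\<F>(t, E, h)\<close> tends
  to \<open>\<F>(t, E, 0)\<close> uniformly on that ball, they converge to the solution of the Riccati equation
  truncated to the ball, which thus never leaves it.

  (ii), (iii) With final cost \<open>0\<close> the solutions increase with the horizon, and any trajectory of
  finite cost bounds them; the limit is stationary. Two stationary solutions \<open>E, E'\<close> agree: otherwise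
  the smallest \<open>l\<close> with \<open>E \<le> l E'\<close> may be assumed greater than \<open>1\<close>, and the two equations
  contradict each other at a vector where \<open>\<langle>E v, v\<rangle> = l \<langle>E' v, v\<rangle>\<close>.

  (iv) The threshold bounds the stationary solutions for step \<open>h\<close> uniformly, and by consistency each of
  their limit points as \<open>h\<close> tends to \<open>0\<close> is stationary for \<open>h = 0\<close>, hence is the one in (ii).\<close>

subsection \<open>Matrices and quadratic forms\<close>

text \<open>The flow and all Riccati matrices are definite descriptions, so existence and uniqueness
  have to be proved along with the limits, and for the Riccati equation, quadratic in
  \<open>E\<close>, an a priori bound must come first. It is taken from the scheme, whose values are
  minima over one control vector per step; hence no optimal control in continuous time is ever
  constructed. The one comparison with trajectories that (ii) needs is value at most cost, and
  monotonicity of the Riccati flow in the final matrix is again a limit of the discrete one.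

  That comparison involves trajectories which are only absolutely continuous and differentiable
  almost everywhere, which calls for a one-sided fundamental theorem for them.

  In the uniqueness argument the contradiction comes from the running cost. It does not grow with
  the matrix, whereas \<open>l E'\<close> with \<open>l > 1\<close> would need \<open>l\<close>
  times as much of it; and it is positive since \<open>Q\<close> is positive definite.\<close>

declare transpose_matrix_vector [simp del]

abbreviation quad :: "real^'n^'n \<Rightarrow> real^'n \<Rightarrow> real" where
  "quad M x \<equiv> (M *v x) \<bullet> x"

lemma inner_transpose: "(transpose M *v x) \<bullet> y = x \<bullet> (M *v y)"
  for M :: "real^'n^'m"
  by (simp add: transpose_matrix_vector dot_lmul_matrix)

lemma norm_transpose: "norm (transpose M) = norm M" for M :: "real^'n^'m"
proof -
  have "inner (transpose M) (transpose M) = inner M M"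
    unfolding inner_vec_def transpose_def by (simp add: sum.swap[where A="UNIV::'n set"])
  then show ?thesis by (simp add: norm_eq_sqrt_inner)
qed

text \<open>\<open>norm\<close> is the Frobenius norm, so Cauchy-Schwarz applied row by row
  suffices.\<close>

lemma norm_matrix_vector_le: "norm (M *v x) \<le> norm M * norm x" for M :: "real^'n^'m"
proof -
  have "norm (M *v x) \<le> L2_set (\<lambda>i. norm (M $ i) * norm x) UNIV"
    unfolding norm_vec_def[of "M *v x"]
    by (intro L2_set_mono) (simp_all add: matrix_vector_mul_component Cauchy_Schwarz_ineq2)
  also have "\<dots> = norm M * norm x"
    unfolding norm_vec_def[of M] by (simp add: L2_set_left_distrib)
  finally show ?thesis .
qed

lemma norm_matrix_mult_le: "norm (M ** N) \<le> norm M * norm N"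
  for M :: "real^'n^'m" and N :: "real^'k^'n"
proof -
  have row: "(M ** N) $ i = transpose N *v (M $ i)" for i
    by (simp add: vec_eq_iff matrix_matrix_mult_def matrix_vector_mult_def transpose_def mult.commute)
  have "norm (M ** N) \<le> L2_set (\<lambda>i. norm (M $ i) * norm N) UNIV"
    unfolding norm_vec_def[of "M ** N"]
  proof (rule L2_set_mono)
    show "norm ((M ** N) $ i) \<le> norm (M $ i) * norm N" for i
      using norm_matrix_vector_le[of "transpose N" "M $ i"] by (metis row norm_transpose mult.commute)
  qed simp
  also have "\<dots> = norm M * norm N"
    unfolding norm_vec_def[of M] by (simp add: L2_set_left_distrib)
  finally show ?thesis .
qed

lemma norm_matrix_mult3_le: "norm (M ** N ** K) \<le> norm M * norm N * norm K"
  for M :: "real^'n^'m" and N :: "real^'k^'n" and K :: "real^'l^'k"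
proof -
  have "norm (M ** N ** K) \<le> norm (M ** N) * norm K" by (rule norm_matrix_mult_le)
  also have "\<dots> \<le> norm M * norm N * norm K"
    by (rule mult_right_mono[OF norm_matrix_mult_le]) simp
  finally show ?thesis .
qed

text \<open>All estimates are carried out in the Frobenius norm; the operator norm of the claim
  enters only through this bound.\<close>

lemma opnorm_le_norm: "opnorm M \<le> norm M"
  unfolding opnorm_def by (rule onorm_le) (rule norm_matrix_vector_le)

lemma matrix_diff_ldistrib: "M ** (N - K) = M ** N - M ** K"
  for M :: "real^'n^'m" and N :: "real^'k^'n"
  using matrix_add_ldistrib[of M "N - K" K] by simp

lemma matrix_diff_rdistrib: "(M - N) ** K = M ** K - N ** K"
  for M :: "real^'n^'m" and K :: "real^'k^'n"
  by (simp add: matrix_matrix_mult_def vec_eq_iff sum_subtractf left_diff_distrib)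

lemma matrix_add_rdistrib: "(M + N) ** K = M ** K + N ** K"
  for M :: "real^'n^'m" and K :: "real^'k^'n"
  by (simp add: matrix_matrix_mult_def vec_eq_iff sum.distrib distrib_right)

lemma bounded_bilinear_matrix_mult:
  "bounded_bilinear ((**) :: real^'n^'m \<Rightarrow> real^'k^'n \<Rightarrow> real^'k^'m)"
proof
  show "\<exists>K. \<forall>a b. norm ((a::real^'n^'m) ** (b::real^'k^'n)) \<le> norm a * norm b * K"
    by (rule exI[of _ 1]) (simp add: norm_matrix_mult_le)
qed (simp_all add: matrix_add_ldistrib matrix_add_rdistrib matrix_scalar_ac scalar_matrix_assoc)

lemma bounded_bilinear_matrix_vector_mult:
  "bounded_bilinear ((*v) :: real^'n^'m \<Rightarrow> real^'n \<Rightarrow> real^'m)"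
proof
  show "\<exists>K. \<forall>a b. norm ((a::real^'n^'m) *v b) \<le> norm a * norm b * K"
    by (rule exI[of _ 1]) (simp add: norm_matrix_vector_le)
qed (simp_all add: algebra_simps scaleR_matrix_vector_assoc)

lemma transpose_add: "transpose (M + N) = transpose M + transpose N"
  by (simp add: transpose_def vec_eq_iff)

lemma transpose_diff: "transpose (M - N) = transpose M - transpose N"
  by (simp add: transpose_def vec_eq_iff)

lemma transpose_zero [simp]: "transpose 0 = 0"
  by (simp add: transpose_def vec_eq_iff)

lemma bounded_linear_transpose: "bounded_linear (transpose :: real^'n^'m \<Rightarrow> real^'m^'n)"
  by (rule bounded_linear_intro[of _ 1]) (simp_all add: transpose_add transpose_scalar norm_transpose)

lemmas matrix_mult_tendsto [tendsto_intros] =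
  bounded_bilinear.tendsto[OF bounded_bilinear_matrix_mult]
lemmas matrix_vector_mult_tendsto [tendsto_intros] =
  bounded_bilinear.tendsto[OF bounded_bilinear_matrix_vector_mult]
lemmas transpose_tendsto [tendsto_intros] =
  bounded_linear.tendsto[OF bounded_linear_transpose]
lemmas continuous_on_matrix_mult [continuous_intros] =
  bounded_bilinear.continuous_on[OF bounded_bilinear_matrix_mult]
lemmas continuous_on_matrix_vector_mult [continuous_intros] =
  bounded_bilinear.continuous_on[OF bounded_bilinear_matrix_vector_mult]
lemmas continuous_on_transpose [continuous_intros] =
  bounded_linear.continuous_on[OF bounded_linear_transpose]

lemma quad_add: "quad (M + N) x = quad M x + quad N x"
  by (simp add: matrix_vector_mult_add_rdistrib inner_add_left)

lemma quad_diff: "quad (M - N) x = quad M x - quad N x"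
  by (simp add: matrix_vector_mult_diff_rdistrib inner_diff_left)

lemma quad_scaleR: "quad (c *\<^sub>R M) x = c * quad M x"
  by (simp flip: scaleR_matrix_vector_assoc)

lemma quad_sandwich: "quad (transpose M ** N ** M) x = quad N (M *v x)"
  by (metis inner_transpose inner_commute matrix_mul_assoc matrix_vector_mul_assoc)

lemma sym_inner: "transpose M = M \<Longrightarrow> (M *v x) \<bullet> y = (M *v y) \<bullet> x" for M :: "real^'n^'n"
  by (metis inner_transpose inner_commute)

lemma sym_quad_plus:
  fixes M :: "real^'n^'n"
  assumes "transpose M = M"
  shows "quad M (x + y) = quad M x + 2 * ((M *v x) \<bullet> y) + quad M y"
  using sym_inner[OF assms, of x y] by (simp add: algebra_simps inner_add_left inner_add_right)

text \<open>Equality, bounds and limits of symmetric matrices are all deduced from their quadratic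
  forms by this identity.\<close>

lemma sym_polarization:
  fixes M :: "real^'n^'n"
  assumes "transpose M = M"
  shows "4 * ((M *v x) \<bullet> y) = quad M (x + y) - quad M (x - y)"
  using sym_inner[OF assms, of x y]
  by (simp add: algebra_simps inner_add_left inner_add_right inner_diff_left inner_diff_right)

lemma matrix_entry: "M $ i $ j = (M *v axis j 1) \<bullet> axis i 1" for M :: "real^'n^'m"
  by (simp add: inner_axis matrix_vector_mult_basis column_def)

lemma sym_quad_eqI:
  fixes M :: "real^'n^'n"
  assumes "transpose M = M" "transpose N = N" "\<And>x. quad M x = quad N x"
  shows "M = N"
proof -
  have "4 * ((M *v x) \<bullet> y) = 4 * ((N *v x) \<bullet> y)" for x y
    using assms by (simp add: sym_polarization)
  then show ?thesis by (simp add: vec_eq_iff matrix_entry)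
qed

lemma sym_psdI: "transpose M = M \<Longrightarrow> (\<And>x. 0 \<le> quad M x) \<Longrightarrow> M \<in> sym_psd"
  and sym_psd_transpose: "M \<in> sym_psd \<Longrightarrow> transpose M = M"
  and sym_psd_nonneg: "M \<in> sym_psd \<Longrightarrow> 0 \<le> quad M x"
  by (auto simp: sym_psd_def)

lemma sym_pd_transpose: "M \<in> sym_pd \<Longrightarrow> transpose M = M"
  and sym_pd_pos: "M \<in> sym_pd \<Longrightarrow> x \<noteq> 0 \<Longrightarrow> 0 < quad M x"
  and sym_pd_imp_psd: "M \<in> sym_pd \<Longrightarrow> M \<in> sym_psd"
  unfolding sym_pd_def sym_psd_def by (auto, metis inner_zero_right order.refl order_less_imp_le)

lemma zero_sym_psd [simp]: "0 \<in> sym_psd"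
  by (simp add: sym_psd_def)

lemma sym_psd_add: "M \<in> sym_psd \<Longrightarrow> N \<in> sym_psd \<Longrightarrow> M + N \<in> sym_psd"
  by (simp add: sym_psd_def transpose_add quad_add)

lemma sym_psd_scaleR: "M \<in> sym_psd \<Longrightarrow> 0 \<le> c \<Longrightarrow> c *\<^sub>R M \<in> sym_psd"
  by (simp add: sym_psd_def transpose_scalar quad_scaleR)

lemma convex_sym_psd: "convex sym_psd"
  by (rule convexI) (simp add: sym_psd_add sym_psd_scaleR)

lemma closed_sym_psd: "closed (sym_psd :: (real^'n^'n) set)"
proof -
  have eq: "sym_psd = {M :: real^'n^'n. transpose M = M} \<inter> (\<Inter>x. {M. 0 \<le> quad M x})"
    by (auto simp: sym_psd_def)
  have "closed {M :: real^'n^'n. transpose M = M}"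
    by (intro closed_Collect_eq continuous_intros)
  moreover have "closed (\<Inter>x. {M :: real^'n^'n. 0 \<le> quad M x})"
    by (intro closed_INT ballI closed_Collect_le continuous_intros)
  ultimately show ?thesis unfolding eq by (rule closed_Int)
qed

text \<open>Otherwise the form would be negative at some \<open>v - r M v\<close> with
  \<open>r > 0\<close>, where the term linear in \<open>r\<close> dominates the quadratic
  one.\<close>

lemma sym_psd_kernel:
  fixes M :: "real^'n^'n"
  assumes M: "M \<in> sym_psd" and v: "quad M v = 0"
  shows "M *v v = 0"
proof (rule ccontr)
  assume "M *v v \<noteq> 0"
  define w where "w = M *v v"
  define c where "c = quad M w"
  \<comment> \<open>This makes \<open>w . w\<close> equal to \<open>- s (c + 1)\<close>, so that
    \<open>2 s (w . w) + s^2 c\<close> becomes \<open>- s^2 (c + 2)\<close>; the summand 1 covers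
    \<open>c = 0\<close>.\<close>
  define s where "s = - (w \<bullet> w) / (c + 1)"
  have w: "0 < w \<bullet> w" using \<open>M *v v \<noteq> 0\<close> by (simp add: w_def)
  have c: "0 \<le> c" using M by (simp add: c_def sym_psd_nonneg)
  have "0 \<le> quad M (v + s *\<^sub>R w)" using M by (rule sym_psd_nonneg)
  also have "\<dots> = 2 * s * (w \<bullet> w) + s\<^sup>2 * c"
    by (simp add: sym_quad_plus[OF sym_psd_transpose[OF M]] v[unfolded w_def[symmetric]] w_def[symmetric] c_def
        matrix_vector_mult_scaleR power2_eq_square)
  also have "\<dots> = s\<^sup>2 * (- c - 2)"
  proof -
    have "w \<bullet> w = - s * (c + 1)" using c by (simp add: s_def)
    then show ?thesis by (simp only:) (simp add: power2_eq_square algebra_simps)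
  qed
  also have "\<dots> < 0" using w c by (intro mult_pos_neg) (auto simp: s_def)
  finally show False by simp
qed

text \<open>The Rayleigh quotient of \<open>E\<close> relative to \<open>Z\<close> attains its
  maximum on the compact unit sphere, and both forms are homogeneous of degree 2. For symmetric
  \<open>E\<close> the number \<open>l\<close> is the largest generalised eigenvalue.\<close>

lemma quad_ratio_max:
  fixes E Z :: "real^'n^'n"
  assumes "Z \<in> sym_pd"
  obtains l v where "v \<noteq> 0" "quad E v = l * quad Z v" "\<And>x. quad E x \<le> l * quad Z x"
proof -
  let ?r = "\<lambda>x. quad E x / quad Z x"
  have nz: "quad Z x \<noteq> 0" if "x \<in> sphere 0 1" for x
    using sym_pd_pos[OF assms, of x] that by force
  have "continuous_on (sphere 0 1) ?r"
    using nz by (intro continuous_intros ballI)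
  moreover have "axis undefined 1 \<in> (sphere 0 1 :: (real^'n) set)"
    by simp
  then have "(sphere 0 1 :: (real^'n) set) \<noteq> {}" by blast
  ultimately obtain v where v: "v \<in> sphere 0 1" "\<And>x. x \<in> sphere 0 1 \<Longrightarrow> ?r x \<le> ?r v"
    using continuous_attains_sup[OF compact_sphere, of 0 1 ?r] by blast
  have "v \<noteq> 0" using v(1) by auto
  moreover have "quad E v = ?r v * quad Z v" using nz[OF v(1)] by simp
  moreover have "quad E x \<le> ?r v * quad Z x" for x
  proof (cases "x = 0")
    case False
    define y where "y = x /\<^sub>R norm x"
    have y: "y \<in> sphere 0 1" using False by (simp add: y_def)
    have x: "x = norm x *\<^sub>R y" using False by (simp add: y_def)
    have "quad M (c *\<^sub>R y) = c\<^sup>2 * quad M y" for M :: "real^'n^'n" and c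
      by (simp add: matrix_vector_mult_scaleR power2_eq_square)
    from this[of _ "norm x"] have scale: "quad M x = (norm x)\<^sup>2 * quad M y" for M :: "real^'n^'n"
      by (simp only: x[symmetric])
    have "quad E y \<le> ?r v * quad Z y"
    proof -
      have "0 < quad Z y" using sym_pd_pos[OF assms, of y] y by force
      with v(2)[OF y] show ?thesis by (simp only: pos_divide_le_eq)
    qed
    then have "(norm x)\<^sup>2 * quad E y \<le> (norm x)\<^sup>2 * (?r v * quad Z y)"
      by (intro mult_left_mono) simp_all
    then show ?thesis by (simp only: scale mult.left_commute)
  qed simp
  ultimately show ?thesis by (rule that)
qed

lemma mat_1_sym_pd: "(mat 1 :: real^'n^'n) \<in> sym_pd"
  by (simp add: sym_pd_def)

text \<open>The constant is the least Rayleigh quotient of \<open>M\<close>, obtained from the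
  largest one of \<open>- M\<close> relative to the identity.\<close>

lemma sym_pd_lower_bound:
  fixes M :: "real^'n^'n"
  assumes "M \<in> sym_pd"
  obtains c where "0 < c" "\<And>x. c * (norm x)\<^sup>2 \<le> quad M x"
proof -
  obtain l v where v: "v \<noteq> 0" "quad (- M) v = l * quad (mat 1) v"
      "\<And>x. quad (- M) x \<le> l * quad (mat 1) x"
    using quad_ratio_max[OF mat_1_sym_pd] by metis
  have neg: "quad (- M) x = - quad M x" for x
    using quad_diff[of 0 M x] by simp
  have "l * (norm v)\<^sup>2 < 0"
    using v(2) sym_pd_pos[OF assms v(1)] by (simp add: neg power2_norm_eq_inner)
  then have "l < 0" using v(1) by (simp add: mult_less_0_iff)
  show ?thesis
  proof (rule that[of "- l"])
    show "- l * (norm x)\<^sup>2 \<le> quad M x" for x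
      using v(3)[of x] by (simp add: neg power2_norm_eq_inner)
  qed (use \<open>l < 0\<close> in simp)
qed

lemma quad_le_norm: "quad M x \<le> norm M * (norm x)\<^sup>2"
proof -
  have "quad M x \<le> norm (M *v x) * norm x" by (rule norm_cauchy_schwarz)
  also have "\<dots> \<le> norm M * norm x * norm x"
    by (intro mult_right_mono norm_matrix_vector_le) simp
  finally show ?thesis by (simp add: power2_eq_square)
qed

text \<open>By polarization an entry is a quarter of the difference of two values of the form. Both
  lie between 0 and \<open>4 c\<close>, since the sum and the difference of two unit vectors have
  norm at most 2. The dimension factor comes from adding up all entries.\<close>

lemma sym_psd_norm_le:
  fixes M :: "real^'n^'n"
  assumes M: "M \<in> sym_psd" and c: "\<And>x. quad M x \<le> c * (norm x)\<^sup>2"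
  shows "norm M \<le> real CARD('n) * real CARD('n) * c"
proof -
  have c0: "0 \<le> c"
    using c[of "axis undefined 1"] sym_psd_nonneg[OF M, of "axis undefined 1"] by simp
  have entry: "\<bar>M $ i $ j\<bar> \<le> c" for i j
  proof -
    let ?p = "axis j 1 + axis i 1 :: real^'n" and ?q = "axis j 1 - axis i 1 :: real^'n"
    have "norm ?p \<le> 2" "norm ?q \<le> 2"
      using norm_triangle_ineq[of "axis j 1" "axis i 1 :: real^'n"]
        norm_triangle_ineq4[of "axis j 1" "axis i 1 :: real^'n"] by simp_all
    then have "(norm ?p)\<^sup>2 \<le> 2\<^sup>2" "(norm ?q)\<^sup>2 \<le> 2\<^sup>2"
      by (intro power_mono; simp)+
    then have "c * (norm ?p)\<^sup>2 \<le> c * 4" "c * (norm ?q)\<^sup>2 \<le> c * 4"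
      using c0 by (intro mult_left_mono; simp)+
    then have "quad M ?p \<le> 4 * c" "quad M ?q \<le> 4 * c" "0 \<le> quad M ?p" "0 \<le> quad M ?q"
      using c[of ?p] c[of ?q] sym_psd_nonneg[OF M] by auto
    then show ?thesis
      using sym_polarization[OF sym_psd_transpose[OF M], of "axis j 1" "axis i 1"]
      by (simp add: matrix_entry)
  qed
  have "norm M \<le> (\<Sum>i\<in>UNIV. norm (M $ i))"
    unfolding norm_vec_def by (rule L2_set_le_sum) simp
  also have "\<dots> \<le> (\<Sum>i\<in>(UNIV::'n set). real CARD('n) * c)"
  proof (rule sum_mono)
    fix i
    have "norm (M $ i) \<le> (\<Sum>j\<in>UNIV. \<bar>M $ i $ j\<bar>)" by (rule norm_le_l1_cart)
    also have "\<dots> \<le> real CARD('n) * c" by (rule sum_bounded_above) (rule entry)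
    finally show "norm (M $ i) \<le> real CARD('n) * c" .
  qed
  also have "\<dots> = real CARD('n) * real CARD('n) * c" by simp
  finally show ?thesis .
qed

text \<open>Monotone convergence in the Loewner order: the forms converge pointwise as bounded
  monotone real sequences, and polarization turns this into convergence of the entries. The bound
  \<open>b\<close> survives in the limit.\<close>

lemma sym_psd_incseq_converges:
  fixes f :: "nat \<Rightarrow> real^'n^'n"
  assumes psd: "\<And>k. f k \<in> sym_psd"
    and mono: "\<And>k x. quad (f k) x \<le> quad (f (Suc k)) x"
    and bound: "\<And>k x. quad (f k) x \<le> b x"
  obtains E where "E \<in> sym_psd" "f \<longlonglongrightarrow> E" "\<And>k x. quad (f k) x \<le> quad E x" "\<And>x. quad E x \<le> b x"
proof -
  have conv: "convergent (\<lambda>k. quad (f k) x)" for x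
  proof (rule Bseq_monoseq_convergent)
    show "Bseq (\<lambda>k. quad (f k) x)"
      by (rule BseqI'[of _ "b x"]) (simp add: sym_psd_nonneg psd bound)
    show "monoseq (\<lambda>k. quad (f k) x)"
      by (intro incseq_imp_monoseq incseq_SucI mono)
  qed
  then have "\<exists>q. \<forall>x. (\<lambda>k. quad (f k) x) \<longlonglongrightarrow> q x"
    unfolding convergent_def by metis
  then obtain q where q: "\<And>x. (\<lambda>k. quad (f k) x) \<longlonglongrightarrow> q x"
    by blast
  \<comment> \<open>The entries of the limit matrix, by polarization of the pointwise limit
    \<open>q\<close> of the forms.\<close>
  define l where "l i j = (q (axis j 1 + axis i 1) - q (axis j 1 - axis i 1)) / 4" for i j
  have l: "(\<lambda>k. f k $ i $ j) \<longlonglongrightarrow> l i j" for i j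
  proof -
    have "f k $ i $ j = (quad (f k) (axis j 1 + axis i 1) - quad (f k) (axis j 1 - axis i 1)) / 4" for k
      using sym_polarization[OF sym_psd_transpose[OF psd[of k]], of "axis j 1" "axis i 1"]
      by (simp add: matrix_entry)
    moreover have "(\<lambda>k. (quad (f k) (axis j 1 + axis i 1) - quad (f k) (axis j 1 - axis i 1)) / 4) \<longlonglongrightarrow> l i j"
      unfolding l_def by (intro tendsto_divide tendsto_diff q tendsto_const) simp
    ultimately show ?thesis by presburger
  qed
  define E where "E = (\<chi> i j. l i j)"
  have lim: "f \<longlonglongrightarrow> E"
    unfolding E_def by (intro vec_tendstoI) (simp add: l)
  have quad_lim: "(\<lambda>k. quad (f k) x) \<longlonglongrightarrow> quad E x" for x
    by (intro tendsto_intros lim)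
  show ?thesis
  proof (rule that[of E])
    show "E \<in> sym_psd" using closed_sym_psd psd lim by (rule closed_sequentially)
    show "f \<longlonglongrightarrow> E" by (rule lim)
    show "quad (f k) x \<le> quad E x" for k x
      by (rule incseq_le[OF _ quad_lim]) (rule incseq_SucI, rule mono)
    show "quad E x \<le> b x" for x
      by (rule LIMSEQ_le_const2[OF quad_lim]) (use bound in auto)
  qed
qed

text \<open>\<open>matrix_inv\<close> is a choice operator, so invertibility has to be known first;
  it follows from the trivial kernel of a positive definite matrix.\<close>

lemma sym_pd_inverse:
  fixes N :: "real^'m^'m"
  assumes "N \<in> sym_pd"
  shows "N ** matrix_inv N = mat 1" "matrix_inv N ** N = mat 1"
    "transpose (matrix_inv N) = matrix_inv N"
proof -
  have "N *v x = 0 \<Longrightarrow> x = 0" for x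
    using sym_pd_pos[OF assms, of x] by force
  then have "invertible N"
    unfolding invertible_left_inverse using matrix_left_invertible_ker by blast
  then have "\<exists>N'. N ** N' = mat 1 \<and> N' ** N = mat 1" by (simp add: invertible_def)
  then show 1: "N ** matrix_inv N = mat 1" and 2: "matrix_inv N ** N = mat 1"
    unfolding matrix_inv_def by (rule someI2_ex; simp)+
  have "transpose (matrix_inv N) ** N = mat 1"
    using arg_cong[OF 1, of transpose] by (simp add: matrix_transpose_mul sym_pd_transpose[OF assms])
  then have "(transpose (matrix_inv N) ** N) ** matrix_inv N = matrix_inv N" by simp
  then show "transpose (matrix_inv N) = matrix_inv N"
    by (simp add: 1 flip: matrix_mul_assoc)
qed

lemma sym_pd_inverse_quad_nonneg:
  fixes N :: "real^'m^'m"
  assumes "N \<in> sym_pd"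
  shows "0 \<le> quad (matrix_inv N) x"
proof -
  have "quad (matrix_inv N) x = quad N (matrix_inv N *v x)"
    using quad_sandwich[of "matrix_inv N" N x]
    by (simp add: sym_pd_inverse[OF assms] flip: matrix_mul_assoc)
  then show ?thesis using sym_psd_nonneg[OF sym_pd_imp_psd[OF assms]] by simp
qed

text \<open>With \<open>x = N y\<close>, coercivity gives
  \<open>r |y|^2 \<le> x . y \<le> |x| |y|\<close>, hence \<open>|y| \<le> |x| / r\<close>.\<close>

lemma sym_pd_inverse_norm_le:
  fixes N :: "real^'m^'m"
  assumes N: "N \<in> sym_pd" and r: "0 < r" "\<And>x. r * (norm x)\<^sup>2 \<le> quad N x"
  shows "norm (matrix_inv N) \<le> real CARD('m) * real CARD('m) * (1 / r)"
proof (rule sym_psd_norm_le)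
  show "matrix_inv N \<in> sym_psd"
    by (intro sym_psdI sym_pd_inverse(3) sym_pd_inverse_quad_nonneg N)
  fix x
  define y where "y = matrix_inv N *v x"
  have x: "x = N *v y"
    by (simp add: y_def matrix_vector_mul_assoc sym_pd_inverse(1)[OF N])
  have "r * (norm y)\<^sup>2 \<le> norm x * norm y"
    using r(2)[of y] norm_cauchy_schwarz[of x y] by (simp add: x)
  then have "norm y \<le> norm x / r"
    using r(1) by (cases "y = 0") (simp_all add: power2_eq_square field_simps)
  then have "norm y * norm x \<le> norm x / r * norm x" by (rule mult_right_mono) simp
  then show "quad (matrix_inv N) x \<le> 1 / r * (norm x)\<^sup>2"
    using norm_cauchy_schwarz[of y x] by (simp add: y_def power2_eq_square)
qed

text \<open>The difference of the inverses is
  \<open>matrix_inv (N k) (R - N k) matrix_inv R\<close>. Near \<open>R\<close> the matrices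
  \<open>N k\<close> inherit half of its coercivity constant, so their inverses stay
  bounded.\<close>

lemma tendsto_matrix_inv:
  fixes N :: "'a \<Rightarrow> real^'m^'m"
  assumes lim: "(N \<longlongrightarrow> R) F" and R: "R \<in> sym_pd" and N: "eventually (\<lambda>k. N k \<in> sym_pd) F"
  shows "((\<lambda>k. matrix_inv (N k)) \<longlongrightarrow> matrix_inv R) F"
proof -
  obtain r where r: "0 < r" "\<And>x. r * (norm x)\<^sup>2 \<le> quad R x"
    using sym_pd_lower_bound[OF R] by metis
  define C where "C = real CARD('m) * real CARD('m) * (1 / (r / 2))"
  have "eventually (\<lambda>k. norm (N k - R) < r / 2) F"
    using tendstoD[OF lim, of "r / 2"] r(1) by (simp add: dist_norm)
  with N have "eventually (\<lambda>k. norm (matrix_inv (N k) - matrix_inv R) \<le>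
      C * norm (R - N k) * norm (matrix_inv R)) F"
  proof eventually_elim
    case (elim k)
    have lower: "r / 2 * (norm x)\<^sup>2 \<le> quad (N k) x" for x
    proof -
      have "quad (R - N k) x \<le> norm (N k - R) * (norm x)\<^sup>2"
        using quad_le_norm[of "R - N k" x] by (simp add: norm_minus_commute)
      also have "\<dots> \<le> r / 2 * (norm x)\<^sup>2"
        using elim(2) by (intro mult_right_mono) auto
      finally show ?thesis using r(2)[of x] by (simp add: quad_diff)
    qed
    have "matrix_inv (N k) - matrix_inv R = matrix_inv (N k) ** (R - N k) ** matrix_inv R"
    proof -
      have "matrix_inv (N k) ** (R - N k) ** matrix_inv R
          = matrix_inv (N k) ** (R ** matrix_inv R) - (matrix_inv (N k) ** N k) ** matrix_inv R"
        by (simp add: matrix_diff_ldistrib matrix_diff_rdistrib matrix_mul_assoc)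
      then show ?thesis by (simp add: sym_pd_inverse R elim(1))
    qed
    also have "norm \<dots> \<le> norm (matrix_inv (N k)) * norm (R - N k) * norm (matrix_inv R)"
      by (rule norm_matrix_mult3_le)
    also have "\<dots> \<le> C * norm (R - N k) * norm (matrix_inv R)"
    proof -
      have "norm (matrix_inv (N k)) \<le> C"
        unfolding C_def using r(1) lower by (intro sym_pd_inverse_norm_le[OF elim(1)]) simp_all
      then show ?thesis by (intro mult_right_mono) simp_all
    qed
    finally show ?case .
  qed
  moreover have "((\<lambda>k. C * norm (R - N k) * norm (matrix_inv R)) \<longlongrightarrow> C * norm (R - R) * norm (matrix_inv R)) F"
    by (intro tendsto_intros lim)
  then have "((\<lambda>k. C * norm (R - N k) * norm (matrix_inv R)) \<longlongrightarrow> 0) F"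
    by simp
  ultimately have "((\<lambda>k. matrix_inv (N k) - matrix_inv R) \<longlongrightarrow> 0) F"
    by (rule Lim_null_comparison)
  then show ?thesis by (simp only: LIM_zero_iff)
qed

subsection \<open>Linear differential equations and the state-transition matrix\<close>

text \<open>Picard iteration measured against a growing weight contracts on the whole half-line at
  once, although the Lipschitz constant depends on time; no patching of short intervals is required.
  The second bound on \<open>g\<close> controls the first increment of the iteration.\<close>

lemma picard_exists:
  fixes g :: "real \<Rightarrow> 'a::euclidean_space \<Rightarrow> 'a" and L :: "real \<Rightarrow> real"
  assumes g: "continuous_on ({0..} \<times> UNIV) (\<lambda>(t, y). g t y)"
    and L: "continuous_on {0..} L"
    and lip: "\<And>t x y. 0 \<le> t \<Longrightarrow> norm (g t x - g t y) \<le> L t * norm (x - y)"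
    and bnd: "\<And>t. 0 \<le> t \<Longrightarrow> norm (g t y0) \<le> L t"
  obtains y where "y 0 = y0"
    "\<And>t. 0 \<le> t \<Longrightarrow> (y has_vector_derivative g t (y t)) (at t within {0..})"
proof -
  have L0: "0 \<le> L t" if "0 \<le> t" for t
    using bnd[OF that] norm_ge_zero order_trans by blast
  have L_cont: "continuous_on {0..T} L" for T
    using L by (rule continuous_on_subset) auto
  define P where "P t = integral {0..t} L" for t
  \<comment> \<open>The factor 2 in the exponent gives \<open>p' = 2 L p\<close>, so the integral of
    \<open>L p\<close> is at most \<open>p / 2\<close>: each iteration halves the weighted
    error.\<close>
  define p where "p t = exp (2 * P t)" for t
  have P_deriv: "(P has_real_derivative L t) (at t within {0..T})" if "t \<in> {0..T}" for t T
    unfolding P_def using L_cont that by (rule integral_has_real_derivative)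
  have p_deriv: "(p has_real_derivative 2 * (L t * p t)) (at t within {0..T})" if "t \<in> {0..T}" for t T
    unfolding p_def[abs_def]
    by (rule derivative_eq_intros refl P_deriv[OF that] | simp)+
  have p_cont: "continuous_on {0..T} p" for T
    by (rule DERIV_continuous_on) (rule p_deriv)
  have P0: "0 \<le> P t" if "0 \<le> t" for t
    unfolding P_def using L_cont L0 by (intro integral_nonneg integrable_continuous_real) auto
  have p1: "1 \<le> p t" if "0 \<le> t" for t
    using P0[OF that] by (simp add: p_def)
  have p_mono: "p s \<le> p t" if "0 \<le> s" "s \<le> t" for s t
  proof -
    have "P s \<le> P t" unfolding P_def using that L_cont L0
      by (intro integral_subset_le integrable_continuous_real) auto
    then show ?thesis by (simp add: p_def)
  qed
  have int_Lp: "integral {0..t} (\<lambda>s. L s * p s) \<le> p t / 2" if "0 \<le> t" for t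
  proof -
    have "((\<lambda>s. 2 * (L s * p s)) has_integral (p t - p 0)) {0..t}"
      using p_deriv that
      by (intro fundamental_theorem_of_calculus) (auto simp: has_real_derivative_iff_has_vector_derivative)
    then have "((\<lambda>s. 1 / 2 * (2 * (L s * p s))) has_integral (1 / 2 * (p t - p 0))) {0..t}"
      by (rule has_integral_mult_right)
    then have "((\<lambda>s. L s * p s) has_integral (1 / 2 * (p t - p 0))) {0..t}" by simp
    then show ?thesis using p1[of 0] by (simp add: integral_unique)
  qed
  have Lp_int: "(\<lambda>s. L s * p s * c) integrable_on {0..t}" for t c
    by (intro integrable_continuous_real continuous_intros L_cont p_cont)
  have g_cont: "continuous_on {0..T} (\<lambda>s. g s (w s))" if "continuous_on {0..T} w" for T w
  proof -
    have "continuous_on {0..T} (\<lambda>s. (s, w s))" by (intro continuous_intros that)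
    moreover have "(\<lambda>s. (s, w s)) ` {0..T} \<subseteq> {0..} \<times> UNIV" by auto
    ultimately show ?thesis using continuous_on_compose2[OF g] by fastforce
  qed
  define y where "y = rec_nat (\<lambda>t. y0) (\<lambda>_ w t. y0 + integral {0..t} (\<lambda>s. g s (w s)))"
  have y_0: "y 0 = (\<lambda>t. y0)" and y_Suc: "y (Suc k) = (\<lambda>t. y0 + integral {0..t} (\<lambda>s. g s (y k s)))" for k
    by (simp_all add: y_def)
  have y_cont: "continuous_on {0..T} (y k)" for k T
  proof (induction k)
    case (Suc k)
    then show ?case unfolding y_Suc
      by (intro continuous_intros indefinite_integral_continuous_1 integrable_continuous_real g_cont)
  qed (simp add: y_0)
  have g_int: "(\<lambda>s. g s (y k s)) integrable_on {0..T}" for k T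
    by (intro integrable_continuous_real g_cont y_cont)
  have step: "norm (y (Suc k) t - y k t) \<le> p t * (1 / 2) ^ k" if "0 \<le> t" for k t
    using that
  proof (induction k arbitrary: t)
    case 0
    have "norm (integral {0..t} (\<lambda>s. g s (y 0 s))) \<le> integral {0..t} (\<lambda>s. L s * p s * 1)"
    proof (intro Henstock_Kurzweil_Integration.integral_norm_bound_integral g_int Lp_int)
      fix s assume "s \<in> {0..t}"
      then have "norm (g s y0) \<le> L s * 1" "L s * 1 \<le> L s * p s"
        using bnd[of s] mult_left_mono[OF p1[of s] L0[of s]] by simp_all
      then show "norm (g s (y 0 s)) \<le> L s * p s * 1" by (simp add: y_0)
    qed
    also have "\<dots> \<le> p t" using int_Lp[OF 0] p1[OF 0] by simp
    finally show ?case by (simp add: y_Suc y_0)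
  next
    case (Suc k)
    have "y (Suc (Suc k)) t - y (Suc k) t = integral {0..t} (\<lambda>s. g s (y (Suc k) s) - g s (y k s))"
      by (subst integral_diff[OF g_int g_int]) (simp add: y_Suc[of "Suc k"] y_Suc[of k])
    also have "norm \<dots> \<le> integral {0..t} (\<lambda>s. L s * p s * (1 / 2) ^ k)"
    proof (intro Henstock_Kurzweil_Integration.integral_norm_bound_integral integrable_diff g_int Lp_int)
      fix s assume s: "s \<in> {0..t}"
      have "norm (g s (y (Suc k) s) - g s (y k s)) \<le> L s * norm (y (Suc k) s - y k s)"
        using s by (intro lip) simp
      also have "\<dots> \<le> L s * (p s * (1 / 2) ^ k)"
        using s Suc.IH[of s] L0[of s] by (intro mult_left_mono) auto
      finally show "norm (g s (y (Suc k) s) - g s (y k s)) \<le> L s * p s * (1 / 2) ^ k" by simp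
    qed
    also have "\<dots> = integral {0..t} (\<lambda>s. L s * p s) * (1 / 2) ^ k"
      by (rule integral_mult_left)
    also have "\<dots> \<le> p t / 2 * (1 / 2) ^ k"
      by (intro mult_right_mono int_Lp Suc.prems) simp
    finally show ?case by simp
  qed
  define z where "z t = y0 + (\<Sum>j. y (Suc j) t - y j t)" for t
  have tele: "y0 + (\<Sum>j<k. y (Suc j) t - y j t) = y k t" for k t
    using sum_lessThan_telescope[of "\<lambda>j. y j t" k] by (simp add: y_0)
  have unif: "uniform_limit {0..T} y z sequentially" for T
  proof -
    have "uniform_limit {0..T} (\<lambda>k t. \<Sum>j<k. y (Suc j) t - y j t)
        (\<lambda>t. \<Sum>j. y (Suc j) t - y j t) sequentially"
    proof (rule Weierstrass_m_test)
      show "summable (\<lambda>k. p T * (1 / 2 :: real) ^ k)"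
        by (intro summable_mult summable_geometric) simp
      fix k t assume t: "t \<in> {0..T}"
      have "norm (y (Suc k) t - y k t) \<le> p t * (1 / 2) ^ k" using t by (intro step) simp
      also have "\<dots> \<le> p T * (1 / 2) ^ k" using t by (intro mult_right_mono p_mono) auto
      finally show "norm (y (Suc k) t - y k t) \<le> p T * (1 / 2) ^ k" .
    qed
    from uniform_limit_add[OF uniform_limit_const this, of "\<lambda>_. y0"]
    show ?thesis by (simp add: tele z_def[symmetric])
  qed
  have z_cont: "continuous_on {0..T} z" for T
    by (rule uniform_limit_theorem[OF _ unif]) (auto simp: y_cont)
  have z_eq: "z t = y0 + integral {0..t} (\<lambda>s. g s (z s))" if t: "0 \<le> t" for t
  proof -
    obtain C where C0: "0 \<le> C" and norm_C: "\<And>s. s \<in> {0..t} \<Longrightarrow> norm (L s) \<le> C"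
      by (rule continuous_on_compact_bound[OF compact_Icc L_cont[of t]]) (rule that)
    have C: "L s \<le> C" if "s \<in> {0..t}" for s using norm_C[OF that] by simp
    have "uniform_limit {0..t} (\<lambda>k s. g s (y k s)) (\<lambda>s. g s (z s)) sequentially"
    proof (rule uniform_limitI)
      fix e :: real assume e: "0 < e"
      have "\<forall>\<^sub>F k in sequentially. \<forall>s\<in>{0..t}. dist (y k s) (z s) < e / (C + 1)"
        using e C0 by (intro uniform_limitD[OF unif]) simp
      then show "\<forall>\<^sub>F k in sequentially. \<forall>s\<in>{0..t}. dist (g s (y k s)) (g s (z s)) < e"
      proof eventually_elim
        case (elim k)
        show ?case
        proof
          fix s assume s: "s \<in> {0..t}"
          have "dist (g s (y k s)) (g s (z s)) \<le> L s * dist (y k s) (z s)"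
            unfolding dist_norm using s by (intro lip) simp
          also have "\<dots> \<le> C * dist (y k s) (z s)"
            using C[OF s] by (intro mult_right_mono) simp_all
          also have "\<dots> \<le> C * (e / (C + 1))"
            using elim s by (intro mult_left_mono[OF less_imp_le C0]) blast
          also have "\<dots> < e" using e C0 by (simp add: field_simps)
          finally show "dist (g s (y k s)) (g s (z s)) < e" .
        qed
      qed
    qed
    then obtain I J where IJ: "\<And>k. ((\<lambda>s. g s (y k s)) has_integral I k) {0..t}"
      "((\<lambda>s. g s (z s)) has_integral J) {0..t}" "I \<longlonglongrightarrow> J"
      by (rule uniform_limit_integral) (auto simp: g_cont y_cont)
    have "I k = y (Suc k) t - y0" for k
      using IJ(1)[of k] by (simp add: y_Suc integral_unique)
    moreover have "(\<lambda>k. y (Suc k) t - y0) \<longlonglongrightarrow> z t - y0"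
      using tendsto_uniform_limitI[OF unif[of t], of t] t
      by (intro tendsto_intros LIMSEQ_Suc) simp
    ultimately have "I \<longlonglongrightarrow> z t - y0" by presburger
    then have "J = z t - y0" using IJ(3) LIMSEQ_unique by blast
    then show ?thesis using IJ(2) by (simp add: integral_unique)
  qed
  show ?thesis
  proof (rule that[of z])
    show "z 0 = y0" using z_eq[of 0] by simp
    fix t :: real assume t: "0 \<le> t"
    \<comment> \<open>The interval extends beyond \<open>t\<close>, so that at \<open>t\<close> its
      filter is the one of the half-line.\<close>
    have "((\<lambda>u. integral {0..u} (\<lambda>s. g s (z s))) has_vector_derivative g t (z t)) (at t within {0..t+1})"
      by (rule integral_has_vector_derivative) (use t in \<open>auto intro!: g_cont z_cont\<close>)
    then have "((\<lambda>u. y0 + integral {0..u} (\<lambda>s. g s (z s))) has_vector_derivative g t (z t)) (at t within {0..t+1})"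
      using has_vector_derivative_add[OF has_vector_derivative_const] by fastforce
    then have "(z has_vector_derivative g t (z t)) (at t within {0..t+1})"
      by (rule has_vector_derivative_transform[rotated 2]) (use t z_eq in auto)
    moreover have "at t within {0..t+1} = at t within {0..}"
      by (rule at_within_nhd[of _ "{..<t+1}"]) auto
    ultimately show "(z has_vector_derivative g t (z t)) (at t within {0..})" by simp
  qed
qed

lemmas has_vector_derivative_matrix_mult =
  bounded_bilinear.has_vector_derivative[OF bounded_bilinear_matrix_mult]
lemmas has_vector_derivative_matrix_vector_mult =
  bounded_bilinear.has_vector_derivative[OF bounded_bilinear_matrix_vector_mult]
lemmas has_vector_derivative_transpose =
  bounded_linear.has_vector_derivative[OF bounded_linear_transpose]

lemma linear_matrix_ode_forward:
  fixes A :: "real \<Rightarrow> real^'n^'n"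
  assumes "continuous_on UNIV A"
  obtains X where "X 0 = mat 1"
    "\<And>t. 0 \<le> t \<Longrightarrow> (X has_vector_derivative A t ** X t) (at t within {0..})"
proof -
  let ?c = "1 + norm (mat 1 :: real^'n^'n)"
  have A: "continuous_on S A" for S using assms by (rule continuous_on_subset) simp
  have 1: "continuous_on ({0..} \<times> UNIV) (\<lambda>(t, y). A t ** y)"
    unfolding split_def by (intro continuous_intros continuous_on_compose2[OF assms]) auto
  have 2: "continuous_on {0..} (\<lambda>t. norm (A t) * ?c)"
    by (intro continuous_intros A)
  have 3: "norm (A t ** X - A t ** Y) \<le> norm (A t) * ?c * norm (X - Y)" for t X Y
  proof -
    have "norm (A t ** X - A t ** Y) \<le> norm (A t) * 1 * norm (X - Y)"
      by (simp add: norm_matrix_mult_le flip: matrix_diff_ldistrib)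
    also have "\<dots> \<le> norm (A t) * ?c * norm (X - Y)"
      by (intro mult_right_mono mult_left_mono) auto
    finally show ?thesis .
  qed
  have 4: "norm (A t ** mat 1) \<le> norm (A t) * ?c" for t
    by (simp add: algebra_simps)
  from picard_exists[OF 1 2 3 4] show ?thesis using that by blast
qed

text \<open>Negative times are reached by solving the time-reversed equation forward; the two halves
  are glued at 0, where values and derivatives agree.\<close>

lemma linear_matrix_ode:
  fixes A :: "real \<Rightarrow> real^'n^'n"
  assumes A: "continuous_on UNIV A"
  obtains X where "X 0 = mat 1" "\<And>t. (X has_vector_derivative A t ** X t) (at t)"
proof -
  obtain X where X: "X 0 = mat 1"
      "\<And>t. 0 \<le> t \<Longrightarrow> (X has_vector_derivative A t ** X t) (at t within {0..})"
    using linear_matrix_ode_forward[OF A] by blast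
  have "continuous_on UNIV (\<lambda>t. - A (- t))"
    by (intro continuous_intros continuous_on_compose2[OF A]) auto
  then obtain Y where Y: "Y 0 = mat 1"
      "\<And>t. 0 \<le> t \<Longrightarrow> (Y has_vector_derivative - A (- t) ** Y t) (at t within {0..})"
    using linear_matrix_ode_forward by blast
  have Y': "((\<lambda>t. Y (- t)) has_vector_derivative A t ** Y (- t)) (at t within {..0})" if "t \<le> 0" for t
  proof -
    have "uminus ` {..0::real} = {0..}" by (simp add: image_uminus_atMost)
    then have "((Y \<circ> uminus) has_vector_derivative (- 1) *\<^sub>R (- A (- (- t)) ** Y (- t))) (at t within {..0})"
      using Y(2)[of "- t"] that
      by (intro vector_diff_chain_within) (auto intro!: derivative_eq_intros simp: has_real_derivative_iff_has_vector_derivative[symmetric])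
    moreover have "- 1 *\<^sub>R (- A t ** Y (- t)) = A t ** Y (- t)"
      using scalar_matrix_assoc[of "-1" "- A t" "Y (- t)"] by simp
    ultimately show ?thesis by (simp add: o_def)
  qed
  define W where "W t = (if t \<in> {0..} then X t else Y (- t))" for t
  have "(W has_vector_derivative (if t \<in> {0..} then A t ** X t else A t ** Y (- t))) (at t within UNIV)" for t
    unfolding W_def[abs_def]
    by (rule has_vector_derivative_If_within_closures[where T="{..0}"])
      (use X Y(1) Y' in \<open>auto simp: Un_absorb2 insert_absorb\<close>)
  moreover have "(if t \<in> {0..} then A t ** X t else A t ** Y (- t)) = A t ** W t" for t
    by (simp add: W_def)
  ultimately have "(W has_vector_derivative A t ** W t) (at t)" for t by simp
  moreover have "W 0 = mat 1" using X(1) by (simp add: W_def)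
  ultimately show ?thesis by (rule that[rotated])
qed

text \<open>The inverse \<open>Z\<close> is the transpose of the solution of the adjoint equation
  \<open>W' = - A^T W\<close>. The product \<open>Z X\<close> has derivative zero and is the
  identity at 0, so no derivative of a matrix inverse has to be computed.\<close>

lemma fundamental_matrix_exists:
  fixes A :: "real \<Rightarrow> real^'n^'n"
  assumes A: "continuous_on UNIV A"
  obtains X Z :: "real \<Rightarrow> real^'n^'n" where "\<And>t. (X has_vector_derivative A t ** X t) (at t)"
    "\<And>t. (Z has_vector_derivative - (Z t ** A t)) (at t)"
    "\<And>t. X t ** Z t = mat 1" "\<And>t. Z t ** X t = mat 1"
proof -
  obtain X where X: "X 0 = mat 1" "\<And>t. (X has_vector_derivative A t ** X t) (at t)"
    using linear_matrix_ode[OF A] by blast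
  have "continuous_on UNIV (\<lambda>t. - transpose (A t))" by (intro continuous_intros A)
  then obtain W where W: "W 0 = mat 1"
      "\<And>t. (W has_vector_derivative - transpose (A t) ** W t) (at t)"
    using linear_matrix_ode by blast
  have Z: "((\<lambda>t. transpose (W t)) has_vector_derivative - (transpose (W t) ** A t)) (at t)" for t
  proof -
    have "transpose (- transpose (A t) ** W t) = transpose (W t) ** (- A t)"
      using transpose_diff[of 0 "transpose (A t)"] by (simp add: matrix_transpose_mul)
    also have "\<dots> = - (transpose (W t) ** A t)"
      using matrix_diff_ldistrib[of "transpose (W t)" 0 "A t"] by simp
    finally show ?thesis using has_vector_derivative_transpose[OF W(2)[of t]] by simp
  qed
  have "((\<lambda>t. transpose (W t) ** X t) has_vector_derivative 0) (at t within UNIV)" for t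
  proof -
    have "transpose (W t) ** (A t ** X t) + - (transpose (W t) ** A t) ** X t = 0"
      using matrix_diff_rdistrib[of 0 "transpose (W t) ** A t" "X t"]
      by (simp add: matrix_mul_assoc)
    then show ?thesis
      using has_vector_derivative_matrix_mult[OF Z[of t] X(2)[of t]] by simp
  qed
  then obtain c where "\<And>t. transpose (W t) ** X t = c"
    using has_vector_derivative_zero_constant[of UNIV "\<lambda>t. transpose (W t) ** X t"] by auto
  with X(1) W(1) have ZX: "transpose (W t) ** X t = mat 1" for t
    by (metis matrix_mul_lid transpose_mat)
  then have "X t ** transpose (W t) = mat 1" for t
    using matrix_left_right_inverse by blast
  with X(2) Z ZX show ?thesis by (intro that[of X "\<lambda>t. transpose (W t)"])
qed

text \<open>Multiplication by the inverse fundamental matrix makes \<open>\<Phi>\<close> constant in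
  its first argument, hence equal to its value \<open>Z s\<close> at time \<open>s\<close>.\<close>

lemma transition_matrix_unique:
  fixes A X Z :: "real \<Rightarrow> real^'n^'n"
  assumes Z: "\<And>t. (Z has_vector_derivative - (Z t ** A t)) (at t)" and XZ: "\<And>t. X t ** Z t = mat 1"
    and \<Phi>: "\<And>s. \<Phi> s s = mat 1"
      "\<And>t s. ((\<lambda>\<tau>. \<Phi> \<tau> s) has_vector_derivative A t ** \<Phi> t s) (at t)"
  shows "\<Phi> t s = X t ** Z s"
proof -
  have "((\<lambda>\<tau>. Z \<tau> ** \<Phi> \<tau> s) has_vector_derivative 0) (at \<tau> within UNIV)" for \<tau>
  proof -
    have "Z \<tau> ** (A \<tau> ** \<Phi> \<tau> s) + - (Z \<tau> ** A \<tau>) ** \<Phi> \<tau> s = 0"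
      using matrix_diff_rdistrib[of 0 "Z \<tau> ** A \<tau>" "\<Phi> \<tau> s"] by (simp add: matrix_mul_assoc)
    then show ?thesis
      using has_vector_derivative_matrix_mult[OF Z[of \<tau>], of "\<lambda>\<tau>. \<Phi> \<tau> s" "A \<tau> ** \<Phi> \<tau> s"] \<Phi>(2)
      by simp
  qed
  then obtain c where c: "\<And>\<tau>. Z \<tau> ** \<Phi> \<tau> s = c"
    using has_vector_derivative_zero_constant[of UNIV "\<lambda>\<tau>. Z \<tau> ** \<Phi> \<tau> s"] by auto
  have "Z t ** \<Phi> t s = Z s" using c[of t] c[of s] \<Phi>(1) by simp
  then have "X t ** (Z t ** \<Phi> t s) = X t ** Z s" by simp
  then show ?thesis by (simp add: XZ matrix_mul_assoc)
qed

text \<open>The factorisation makes the joint continuity of the flow in both arguments evident.\<close>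

lemma state_transition_factor:
  fixes A :: "real \<Rightarrow> real^'n^'n"
  assumes A: "continuous_on UNIV A"
  obtains X Z :: "real \<Rightarrow> real^'n^'n" where "continuous_on UNIV X" "continuous_on UNIV Z"
    "\<And>t. (X has_vector_derivative A t ** X t) (at t)"
    "\<And>t. X t ** Z t = mat 1" "\<And>t. Z t ** X t = mat 1"
    "\<And>t s. state_transition A t s = X t ** Z s"
proof -
  obtain X Z :: "real \<Rightarrow> real^'n^'n" where X: "\<And>t. (X has_vector_derivative A t ** X t) (at t)"
    and Z: "\<And>t. (Z has_vector_derivative - (Z t ** A t)) (at t)"
    and XZ: "\<And>t. X t ** Z t = mat 1" and ZX: "\<And>t. Z t ** X t = mat 1"
    using fundamental_matrix_exists[OF A] by blast
  have deriv: "((\<lambda>t. X t ** Z s) has_vector_derivative A t ** (X t ** Z s)) (at t)" for t s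
    using has_vector_derivative_matrix_mult[OF X[of t] has_vector_derivative_const[of "Z s"]]
    by (simp add: matrix_mul_assoc)
  have "state_transition A = (\<lambda>t s. X t ** Z s)"
    unfolding state_transition_def
  proof (rule the_equality)
    show "\<forall>s. X s ** Z s = mat 1 \<and> (\<forall>t. ((\<lambda>\<tau>. X \<tau> ** Z s) has_vector_derivative A t ** (X t ** Z s)) (at t))"
      using XZ deriv by blast
  next
    fix \<Phi> assume \<Phi>: "\<forall>s. \<Phi> s s = mat 1 \<and>
      (\<forall>t. ((\<lambda>\<tau>. \<Phi> \<tau> s) has_vector_derivative A t ** \<Phi> t s) (at t))"
    have "\<Phi> t s = X t ** Z s" for t s
      by (rule transition_matrix_unique[OF Z XZ]) (use \<Phi> in blast)+
    then show "\<Phi> = (\<lambda>t s. X t ** Z s)" by blast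
  qed
  moreover have "continuous_on UNIV X" "continuous_on UNIV Z"
    using X Z by (auto intro!: continuous_at_imp_continuous_on has_vector_derivative_continuous)
  ultimately show ?thesis using X XZ ZX by (intro that[of X Z]) simp_all
qed

subsection \<open>One step of the scheme as a minimisation\<close>

lemma bounded_linear_form: "bounded_linear (\<lambda>M :: real^'m^'n. (M *v u) \<bullet> x)"
  by (intro bounded_linear_compose[OF bounded_linear_inner_left]
      bounded_bilinear.bounded_linear_left[OF bounded_bilinear_matrix_vector_mult])

text \<open>For fixed vectors the bilinear value is a bounded linear function of the matrix. This
  turns the matrix integrals of the scheme into scalar integrals that can be matched with a
  cost.\<close>

lemma integral_form:
  fixes f :: "real \<Rightarrow> real^'m^'n"
  assumes "continuous_on {a..b} f"
  shows "(integral {a..b} f *v u) \<bullet> x = integral {a..b} (\<lambda>\<tau>. (f \<tau> *v u) \<bullet> x)"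
  using integral_linear[OF integrable_continuous_real[OF assms] bounded_linear_form, of u x]
  by (simp add: o_def)

lemma form_transpose_mult: "((transpose M ** N) *v u) \<bullet> x = (N *v u) \<bullet> (M *v x)"
  for M :: "real^'n^'k" and N :: "real^'m^'k"
  by (simp add: inner_transpose flip: matrix_vector_mul_assoc)

lemma matrix_mult_scaleR_right: "M ** (c *\<^sub>R N) = c *\<^sub>R (M ** N)"
  and matrix_mult_scaleR_left: "(c *\<^sub>R M) ** N = c *\<^sub>R (M ** N)"
  for M :: "real^'n^'m" and N :: "real^'k^'n"
  by (simp_all add: matrix_scalar_ac scalar_matrix_assoc)

lemma form_scaleR: "((c *\<^sub>R M) *v u) \<bullet> x = c * ((M *v u) \<bullet> x)"
  for M :: "real^'m^'n"
  by (simp flip: scaleR_matrix_vector_assoc)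

lemma transpose_sandwich: "transpose N = N \<Longrightarrow> transpose (transpose M ** N ** M) = transpose M ** N ** M"
  for N :: "real^'k^'k"
  by (simp add: matrix_transpose_mul matrix_mul_assoc)

lemma transpose_integral:
  fixes f :: "real \<Rightarrow> real^'m^'n"
  assumes "continuous_on {a..b} f"
  shows "transpose (integral {a..b} f) = integral {a..b} (\<lambda>\<tau>. transpose (f \<tau>))"
  using integral_linear[OF integrable_continuous_real[OF assms] bounded_linear_transpose]
  by (simp add: o_def)

section \<open>Linear-quadratic data, flow and input map\<close>

locale lq =
  fixes A :: "real \<Rightarrow> real^'n^'n" and B :: "real \<Rightarrow> real^'m^'n"
    and Q :: "real \<Rightarrow> real^'n^'n" and R :: "real \<Rightarrow> real^'m^'m"
  assumes A_continuous: "continuous_on UNIV A" and B_continuous: "continuous_on UNIV B"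
    and Q_continuous: "continuous_on UNIV Q" and R_continuous: "continuous_on UNIV R"
    and Q_psd: "\<And>t. Q t \<in> sym_psd" and R_pd: "\<And>t. R t \<in> sym_pd"
begin

abbreviation "\<Phi> \<equiv> state_transition A"
abbreviation "\<Gamma> \<equiv> input_map A B"
abbreviation "\<F> \<equiv> ric A B Q R"
abbreviation "E_fin \<equiv> finite_riccati A B Q R"
abbreviation "E_disc \<equiv> discrete_riccati A B Q R"
abbreviation "E_inf \<equiv> infinite_riccati A B Q R"

lemma data_continuous_on [continuous_intros]:
  assumes "continuous_on S f"
  shows "continuous_on S (\<lambda>x. A (f x))" "continuous_on S (\<lambda>x. B (f x))"
    "continuous_on S (\<lambda>x. Q (f x))" "continuous_on S (\<lambda>x. R (f x))"
  using A_continuous B_continuous Q_continuous R_continuous assms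
  by (auto intro: continuous_on_compose2)

lemma data_tendsto:
  assumes "(f \<longlongrightarrow> t) F"
  shows "((\<lambda>k. A (f k)) \<longlongrightarrow> A t) F" "((\<lambda>k. B (f k)) \<longlongrightarrow> B t) F"
    "((\<lambda>k. Q (f k)) \<longlongrightarrow> Q t) F" "((\<lambda>k. R (f k)) \<longlongrightarrow> R t) F"
  using A_continuous B_continuous Q_continuous R_continuous assms
  by (auto intro!: isCont_tendsto_compose[OF _ assms] simp: continuous_on_eq_continuous_at)

lemma Phi_refl: "\<Phi> s s = mat 1"
  using state_transition_factor[OF A_continuous] by metis

lemma Phi_continuous_on [continuous_intros]:
  assumes "continuous_on S f" "continuous_on S g"
  shows "continuous_on S (\<lambda>x. \<Phi> (f x) (g x))"
proof -
  obtain X Z :: "real \<Rightarrow> real^'n^'n" where XZ: "continuous_on UNIV X" "continuous_on UNIV Z"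
    and X: "\<And>t. (X has_vector_derivative A t ** X t) (at t)"
    and inv: "\<And>t. X t ** Z t = mat 1" "\<And>t. Z t ** X t = mat 1"
    and eq: "\<And>t s. \<Phi> t s = X t ** Z s"
    by (rule state_transition_factor[OF A_continuous]) (rule that)
  have "continuous_on S (\<lambda>x. X (f x))" "continuous_on S (\<lambda>x. Z (g x))"
    using XZ assms by (auto intro: continuous_on_compose2)
  then show ?thesis by (simp add: eq continuous_on_matrix_mult)
qed

lemma Phi_has_vector_derivative: "((\<lambda>t. \<Phi> t s) has_vector_derivative A t ** \<Phi> t s) (at t within S)"
proof -
  obtain X Z :: "real \<Rightarrow> real^'n^'n" where cont: "continuous_on UNIV X" "continuous_on UNIV Z"
    and X: "\<And>t. (X has_vector_derivative A t ** X t) (at t)"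
    and inv: "\<And>t. X t ** Z t = mat 1" "\<And>t. Z t ** X t = mat 1"
    and eq: "\<And>t s. \<Phi> t s = X t ** Z s"
    by (rule state_transition_factor[OF A_continuous]) (rule that)
  have "((\<lambda>t. X t ** Z s) has_vector_derivative A t ** (X t ** Z s)) (at t)"
    using has_vector_derivative_matrix_mult[OF X[of t] has_vector_derivative_const[of "Z s"]]
    by (simp add: matrix_mul_assoc)
  then show ?thesis by (simp add: eq has_vector_derivative_at_within)
qed

text \<open>With \<open>X t\<close> pulled out, the integrand no longer depends on the upper end
  \<open>t\<close>, so \<open>\<Gamma>\<close> can be differentiated in \<open>t\<close> by the
  product rule.\<close>

lemma Gamma_factor:
  obtains X W :: "real \<Rightarrow> real^'n^'n"
  where "\<And>t. (X has_vector_derivative A t ** X t) (at t)" "continuous_on UNIV X" "continuous_on UNIV W"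
    "\<And>t. X t ** W t = mat 1" "\<And>s t. \<Gamma> s t = X t ** integral {s..t} (\<lambda>\<xi>. W \<xi> ** B \<xi>)"
proof -
  obtain X Z :: "real \<Rightarrow> real^'n^'n" where cont: "continuous_on UNIV X" "continuous_on UNIV Z"
    and X: "\<And>t. (X has_vector_derivative A t ** X t) (at t)"
    and XZ: "\<And>t. X t ** Z t = mat 1" "\<And>t. Z t ** X t = mat 1"
    and eq: "\<And>t s. \<Phi> t s = X t ** Z s"
    by (rule state_transition_factor[OF A_continuous]) (rule that)
  have "\<Gamma> s t = X t ** integral {s..t} (\<lambda>\<xi>. Z \<xi> ** B \<xi>)" for s t
  proof -
    have "continuous_on {s..t} (\<lambda>\<xi>. Z \<xi> ** B \<xi>)"
      using cont(2) by (intro continuous_intros) (auto intro: continuous_on_subset)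
    from integral_linear[OF integrable_continuous_real[OF this]
        bounded_bilinear.bounded_linear_right[OF bounded_bilinear_matrix_mult, of "X t"]]
    show ?thesis by (simp add: input_map_def eq o_def matrix_mul_assoc)
  qed
  then show ?thesis by (rule that[OF X cont XZ(1)])
qed

lemma Gamma_has_vector_derivative:
  assumes "t \<in> {s..b}"
  shows "((\<lambda>t. \<Gamma> s t) has_vector_derivative A t ** \<Gamma> s t + B t) (at t within {s..b})"
proof -
  obtain X W :: "real \<Rightarrow> real^'n^'n" where X: "\<And>t. (X has_vector_derivative A t ** X t) (at t)"
    and "continuous_on UNIV X" and W: "continuous_on UNIV W" and XW: "\<And>t. X t ** W t = mat 1"
    and eq: "\<And>s t. \<Gamma> s t = X t ** integral {s..t} (\<lambda>\<xi>. W \<xi> ** B \<xi>)"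
    by (rule Gamma_factor) (rule that)
  have "continuous_on {s..b} (\<lambda>\<xi>. W \<xi> ** B \<xi>)"
    using W by (intro continuous_intros) (auto intro: continuous_on_subset)
  then have "((\<lambda>t. integral {s..t} (\<lambda>\<xi>. W \<xi> ** B \<xi>)) has_vector_derivative W t ** B t) (at t within {s..b})"
    using assms by (rule integral_has_vector_derivative)
  from has_vector_derivative_matrix_mult[OF has_vector_derivative_at_within[OF X] this]
  show ?thesis by (simp add: eq matrix_mul_assoc XW add.commute)
qed

lemma Gamma_continuous_on: "continuous_on {s..b} (\<Gamma> s)"
  using Gamma_has_vector_derivative by (rule continuous_on_vector_derivative)

lemma Gamma_refl: "\<Gamma> s s = 0"
  by (simp add: input_map_def)

lemma transpose_Gamma:
  "integral {s..t} (\<lambda>\<xi>. transpose (B \<xi>) ** transpose (\<Phi> t \<xi>)) = transpose (\<Gamma> s t)"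
  unfolding input_map_def
  by (subst transpose_integral) (auto intro!: continuous_intros simp: matrix_transpose_mul)

text \<open>Variation of constants: the state at time \<open>t\<close> when the system starts in
  \<open>x\<close> at time \<open>s\<close> and the control is constantly \<open>u\<close>.\<close>

definition "state s x u t = \<Phi> t s *v x + \<Gamma> s t *v u"

definition "stage_cost s t x u = integral {s..t} (\<lambda>\<tau>. quad (Q \<tau>) (state s x u \<tau>) + quad (R \<tau>) u)"

text \<open>The map called \<open>S\<close> in the overview. The time argument is the right end of
  the step, so one application goes from \<open>t\<close> back to \<open>t - h\<close>.\<close>

definition "back t h E = E - h *\<^sub>R \<F> t E h"

lemma state_has_vector_derivative:
  assumes "t \<in> {s..b}"
  shows "(state s x u has_vector_derivative A t *v state s x u t + B t *v u) (at t within {s..b})"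
  unfolding state_def[abs_def]
  using has_vector_derivative_add[OF
      has_vector_derivative_matrix_vector_mult[OF Phi_has_vector_derivative has_vector_derivative_const]
      has_vector_derivative_matrix_vector_mult[OF Gamma_has_vector_derivative[OF assms] has_vector_derivative_const]]
  by (simp add: algebra_simps matrix_vector_mul_assoc)

lemma state_continuous_on: "continuous_on {s..b} (state s x u)"
  using state_has_vector_derivative by (rule continuous_on_vector_derivative)

lemma state_refl: "state s x u s = x"
  by (simp add: state_def Phi_refl Gamma_refl)

lemma stage_cost_integrable:
  "(\<lambda>\<tau>. quad (Q \<tau>) (state s x u \<tau>) + quad (R \<tau>) u) integrable_on {s..t}"
  by (intro integrable_continuous_real continuous_intros state_continuous_on)

lemma stage_cost_nonneg: "0 \<le> stage_cost s t x u"
  unfolding stage_cost_def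
  by (intro integral_nonneg stage_cost_integrable add_nonneg_nonneg sym_psd_nonneg Q_psd sym_pd_imp_psd R_pd)

text \<open>Definiteness comes from the average of \<open>R\<close>; the other two summands are a
  congruence and an average of congruences of positive semi-definite matrices.\<close>

lemma ricN_sym_pd:
  assumes h: "0 < h" and E: "E \<in> sym_psd"
  shows "ricN1 R t E h + ricN2 A B Q t E h + ricN3 A B t E h \<in> sym_pd"
proof -
  let ?s = "t - h"
  note G = Gamma_continuous_on[of ?s t]
  have N2: "ricN2 A B Q t E h = (1 / h) *\<^sub>R integral {?s..t} (\<lambda>\<tau>. transpose (\<Gamma> ?s \<tau>) ** Q \<tau> ** \<Gamma> ?s \<tau>)"
    using h by (simp add: ricN2_def transpose_Gamma)
  have N3: "ricN3 A B t E h = (1 / h) *\<^sub>R (transpose (\<Gamma> ?s t) ** E ** \<Gamma> ?s t)"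
    using h by (simp add: ricN3_def transpose_Gamma)
  have N1: "ricN1 R t E h = (1 / h) *\<^sub>R integral {?s..t} R"
    using h by (simp add: ricN1_def)
  have c2: "continuous_on {?s..t} (\<lambda>\<tau>. transpose (\<Gamma> ?s \<tau>) ** Q \<tau> ** \<Gamma> ?s \<tau>)"
    by (intro continuous_intros G)
  have c1: "continuous_on {?s..t} R"
    using R_continuous by (rule continuous_on_subset) simp
  have tr: "transpose (ricN1 R t E h) = ricN1 R t E h" "transpose (ricN2 A B Q t E h) = ricN2 A B Q t E h"
    "transpose (ricN3 A B t E h) = ricN3 A B t E h"
    unfolding N1 N2 N3 transpose_scalar transpose_integral[OF c1] transpose_integral[OF c2]
    by (simp_all add: transpose_sandwich sym_psd_transpose[OF Q_psd] sym_psd_transpose[OF E] sym_pd_transpose[OF R_pd])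
  have q2: "0 \<le> quad (ricN2 A B Q t E h) u" for u
    unfolding N2 quad_scaleR integral_form[OF c2] quad_sandwich using h
    by (intro mult_nonneg_nonneg integral_nonneg integrable_continuous_real continuous_intros G sym_psd_nonneg Q_psd) simp
  have q3: "0 \<le> quad (ricN3 A B t E h) u" for u
    unfolding N3 quad_scaleR quad_sandwich using h by (simp add: sym_psd_nonneg[OF E])
  have q1: "0 < quad (ricN1 R t E h) u" if u: "u \<noteq> 0" for u
  proof -
    have cont: "continuous_on {?s..t} (\<lambda>\<tau>. quad (R \<tau>) u)"
      by (intro continuous_intros)
    have "{?s..t} \<noteq> {}" using h by simp
    \<comment> \<open>The minimum of a continuous positive function on a compact interval is
      positive and bounds the integral from below.\<close>
    then obtain \<tau>0 where "\<And>\<tau>. \<tau> \<in> {?s..t} \<Longrightarrow> quad (R \<tau>0) u \<le> quad (R \<tau>) u"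
      using continuous_attains_inf[OF compact_Icc _ cont] by blast
    then have "integral {?s..t} (\<lambda>_. quad (R \<tau>0) u) \<le> integral {?s..t} (\<lambda>\<tau>. quad (R \<tau>) u)"
      by (intro integral_le integrable_continuous_real cont continuous_intros) auto
    then have "h * quad (R \<tau>0) u \<le> integral {?s..t} (\<lambda>\<tau>. quad (R \<tau>) u)"
      using h by simp
    moreover have "0 < h * quad (R \<tau>0) u"
      using h u by (simp add: sym_pd_pos[OF R_pd])
    ultimately show ?thesis
      using h unfolding N1 quad_scaleR integral_form[OF c1] by simp
  qed
  show ?thesis
    unfolding sym_pd_def using tr q1 q2 q3
    by (simp add: transpose_add quad_add add_pos_nonneg)
qed

text \<open>The value \<open>back t h E\<close> is obtained from the cost of a constant control on \<open>[t - h, t]\<close>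
  by completing the square in the control.\<close>

lemma back_quad:
  assumes h: "0 < h" and E: "E \<in> sym_psd"
  obtains N w where "N \<in> sym_pd"
    "\<And>u. quad (back t h E) x + h * quad N (u + w)
      = stage_cost (t - h) t x u + quad E (state (t - h) x u t)"
proof -
  let ?s = "t - h"
  note G = Gamma_continuous_on[of ?s t]
  define M where "M = ricM1 A B t E h + ricM2 A B Q t E h"
  define N where "N = ricN1 R t E h + ricN2 A B Q t E h + ricN3 A B t E h"
  \<comment> \<open>The control \<open>- w\<close> is the minimiser: \<open>N w = M^T x\<close> is
    what makes the cross term of the cost part of a square.\<close>
  define w where "w = matrix_inv N *v (transpose M *v x)"
  have N: "N \<in> sym_pd" unfolding N_def using h E by (rule ricN_sym_pd)
  have Nw: "N *v w = transpose M *v x"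
    unfolding w_def
    by (subst matrix_vector_mul_assoc) (simp add: sym_pd_inverse(1)[OF N])
  have square: "quad N (u + w) = quad N u + 2 * ((M *v u) \<bullet> x) + quad (M ** matrix_inv N ** transpose M) x" for u
  proof -
    have "quad N (w + u) = quad N w + 2 * ((N *v w) \<bullet> u) + quad N u"
      by (rule sym_quad_plus[OF sym_pd_transpose[OF N]])
    moreover have "quad N w = quad (M ** matrix_inv N ** transpose M) x"
      by (simp add: Nw inner_transpose)
        (simp add: w_def matrix_vector_mul_assoc matrix_mul_assoc inner_commute[of x])
    moreover have "(N *v w) \<bullet> u = (M *v u) \<bullet> x"
      unfolding Nw inner_transpose by (rule inner_commute)
    ultimately show ?thesis by (simp add: add.commute)
  qed
  \<comment> \<open>Multiplied by \<open>h\<close>, the blocks of \<open>\<F>\<close> lose their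
    averaging factor and become the terms into which the cost splits.\<close>
  have hM1: "h * ((ricM1 A B t E h *v u) \<bullet> x) = (E *v (\<Gamma> ?s t *v u)) \<bullet> (\<Phi> t ?s *v x)" for u
    using h by (simp add: ricM1_def matrix_mult_scaleR_right form_scaleR form_transpose_mult
        flip: matrix_mul_assoc) (simp add: matrix_vector_mul_assoc)
  have "continuous_on {?s..t} (\<lambda>\<tau>. transpose (\<Phi> \<tau> ?s) ** Q \<tau> ** \<Gamma> ?s \<tau>)"
    by (intro continuous_intros G)
  from integral_form[OF this]
  have hM2: "h * ((ricM2 A B Q t E h *v u) \<bullet> x)
      = integral {?s..t} (\<lambda>\<tau>. (Q \<tau> *v (\<Gamma> ?s \<tau> *v u)) \<bullet> (\<Phi> \<tau> ?s *v x))" for u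
    using h by (simp add: ricM2_def form_scaleR form_transpose_mult
        flip: matrix_mul_assoc) (simp add: matrix_vector_mul_assoc)
  have "continuous_on {?s..t} R"
    using R_continuous by (rule continuous_on_subset) simp
  from integral_form[OF this]
  have hN1: "h * quad (ricN1 R t E h) u = integral {?s..t} (\<lambda>\<tau>. quad (R \<tau>) u)" for u
    using h by (simp add: ricN1_def quad_scaleR)
  have "continuous_on {?s..t} (\<lambda>\<tau>. transpose (\<Gamma> ?s \<tau>) ** Q \<tau> ** \<Gamma> ?s \<tau>)"
    by (intro continuous_intros G)
  from integral_form[OF this]
  have hN2: "h * quad (ricN2 A B Q t E h) u = integral {?s..t} (\<lambda>\<tau>. quad (Q \<tau>) (\<Gamma> ?s \<tau> *v u))" for u
    using h by (simp add: ricN2_def quad_scaleR transpose_Gamma quad_sandwich)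
  have hN3: "h * quad (ricN3 A B t E h) u = quad E (\<Gamma> ?s t *v u)" for u
    using h by (simp add: ricN3_def quad_scaleR transpose_Gamma quad_sandwich)
  have "continuous_on {?s..t} (\<lambda>\<tau>. transpose (\<Phi> \<tau> ?s) ** Q \<tau> ** \<Phi> \<tau> ?s)"
    by (intro continuous_intros)
  from integral_form[OF this]
  have hG1: "h * quad (ricG1 A Q t E h) x = integral {?s..t} (\<lambda>\<tau>. quad (Q \<tau>) (\<Phi> \<tau> ?s *v x))"
    using h by (simp add: ricG1_def quad_scaleR quad_sandwich)
  have hG2: "h * quad (ricG2 A t E h) x = quad E (\<Phi> t ?s *v x) - quad E x"
    using h by (simp add: ricG2_def quad_scaleR quad_sandwich quad_diff)
  have cost: "stage_cost ?s t x u =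
      integral {?s..t} (\<lambda>\<tau>. quad (Q \<tau>) (\<Phi> \<tau> ?s *v x))
      + 2 * integral {?s..t} (\<lambda>\<tau>. (Q \<tau> *v (\<Gamma> ?s \<tau> *v u)) \<bullet> (\<Phi> \<tau> ?s *v x))
      + integral {?s..t} (\<lambda>\<tau>. quad (Q \<tau>) (\<Gamma> ?s \<tau> *v u))
      + integral {?s..t} (\<lambda>\<tau>. quad (R \<tau>) u)" for u
  proof -
    have "quad (Q \<tau>) (state ?s x u \<tau>) + quad (R \<tau>) u = quad (Q \<tau>) (\<Phi> \<tau> ?s *v x)
      + 2 * ((Q \<tau> *v (\<Gamma> ?s \<tau> *v u)) \<bullet> (\<Phi> \<tau> ?s *v x))
      + quad (Q \<tau>) (\<Gamma> ?s \<tau> *v u) + quad (R \<tau>) u" for \<tau>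
      unfolding state_def
      using sym_quad_plus[OF sym_psd_transpose[OF Q_psd], of \<tau> "\<Gamma> ?s \<tau> *v u" "\<Phi> \<tau> ?s *v x"]
      by (simp add: add_ac)
    moreover have "((\<lambda>\<tau>. quad (Q \<tau>) (\<Phi> \<tau> ?s *v x)
      + 2 * ((Q \<tau> *v (\<Gamma> ?s \<tau> *v u)) \<bullet> (\<Phi> \<tau> ?s *v x))
      + quad (Q \<tau>) (\<Gamma> ?s \<tau> *v u) + quad (R \<tau>) u) has_integral
      (integral {?s..t} (\<lambda>\<tau>. quad (Q \<tau>) (\<Phi> \<tau> ?s *v x))
      + 2 * integral {?s..t} (\<lambda>\<tau>. (Q \<tau> *v (\<Gamma> ?s \<tau> *v u)) \<bullet> (\<Phi> \<tau> ?s *v x))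
      + integral {?s..t} (\<lambda>\<tau>. quad (Q \<tau>) (\<Gamma> ?s \<tau> *v u))
      + integral {?s..t} (\<lambda>\<tau>. quad (R \<tau>) u))) {?s..t}"
      by (intro has_integral_add has_integral_mult_right integrable_integral
          integrable_continuous_real continuous_intros G)
    ultimately show ?thesis
      unfolding stage_cost_def by (simp add: integral_unique)
  qed
  have final: "quad E (state ?s x u t) = quad E (\<Phi> t ?s *v x)
      + 2 * ((E *v (\<Gamma> ?s t *v u)) \<bullet> (\<Phi> t ?s *v x)) + quad E (\<Gamma> ?s t *v u)" for u
    unfolding state_def
    using sym_quad_plus[OF sym_psd_transpose[OF E], of "\<Gamma> ?s t *v u" "\<Phi> t ?s *v x"]
    by (simp add: add_ac)
  have "quad (back t h E) x + h * quad N (u + w)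
      = stage_cost ?s t x u + quad E (state ?s x u t)" for u
  proof -
    have "quad (back t h E) x = quad E x - h * quad (M ** matrix_inv N ** transpose M) x
        + h * quad (ricG1 A Q t E h) x + h * quad (ricG2 A t E h) x"
      by (simp add: back_def ric_def Let_def M_def N_def quad_diff quad_add quad_scaleR algebra_simps)
    moreover have "h * quad N u = h * quad (ricN1 R t E h) u + h * quad (ricN2 A B Q t E h) u
        + h * quad (ricN3 A B t E h) u"
      by (simp add: N_def quad_add algebra_simps)
    moreover have "h * ((M *v u) \<bullet> x) = h * ((ricM1 A B t E h *v u) \<bullet> x) + h * ((ricM2 A B Q t E h *v u) \<bullet> x)"
      by (simp add: M_def matrix_vector_mult_add_rdistrib inner_add_left algebra_simps)
    ultimately show ?thesis
      unfolding square cost final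
      using hM1[of u] hM2[of u] hN1[of u] hN2[of u] hN3[of u] hG1 hG2
      by (simp add: algebra_simps)
  qed
  with N show ?thesis by (rule that)
qed

lemma back_le:
  assumes "0 < h" "E \<in> sym_psd"
  shows "quad (back t h E) x \<le> stage_cost (t - h) t x u + quad E (state (t - h) x u t)"
proof -
  obtain N w where N: "N \<in> sym_pd" and eq: "\<And>u. quad (back t h E) x + h * quad N (u + w)
      = stage_cost (t - h) t x u + quad E (state (t - h) x u t)"
    using back_quad[OF assms] by blast
  have "0 \<le> h * quad N (u + w)"
    using assms(1) sym_psd_nonneg[OF sym_pd_imp_psd[OF N]] by simp
  with eq[of u] show ?thesis by linarith
qed

lemma back_attained:
  assumes "0 < h" "E \<in> sym_psd"
  obtains u where "quad (back t h E) x = stage_cost (t - h) t x u + quad E (state (t - h) x u t)"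
proof -
  obtain N :: "real^'m^'m" and w where eq: "\<And>u. quad (back t h E) x + h * quad N (u + w)
      = stage_cost (t - h) t x u + quad E (state (t - h) x u t)"
    using back_quad[OF assms] by blast
  show ?thesis by (rule that[of "- w"]) (use eq[of "- w"] in simp)
qed

text \<open>Nonnegativity is read off the attained minimum, a sum of nonnegative costs; symmetry is
  visible only in the formula.\<close>

lemma back_psd:
  assumes h: "0 < h" and E: "E \<in> sym_psd"
  shows "back t h E \<in> sym_psd"
proof (rule sym_psdI)
  show "0 \<le> quad (back t h E) x" for x
  proof -
    obtain u where "quad (back t h E) x = stage_cost (t - h) t x u + quad E (state (t - h) x u t)"
      using back_attained[OF assms] by blast
    then show ?thesis using stage_cost_nonneg sym_psd_nonneg[OF E] by simp
  qed
  let ?N = "ricN1 R t E h + ricN2 A B Q t E h + ricN3 A B t E h"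
  have c1: "continuous_on {t-h..t} (\<lambda>\<tau>. transpose (\<Phi> \<tau> (t-h)) ** Q \<tau> ** \<Phi> \<tau> (t-h))"
    by (intro continuous_intros)
  have "transpose (ricG1 A Q t E h) = ricG1 A Q t E h"
    using h unfolding ricG1_def
    by (simp add: transpose_scalar transpose_integral[OF c1] transpose_sandwich sym_psd_transpose[OF Q_psd])
  moreover have "transpose (ricG2 A t E h) = ricG2 A t E h"
    using h unfolding ricG2_def
    by (simp add: transpose_scalar transpose_diff transpose_sandwich sym_psd_transpose[OF E])
  moreover have "transpose (matrix_inv ?N) = matrix_inv ?N"
    using ricN_sym_pd[OF assms] by (rule sym_pd_inverse(3))
  ultimately show "transpose (back t h E) = back t h E"
    unfolding back_def ric_def Let_def
    by (simp add: transpose_diff transpose_add transpose_scalar sym_psd_transpose[OF E]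
        matrix_transpose_mul matrix_mul_assoc)
qed

text \<open>The optimal control for the larger final cost is a competitor for the smaller
  one.\<close>

lemma back_mono:
  assumes "0 < h" "E \<in> sym_psd" "E' \<in> sym_psd" "\<And>x. quad E x \<le> quad E' x"
  shows "quad (back t h E) x \<le> quad (back t h E') x"
proof -
  obtain u where "quad (back t h E') x = stage_cost (t - h) t x u + quad E' (state (t - h) x u t)"
    using back_attained[OF assms(1,3)] by blast
  then show ?thesis
    using back_le[OF assms(1,2), of t x u] assms(4)[of "state (t - h) x u t"] by linarith
qed

end

subsection \<open>Consistency of the scheme\<close>

text \<open>The second argument of \<open>f\<close> carries an end of the interval, as in
  \<open>\<Phi> \<tau> (t - h)\<close> or \<open>\<Phi> t \<xi>\<close>. The limit is taken along
  the full neighbourhood filter of the diagonal point, so that it controls every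
  \<open>\<tau>\<close> of the interval, also at \<open>\<tau> = t0\<close>.\<close>

lemma average_tendsto:
  fixes f :: "real \<Rightarrow> real \<Rightarrow> 'a::euclidean_space"
  assumes t: "(t \<longlongrightarrow> t0) F" and p: "(p \<longlongrightarrow> t0) F"
    and h: "(h \<longlongrightarrow> 0) F" "\<forall>\<^sub>F k in F. 0 < h k"
    and f: "((\<lambda>x. f (fst x) (snd x)) \<longlongrightarrow> l) (nhds (t0, t0))"
    and cont: "\<forall>\<^sub>F k in F. continuous_on {t k - h k..t k} (\<lambda>\<tau>. f \<tau> (p k))"
  shows "((\<lambda>k. (1 / h k) *\<^sub>R integral {t k - h k..t k} (\<lambda>\<tau>. f \<tau> (p k))) \<longlongrightarrow> l) F"
proof (rule tendstoI)
  fix e :: real assume e: "0 < e"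
  have "\<forall>\<^sub>F x in nhds (t0, t0). dist (f (fst x) (snd x)) l < e / 2"
    using tendstoD[OF f, of "e / 2"] e by simp
  then obtain d where d: "0 < d" "\<And>x. dist x (t0, t0) < d \<Longrightarrow> dist (f (fst x) (snd x)) l < e / 2"
    unfolding eventually_nhds_metric by blast
  \<comment> \<open>A point of the interval is within \<open>|h k| + |t k - t0| < d / 2\<close> of
    \<open>t0\<close>, and the pair with \<open>p k\<close> is then within \<open>d\<close> of the
    diagonal point.\<close>
  have "\<forall>\<^sub>F k in F. dist (t k) t0 < d / 4" "\<forall>\<^sub>F k in F. dist (p k) t0 < d / 4" "\<forall>\<^sub>F k in F. dist (h k) 0 < d / 4"
    using tendstoD[OF t, of "d / 4"] tendstoD[OF p, of "d / 4"] tendstoD[OF h(1), of "d / 4"] d(1)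
    by simp_all
  with h(2) cont
  show "\<forall>\<^sub>F k in F. dist ((1 / h k) *\<^sub>R integral {t k - h k..t k} (\<lambda>\<tau>. f \<tau> (p k))) l < e"
  proof eventually_elim
    case (elim k)
    have near: "norm (f \<tau> (p k) - l) \<le> e / 2" if "\<tau> \<in> {t k - h k..t k}" for \<tau>
    proof -
      have "\<bar>\<tau> - t0\<bar> < d / 2" using that elim by (simp add: dist_real_def abs_if split: if_splits)
      moreover have "\<bar>p k - t0\<bar> < d / 2" using elim d(1) by (simp add: dist_real_def)
      ultimately have "norm (\<tau> - t0, p k - t0) < d"
        using norm_Pair_le[of "\<tau> - t0" "p k - t0"] by simp
      then show ?thesis using d(2)[of "(\<tau>, p k)"] by (simp add: dist_norm)
    qed
    have "norm (integral {t k - h k..t k} (\<lambda>\<tau>. f \<tau> (p k) - l)) \<le> e / 2 * (t k - (t k - h k))"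
      using elim near by (intro integral_bound continuous_intros) auto
    moreover have "integral {t k - h k..t k} (\<lambda>\<tau>. f \<tau> (p k) - l)
        = integral {t k - h k..t k} (\<lambda>\<tau>. f \<tau> (p k)) - h k *\<^sub>R l"
      using elim by (subst integral_diff) (auto intro!: integrable_continuous_real)
    ultimately have le: "norm (integral {t k - h k..t k} (\<lambda>\<tau>. f \<tau> (p k)) - h k *\<^sub>R l) \<le> e / 2 * h k"
      by simp
    have "(1 / h k) *\<^sub>R integral {t k - h k..t k} (\<lambda>\<tau>. f \<tau> (p k)) - l
        = (1 / h k) *\<^sub>R (integral {t k - h k..t k} (\<lambda>\<tau>. f \<tau> (p k)) - h k *\<^sub>R l)"
      using elim by (simp add: scaleR_diff_right)
    then have "norm ((1 / h k) *\<^sub>R integral {t k - h k..t k} (\<lambda>\<tau>. f \<tau> (p k)) - l) \<le> 1 / h k * (e / 2 * h k)"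
      using le elim by (simp add: divide_simps)
    also have "\<dots> < e" using elim e by simp
    finally show ?case by (simp add: dist_norm)
  qed
qed

context lq
begin

lemma Phi_tendsto_nhds: "((\<lambda>x. \<Phi> (fst x) (snd x)) \<longlongrightarrow> \<Phi> t s) (nhds (t, s))"
proof -
  have "continuous_on UNIV (\<lambda>x. \<Phi> (fst x) (snd x))"
    by (intro continuous_intros)
  then have "isCont (\<lambda>x. \<Phi> (fst x) (snd x)) (t, s)"
    by (simp add: continuous_on_eq_continuous_at)
  then show ?thesis
    using tendsto_at_iff_tendsto_nhds[of "\<lambda>x. \<Phi> (fst x) (snd x)" "(t, s)"] by (simp add: isCont_def)
qed

lemma Phi_tendsto:
  assumes "(f \<longlongrightarrow> t) F" "(g \<longlongrightarrow> s) F"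
  shows "((\<lambda>k. \<Phi> (f k) (g k)) \<longlongrightarrow> \<Phi> t s) F"
  using filterlim_compose[OF Phi_tendsto_nhds tendsto_Pair[OF assms]] by simp

text \<open>An integral over an empty interval is 0, so the bound holds for \<open>t < s\<close> as
  well. This makes it usable on a full neighbourhood of a diagonal point.\<close>

lemma Gamma_bound:
  obtains C where "0 \<le> C" "\<And>s t. s \<in> {a..b} \<Longrightarrow> t \<in> {a..b} \<Longrightarrow> norm (\<Gamma> s t) \<le> C * \<bar>t - s\<bar>"
proof -
  let ?f = "\<lambda>x. \<Phi> (fst x) (snd x) ** B (snd x)"
  have "continuous_on ({a..b} \<times> {a..b}) ?f" by (intro continuous_intros)
  then obtain C where C0: "0 \<le> C" and bound: "\<And>x. x \<in> {a..b} \<times> {a..b} \<Longrightarrow> norm (?f x) \<le> C"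
    by (rule continuous_on_compact_bound[OF compact_Times[OF compact_Icc compact_Icc]]) (rule that)
  have C: "norm (\<Phi> t \<xi> ** B \<xi>) \<le> C" if "t \<in> {a..b}" "\<xi> \<in> {a..b}" for t \<xi>
    using bound[of "(t, \<xi>)"] that by simp
  show ?thesis
  proof (rule that[OF C0])
    fix s t assume s: "s \<in> {a..b}" and t: "t \<in> {a..b}"
    show "norm (\<Gamma> s t) \<le> C * \<bar>t - s\<bar>"
    proof (cases "s \<le> t")
      case True
      have "norm (\<Gamma> s t) \<le> C * (t - s)"
        unfolding input_map_def
      proof (rule integral_bound[OF True])
        show "continuous_on {s..t} (\<lambda>\<xi>. \<Phi> t \<xi> ** B \<xi>)" by (intro continuous_intros)
        show "norm (\<Phi> t \<xi> ** B \<xi>) \<le> C" if "\<xi> \<in> {s..t}" for \<xi>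
          using s t that by (intro C) simp_all
      qed
      then show ?thesis using True by simp
    qed (simp add: input_map_def C0)
  qed
qed

lemma Gamma_tendsto_nhds: "((\<lambda>x. \<Gamma> (snd x) (fst x)) \<longlongrightarrow> 0) (nhds (t, t))"
proof -
  obtain C where C: "0 \<le> C"
    "\<And>s \<tau>. s \<in> {t-1..t+1} \<Longrightarrow> \<tau> \<in> {t-1..t+1} \<Longrightarrow> norm (\<Gamma> s \<tau>) \<le> C * \<bar>\<tau> - s\<bar>"
    by (rule Gamma_bound) (rule that)
  have "\<forall>\<^sub>F x in nhds (t, t). dist x (t, t) < 1"
    unfolding eventually_nhds_metric by (rule exI[of _ 1]) simp
  then have "\<forall>\<^sub>F x in nhds (t, t). norm (\<Gamma> (snd x) (fst x)) \<le> C * \<bar>fst x - snd x\<bar>"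
  proof eventually_elim
    case (elim x)
    have "dist (fst x) t < 1" "dist (snd x) t < 1"
      using elim dist_fst_le[of x "(t, t)"] dist_snd_le[of x "(t, t)"] by auto
    then show ?case by (intro C(2)) (auto simp: dist_real_def)
  qed
  moreover have "((\<lambda>x. C * \<bar>fst x - snd x\<bar>) \<longlongrightarrow> C * \<bar>fst (t, t) - snd (t, t)\<bar>) (nhds (t, t))"
    by (intro tendsto_intros filterlim_ident)
  then have "((\<lambda>x. C * \<bar>fst x - snd x\<bar>) \<longlongrightarrow> 0) (nhds (t, t))" by simp
  ultimately show ?thesis by (rule Lim_null_comparison)
qed

text \<open>Consistency with time, matrix and step varying together, as the later compactness
  arguments demand. Each block is an average of a function with a limit at the diagonal, or a
  product of such averages with factors that converge.\<close>

lemma ric_tendsto_zero_step: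
  assumes t: "(t \<longlongrightarrow> t0) F" and E: "(E \<longlongrightarrow> E0) F"
    and h: "(h \<longlongrightarrow> 0) F" "\<forall>\<^sub>F k in F. 0 < h k"
    and psd: "\<forall>\<^sub>F k in F. E k \<in> sym_psd"
  shows "((\<lambda>k. \<F> (t k) (E k) (h k)) \<longlongrightarrow> \<F> t0 E0 0) F"
proof -
  define s where "s k = t k - h k" for k
  have s: "(s \<longlongrightarrow> t0) F" unfolding s_def using tendsto_diff[OF t h(1)] by simp
  have fst: "(fst \<longlongrightarrow> t0) (nhds (t0, t0))"
    using tendsto_fst[OF filterlim_ident, of "(t0, t0)"] by simp
  have snd: "(snd \<longlongrightarrow> t0) (nhds (t0, t0))"
    using tendsto_snd[OF filterlim_ident, of "(t0, t0)"] by simp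
  note Phi_nhds = Phi_tendsto_nhds[of t0 t0, unfolded Phi_refl]
  have avg: "(g \<longlongrightarrow> l) F"
    if "(p \<longlongrightarrow> t0) F" "((\<lambda>x. f (fst x) (snd x)) \<longlongrightarrow> l) (nhds (t0, t0))"
      "\<And>k. continuous_on {t k - h k..t k} (\<lambda>\<tau>. f \<tau> (p k))"
      "\<And>k. 0 < h k \<Longrightarrow> (1 / h k) *\<^sub>R integral {t k - h k..t k} (\<lambda>\<tau>. f \<tau> (p k)) = g k"
    for f :: "real \<Rightarrow> real \<Rightarrow> 'c::euclidean_space" and g l p
  proof (rule Lim_transform_eventually)
    show "((\<lambda>k. (1 / h k) *\<^sub>R integral {t k - h k..t k} (\<lambda>\<tau>. f \<tau> (p k))) \<longlongrightarrow> l) F"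
      using t that(1) h that(2) always_eventually[OF allI[OF that(3)]] by (rule average_tendsto)
    show "\<forall>\<^sub>F k in F. (1 / h k) *\<^sub>R integral {t k - h k..t k} (\<lambda>\<tau>. f \<tau> (p k)) = g k"
      using h(2) by eventually_elim (rule that(4))
  qed
  have Phi: "((\<lambda>k. \<Phi> (t k) (s k)) \<longlongrightarrow> mat 1) F"
    using Phi_tendsto[OF t s] by (simp add: Phi_refl)
  have avgGamma: "((\<lambda>k. (1 / h k) *\<^sub>R \<Gamma> (s k) (t k)) \<longlongrightarrow> B t0) F"
  proof (rule avg[OF t])
    have "((\<lambda>x. \<Phi> (snd x) (fst x) ** B (fst x)) \<longlongrightarrow> mat 1 ** B t0) (nhds (t0, t0))"
      using Phi_tendsto[OF snd fst] by (intro tendsto_intros data_tendsto fst) (simp add: Phi_refl)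
    then show "((\<lambda>x. \<Phi> (snd x) (fst x) ** B (fst x)) \<longlongrightarrow> B t0) (nhds (t0, t0))" by simp
  qed (auto intro!: continuous_intros simp: input_map_def s_def)
  have Gamma: "((\<lambda>k. \<Gamma> (s k) (t k)) \<longlongrightarrow> 0) F"
  proof -
    have "((\<lambda>k. h k *\<^sub>R ((1 / h k) *\<^sub>R \<Gamma> (s k) (t k))) \<longlongrightarrow> 0 *\<^sub>R B t0) F"
      by (intro tendsto_scaleR h(1) avgGamma)
    then have "((\<lambda>k. h k *\<^sub>R ((1 / h k) *\<^sub>R \<Gamma> (s k) (t k))) \<longlongrightarrow> 0) F" by simp
    then show ?thesis
      by (rule Lim_transform_eventually) (use h(2) in \<open>auto elim!: eventually_mono\<close>)
  qed
  have M1: "((\<lambda>k. ricM1 A B (t k) (E k) (h k)) \<longlongrightarrow> E0 ** B t0) F"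
  proof -
    have "((\<lambda>k. transpose (\<Phi> (t k) (s k)) ** E k ** ((1 / h k) *\<^sub>R \<Gamma> (s k) (t k)))
        \<longlongrightarrow> transpose (mat 1) ** E0 ** B t0) F"
      by (intro tendsto_intros Phi E avgGamma)
    then have "((\<lambda>k. transpose (\<Phi> (t k) (s k)) ** E k ** ((1 / h k) *\<^sub>R \<Gamma> (s k) (t k))) \<longlongrightarrow> E0 ** B t0) F"
      by simp
    then show ?thesis
      by (rule Lim_transform_eventually)
        (use h(2) in \<open>auto elim!: eventually_mono simp: ricM1_def s_def\<close>)
  qed
  have M2: "((\<lambda>k. ricM2 A B Q (t k) (E k) (h k)) \<longlongrightarrow> 0) F"
  proof (rule avg[OF s])
    have "((\<lambda>x. transpose (\<Phi> (fst x) (snd x)) ** Q (fst x) ** \<Gamma> (snd x) (fst x))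
        \<longlongrightarrow> transpose (mat 1) ** Q t0 ** 0) (nhds (t0, t0))"
      by (intro tendsto_intros Phi_nhds Gamma_tendsto_nhds data_tendsto fst)
    then show "((\<lambda>x. transpose (\<Phi> (fst x) (snd x)) ** Q (fst x) ** \<Gamma> (snd x) (fst x))
        \<longlongrightarrow> 0) (nhds (t0, t0))" by simp
  qed (auto intro!: continuous_intros Gamma_continuous_on simp: ricM2_def s_def)
  have N1: "((\<lambda>k. ricN1 R (t k) (E k) (h k)) \<longlongrightarrow> R t0) F"
    by (rule avg[OF s, of "\<lambda>\<tau> _. R \<tau>"])
      (auto intro!: data_tendsto fst continuous_on_subset[OF R_continuous] simp: ricN1_def)
  have N2: "((\<lambda>k. ricN2 A B Q (t k) (E k) (h k)) \<longlongrightarrow> 0) F"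
  proof (rule avg[OF s])
    have "((\<lambda>x. transpose (\<Gamma> (snd x) (fst x)) ** Q (fst x) ** \<Gamma> (snd x) (fst x))
        \<longlongrightarrow> transpose 0 ** Q t0 ** 0) (nhds (t0, t0))"
      by (intro tendsto_intros Gamma_tendsto_nhds data_tendsto fst)
    then show "((\<lambda>x. transpose (\<Gamma> (snd x) (fst x)) ** Q (fst x) ** \<Gamma> (snd x) (fst x))
        \<longlongrightarrow> 0) (nhds (t0, t0))" by simp
  qed (auto intro!: continuous_intros Gamma_continuous_on simp: ricN2_def s_def transpose_Gamma)
  have N3: "((\<lambda>k. ricN3 A B (t k) (E k) (h k)) \<longlongrightarrow> 0) F"
  proof -
    have "((\<lambda>k. transpose (\<Gamma> (s k) (t k)) ** E k ** ((1 / h k) *\<^sub>R \<Gamma> (s k) (t k)))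
        \<longlongrightarrow> transpose 0 ** E0 ** B t0) F"
      by (intro tendsto_intros Gamma E avgGamma)
    then have "((\<lambda>k. transpose (\<Gamma> (s k) (t k)) ** E k ** ((1 / h k) *\<^sub>R \<Gamma> (s k) (t k))) \<longlongrightarrow> 0) F"
      by simp
    then show ?thesis
      by (rule Lim_transform_eventually)
        (use h(2) in \<open>auto elim!: eventually_mono simp: ricN3_def s_def transpose_Gamma matrix_mult_scaleR_right\<close>)
  qed
  have G1: "((\<lambda>k. ricG1 A Q (t k) (E k) (h k)) \<longlongrightarrow> Q t0) F"
  proof (rule avg[OF s])
    have "((\<lambda>x. transpose (\<Phi> (fst x) (snd x)) ** Q (fst x) ** \<Phi> (fst x) (snd x))
        \<longlongrightarrow> transpose (mat 1) ** Q t0 ** mat 1) (nhds (t0, t0))"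
      by (intro tendsto_intros Phi_nhds data_tendsto fst)
    then show "((\<lambda>x. transpose (\<Phi> (fst x) (snd x)) ** Q (fst x) ** \<Phi> (fst x) (snd x))
        \<longlongrightarrow> Q t0) (nhds (t0, t0))" by simp
  qed (auto intro!: continuous_intros Gamma_continuous_on simp: ricG1_def s_def)
  \<comment> \<open>The difference quotient of the flow, which is the average of its derivative
    \<open>A \<Phi>\<close> over the step.\<close>
  define D where "D k = (1 / h k) *\<^sub>R (\<Phi> (t k) (s k) - mat 1)" for k
  have D: "(D \<longlongrightarrow> A t0) F"
  proof (rule avg[OF s])
    have "((\<lambda>x. A (fst x) ** \<Phi> (fst x) (snd x)) \<longlongrightarrow> A t0 ** mat 1) (nhds (t0, t0))"
      by (intro tendsto_intros Phi_nhds data_tendsto fst)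
    then show "((\<lambda>x. A (fst x) ** \<Phi> (fst x) (snd x)) \<longlongrightarrow> A t0) (nhds (t0, t0))" by simp
    fix k
    show "continuous_on {t k - h k..t k} (\<lambda>\<tau>. A \<tau> ** \<Phi> \<tau> (s k))" by (intro continuous_intros)
    assume "0 < h k"
    then have "((\<lambda>\<tau>. A \<tau> ** \<Phi> \<tau> (s k)) has_integral (\<Phi> (t k) (s k) - \<Phi> (s k) (s k))) {s k..t k}"
      by (intro fundamental_theorem_of_calculus Phi_has_vector_derivative) (simp add: s_def)
    then show "(1 / h k) *\<^sub>R integral {t k - h k..t k} (\<lambda>\<tau>. A \<tau> ** \<Phi> \<tau> (s k)) = D k"
      by (simp add: D_def s_def integral_unique Phi_refl)
  qed
  \<comment> \<open>Discrete product rule: with \<open>\<Phi> = 1 + h D\<close>, the quotient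
    \<open>(\<Phi>^T E \<Phi> - E) / h\<close> equals \<open>D^T E \<Phi> + E D\<close>.\<close>
  have G2: "((\<lambda>k. ricG2 A (t k) (E k) (h k)) \<longlongrightarrow> transpose (A t0) ** E0 + E0 ** A t0) F"
  proof -
    have "((\<lambda>k. transpose (D k) ** E k ** \<Phi> (t k) (s k) + E k ** D k)
        \<longlongrightarrow> transpose (A t0) ** E0 ** mat 1 + E0 ** A t0) F"
      by (intro tendsto_intros D E Phi)
    then have "((\<lambda>k. transpose (D k) ** E k ** \<Phi> (t k) (s k) + E k ** D k)
        \<longlongrightarrow> transpose (A t0) ** E0 + E0 ** A t0) F" by simp
    moreover have "\<forall>\<^sub>F k in F. transpose (D k) ** E k ** \<Phi> (t k) (s k) + E k ** D k = ricG2 A (t k) (E k) (h k)"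
      using h(2)
    proof eventually_elim
      case (elim k)
      have "transpose (D k) ** E k ** \<Phi> (t k) (s k) + E k ** D k
          = (1 / h k) *\<^sub>R ((transpose (\<Phi> (t k) (s k)) - mat 1) ** E k ** \<Phi> (t k) (s k) + E k ** (\<Phi> (t k) (s k) - mat 1))"
        by (simp add: D_def transpose_scalar transpose_diff matrix_mult_scaleR_right matrix_mult_scaleR_left scaleR_add_right)
      also have "\<dots> = ricG2 A (t k) (E k) (h k)"
        using elim by (simp add: ricG2_def s_def matrix_diff_ldistrib matrix_diff_rdistrib)
      finally show ?case .
    qed
    ultimately show ?thesis by (rule Lim_transform_eventually)
  qed
  have "((\<lambda>k. matrix_inv (ricN1 R (t k) (E k) (h k) + ricN2 A B Q (t k) (E k) (h k) + ricN3 A B (t k) (E k) (h k)))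
      \<longlongrightarrow> matrix_inv (R t0)) F"
  proof (rule tendsto_matrix_inv[OF _ R_pd])
    have "((\<lambda>k. ricN1 R (t k) (E k) (h k) + ricN2 A B Q (t k) (E k) (h k) + ricN3 A B (t k) (E k) (h k))
      \<longlongrightarrow> R t0 + 0 + 0) F" by (intro tendsto_add N1 N2 N3)
    then show "((\<lambda>k. ricN1 R (t k) (E k) (h k) + ricN2 A B Q (t k) (E k) (h k) + ricN3 A B (t k) (E k) (h k))
      \<longlongrightarrow> R t0) F" by simp
    show "\<forall>\<^sub>F k in F. ricN1 R (t k) (E k) (h k) + ricN2 A B Q (t k) (E k) (h k) + ricN3 A B (t k) (E k) (h k) \<in> sym_pd"
      using h(2) psd by eventually_elim (rule ricN_sym_pd)
  qed
  then have "((\<lambda>k. \<F> (t k) (E k) (h k)) \<longlongrightarrow>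
      (E0 ** B t0 + 0) ** matrix_inv (R t0) ** transpose (E0 ** B t0 + 0)
      - (Q t0 + (transpose (A t0) ** E0 + E0 ** A t0))) F"
    unfolding ric_def Let_def by (intro tendsto_intros M1 M2 G1 G2)
  then show ?thesis
    by (simp add: ric_def Let_def ricM1_def ricM2_def ricN1_def ricN2_def ricN3_def ricG1_def ricG2_def)
qed

section \<open>The right-hand side at zero step and its regularity\<close>

lemma ric_zero: "\<F> t E 0 = E ** B t ** matrix_inv (R t) ** transpose (E ** B t)
    - (Q t + (transpose (A t) ** E + E ** A t))"
  by (simp add: ric_def Let_def ricM1_def ricM2_def ricN1_def ricN2_def ricN3_def ricG1_def ricG2_def)

lemma ric_zero_quad:
  assumes E: "E \<in> sym_psd"
  shows "quad (\<F> t E 0) x = quad (matrix_inv (R t)) (transpose (B t) *v (E *v x))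
    - quad (Q t) x - 2 * ((E *v x) \<bullet> (A t *v x))"
proof -
  note sym = sym_psd_transpose[OF E]
  have "quad (E ** B t ** matrix_inv (R t) ** transpose (E ** B t)) x
      = quad (transpose (transpose (E ** B t)) ** matrix_inv (R t) ** transpose (E ** B t)) x"
    by simp
  also have "\<dots> = quad (matrix_inv (R t)) (transpose (E ** B t) *v x)"
    by (rule quad_sandwich)
  also have "transpose (E ** B t) *v x = transpose (B t) *v (E *v x)"
    by (simp add: matrix_transpose_mul sym matrix_vector_mul_assoc)
  finally have 1: "quad (E ** B t ** matrix_inv (R t) ** transpose (E ** B t)) x
      = quad (matrix_inv (R t)) (transpose (B t) *v (E *v x))" .
  have 2: "quad (transpose (A t) ** E) x = (E *v x) \<bullet> (A t *v x)"
    by (rule form_transpose_mult)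
  have 3: "quad (E ** A t) x = (E *v x) \<bullet> (A t *v x)"
    using sym_inner[OF sym, of x "A t *v x"] by (simp flip: matrix_vector_mul_assoc)
  show ?thesis unfolding ric_zero quad_diff quad_add 1 2 3 by simp
qed

lemma R_inv_tendsto:
  assumes "(t \<longlongrightarrow> t0) F"
  shows "((\<lambda>k. matrix_inv (R (t k))) \<longlongrightarrow> matrix_inv (R t0)) F"
  by (intro tendsto_matrix_inv data_tendsto assms R_pd always_eventually allI)

lemma ric_zero_tendsto:
  assumes "(t \<longlongrightarrow> t0) F" "(E \<longlongrightarrow> E0) F"
  shows "((\<lambda>k. \<F> (t k) (E k) 0) \<longlongrightarrow> \<F> t0 E0 0) F"
  unfolding ric_zero by (intro tendsto_intros R_inv_tendsto data_tendsto assms)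

lemma ric_zero_continuous_on:
  assumes "continuous_on S f" "continuous_on S g"
  shows "continuous_on S (\<lambda>x. \<F> (f x) (g x) 0)"
  using assms unfolding continuous_on_def by (blast intro: ric_zero_tendsto)

text \<open>For fixed \<open>h\<close> the matrix \<open>E\<close> enters \<open>ricM1\<close>,
  \<open>ricN3\<close> and \<open>ricG2\<close> affinely; only the inverse needs care, and it is
  continuous because semi-definite arguments keep \<open>N\<close> positive definite.\<close>

lemma ric_tendsto_fixed_step:
  assumes E: "(E \<longlongrightarrow> E0) F" and h: "0 < h"
    and psd: "\<forall>\<^sub>F k in F. E k \<in> sym_psd" and E0: "E0 \<in> sym_psd"
  shows "((\<lambda>k. \<F> t (E k) h) \<longlongrightarrow> \<F> t E0 h) F"
proof -
  have M: "((\<lambda>k. ricM1 A B t (E k) h + ricM2 A B Q t (E k) h) \<longlongrightarrow> ricM1 A B t E0 h + ricM2 A B Q t E0 h) F"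
    using h unfolding ricM1_def ricM2_def by simp (intro tendsto_intros E)
  have G: "((\<lambda>k. ricG1 A Q t (E k) h + ricG2 A t (E k) h) \<longlongrightarrow> ricG1 A Q t E0 h + ricG2 A t E0 h) F"
    using h unfolding ricG1_def ricG2_def by simp (intro tendsto_intros E)
  have "((\<lambda>k. ricN1 R t (E k) h + ricN2 A B Q t (E k) h + ricN3 A B t (E k) h)
      \<longlongrightarrow> ricN1 R t E0 h + ricN2 A B Q t E0 h + ricN3 A B t E0 h) F"
    using h unfolding ricN1_def ricN2_def ricN3_def by simp (intro tendsto_intros E)
  then have "((\<lambda>k. matrix_inv (ricN1 R t (E k) h + ricN2 A B Q t (E k) h + ricN3 A B t (E k) h))
      \<longlongrightarrow> matrix_inv (ricN1 R t E0 h + ricN2 A B Q t E0 h + ricN3 A B t E0 h)) F"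
    by (rule tendsto_matrix_inv) (use psd E0 h in \<open>auto elim!: eventually_mono intro: ricN_sym_pd\<close>)
  then show ?thesis unfolding ric_def Let_def by (intro tendsto_intros M G)
qed

text \<open>A violating sequence has a subsequence along which time and matrix converge in the
  compact set and the step tends to 0; there both terms have the same limit.\<close>

lemma ric_zero_step_uniform:
  assumes K: "compact K" "K \<subseteq> sym_psd" and e: "0 < e"
  obtains d where "0 < d"
    "\<And>t E h. t \<in> {a..b} \<Longrightarrow> E \<in> K \<Longrightarrow> 0 < h \<Longrightarrow> h \<le> d \<Longrightarrow> norm (\<F> t E h - \<F> t E 0) \<le> e"
proof -
  have "\<exists>d>0. \<forall>t\<in>{a..b}. \<forall>E\<in>K. \<forall>h. 0 < h \<and> h \<le> d \<longrightarrow> norm (\<F> t E h - \<F> t E 0) \<le> e"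
  proof (rule ccontr)
    assume contra: "\<not> ?thesis"
    have "\<exists>t E h. t \<in> {a..b} \<and> E \<in> K \<and> 0 < h \<and> h \<le> inverse (real (Suc k)) \<and> e < norm (\<F> t E h - \<F> t E 0)" for k
    proof -
      have "0 < inverse (real (Suc k))" by simp
      then show ?thesis using contra by (meson not_le)
    qed
    then obtain t E h where teh: "\<And>k. t k \<in> {a..b}" "\<And>k. E k \<in> K" "\<And>k. 0 < h k"
        "\<And>k. h k \<le> inverse (real (Suc k))" "\<And>k. e < norm (\<F> (t k) (E k) (h k) - \<F> (t k) (E k) 0)"
      by metis
    have "compact ({a..b} \<times> K)" using K(1) by (intro compact_Times compact_Icc)
    moreover have "\<forall>k. (t k, E k) \<in> {a..b} \<times> K" using teh by auto
    ultimately obtain l r where "l \<in> {a..b} \<times> K" and r: "strict_mono (r :: nat \<Rightarrow> nat)"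
      and lim: "((\<lambda>k. (t k, E k)) \<circ> r) \<longlonglongrightarrow> l"
      unfolding compact_eq_seq_compact_metric by (rule seq_compactE) (rule that)
    have t: "(\<lambda>k. t (r k)) \<longlonglongrightarrow> fst l" and E: "(\<lambda>k. E (r k)) \<longlonglongrightarrow> snd l"
      using tendsto_fst[OF lim] tendsto_snd[OF lim] by (simp_all add: o_def)
    have "h \<longlonglongrightarrow> 0"
    proof (rule tendsto_sandwich[OF _ _ tendsto_const LIMSEQ_inverse_real_of_nat])
      show "\<forall>\<^sub>F k in sequentially. 0 \<le> h k" by (intro always_eventually allI less_imp_le teh(3))
      show "\<forall>\<^sub>F k in sequentially. h k \<le> inverse (real (Suc k))" using teh(4) by simp
    qed
    from LIMSEQ_subseq_LIMSEQ[OF this r] have h: "(\<lambda>k. h (r k)) \<longlonglongrightarrow> 0"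
      by (simp add: o_def)
    have "(\<lambda>k. \<F> (t (r k)) (E (r k)) (h (r k)) - \<F> (t (r k)) (E (r k)) 0)
        \<longlonglongrightarrow> \<F> (fst l) (snd l) 0 - \<F> (fst l) (snd l) 0"
      using teh K(2)
      by (intro tendsto_diff ric_tendsto_zero_step[OF t E h] ric_zero_tendsto[OF t E] always_eventually allI) auto
    from tendstoD[OF this e] have "\<forall>\<^sub>F k in sequentially.
        norm (\<F> (t (r k)) (E (r k)) (h (r k)) - \<F> (t (r k)) (E (r k)) 0) < e"
      by (simp add: dist_norm)
    then obtain k where "norm (\<F> (t (r k)) (E (r k)) (h (r k)) - \<F> (t (r k)) (E (r k)) 0) < e"
      using eventually_happens'[OF sequentially_bot] by blast
    with teh(5)[of "r k"] show False by simp
  qed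
  then show ?thesis using that by blast
qed

text \<open>The only nonlinearity is \<open>E G E\<close>, and
  \<open>E G E - E' G E' = (E - E') G E + E' G (E - E')\<close>. The constant grows with the radius,
  hence the restriction to a ball.\<close>

lemma ric_zero_lipschitz:
  obtains L where "0 \<le> L"
    "\<And>t E E'. t \<in> {a..b} \<Longrightarrow> E \<in> sym_psd \<inter> cball 0 C \<Longrightarrow> E' \<in> sym_psd \<inter> cball 0 C
      \<Longrightarrow> norm (\<F> t E 0 - \<F> t E' 0) \<le> L * norm (E - E')"
proof -
  define G where "G t = B t ** matrix_inv (R t) ** transpose (B t)" for t
  have "continuous_on {a..b} (\<lambda>t. matrix_inv (R t))"
    unfolding continuous_on_def by (intro ballI R_inv_tendsto tendsto_ident_at)
  then have "continuous_on {a..b} G" unfolding G_def by (intro continuous_intros)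
  then obtain c1 where c1: "0 \<le> c1" "\<And>t. t \<in> {a..b} \<Longrightarrow> norm (G t) \<le> c1"
    by (rule continuous_on_compact_bound[OF compact_Icc]) (rule that)
  have "continuous_on {a..b} A" using A_continuous by (rule continuous_on_subset) simp
  then obtain c2 where c2: "0 \<le> c2" "\<And>t. t \<in> {a..b} \<Longrightarrow> norm (A t) \<le> c2"
    by (rule continuous_on_compact_bound[OF compact_Icc]) (rule that)
  show ?thesis
  \<comment> \<open>The quadratic term contributes \<open>max 0 C * c1\<close> twice, the two linear
    terms \<open>c2\<close> each; \<open>max\<close> keeps the constant nonnegative also for an
    empty ball.\<close>
  proof (rule that[of "2 * (max 0 C * c1) + 2 * c2"])
    fix t and E E' :: "real^'n^'n" assume t: "t \<in> {a..b}" and EE: "E \<in> sym_psd \<inter> cball 0 C" "E' \<in> sym_psd \<inter> cball 0 C"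
    have sq: "M ** B t ** matrix_inv (R t) ** transpose (M ** B t) = M ** G t ** M" if "M \<in> sym_psd" for M
      using that by (simp add: G_def matrix_transpose_mul sym_psd_transpose matrix_mul_assoc)
    have norm: "norm E \<le> max 0 C" "norm E' \<le> max 0 C" using EE by auto
    have "\<F> t E 0 - \<F> t E' 0 = (E - E') ** G t ** E + E' ** G t ** (E - E')
        - (transpose (A t) ** (E - E') + (E - E') ** A t)"
      using EE by (simp add: ric_zero sq matrix_diff_ldistrib matrix_diff_rdistrib)
    also have "norm \<dots> \<le> norm (E - E') * norm (G t) * norm E + norm E' * norm (G t) * norm (E - E')
        + (norm (transpose (A t)) * norm (E - E') + norm (E - E') * norm (A t))"
      by (intro norm_triangle_le_diff norm_triangle_le add_mono norm_matrix_mult3_le norm_matrix_mult_le)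
    also have "\<dots> \<le> norm (E - E') * c1 * max 0 C + max 0 C * c1 * norm (E - E')
        + (c2 * norm (E - E') + norm (E - E') * c2)"
      unfolding norm_transpose using c1 c2 t norm
      by (intro add_mono mult_mono mult_nonneg_nonneg) auto
    also have "\<dots> = (2 * (max 0 C * c1) + 2 * c2) * norm (E - E')"
      by (simp add: algebra_simps)
    finally show "norm (\<F> t E 0 - \<F> t E' 0) \<le> (2 * (max 0 C * c1) + 2 * c2) * norm (E - E')" .
  qed (use c1(1) c2(1) in simp)
qed

end

subsection \<open>Finite-horizon Riccati equations\<close>

lemma time_partition_mono:
  assumes "time_partition T N \<theta>" "i \<le> j" "j \<le> N"
  shows "\<theta> i \<le> \<theta> j"
  using assms(2,3)
proof (induction j rule: dec_induct)
  case (step j)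
  then have "\<theta> j < \<theta> (Suc j)" using assms(1) by (simp add: time_partition_def)
  with step show ?case by simp
qed simp

lemma time_partition_range:
  assumes "time_partition T N \<theta>" "i \<le> N"
  shows "\<theta> i \<in> {0..T}"
  using time_partition_mono[OF assms(1), of 0 i] time_partition_mono[OF assms(1), of i N] assms
  by (simp add: time_partition_def)

lemma time_partition_step_le_mesh:
  assumes "i < N"
  shows "\<theta> (Suc i) - \<theta> i \<le> mesh N \<theta>"
  unfolding mesh_def
proof (rule Max_ge)
  show "\<theta> (Suc i) - \<theta> i \<in> (\<lambda>i. \<theta> i - \<theta> (i - 1)) ` {1..N}"
    using assms by (intro image_eqI[of _ _ "Suc i"]) auto
qed simp

lemma time_partition_uniform:
  assumes "0 < T" "0 < N"
  shows "time_partition T N (\<lambda>j. real j * (T / real N))"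
  using assms by (auto simp: time_partition_def divide_simps)

context lq
begin

lemma Phi_comp: "\<Phi> t r ** \<Phi> r s = \<Phi> t s"
proof -
  obtain X Z :: "real \<Rightarrow> real^'n^'n" where "continuous_on UNIV X" "continuous_on UNIV Z"
    and "\<And>t. (X has_vector_derivative A t ** X t) (at t)"
    and inv: "\<And>t. X t ** Z t = mat 1" "\<And>t. Z t ** X t = mat 1"
    and eq: "\<And>t s. \<Phi> t s = X t ** Z s"
    by (rule state_transition_factor[OF A_continuous]) (rule that)
  have "X t ** Z r ** (X r ** Z s) = X t ** (Z r ** X r) ** Z s"
    by (simp only: matrix_mul_assoc)
  then show ?thesis by (simp add: eq inv)
qed

text \<open>The recursion of \<open>discrete_riccati\<close> solved for the earlier matrix, without
  the conditions of extensionality and membership in \<open>sym_psd\<close>; the latter is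
  propagated from \<open>P\<close>.\<close>

definition "backward N \<theta> P E \<longleftrightarrow>
  E N = P \<and> (\<forall>i<N. E i = back (\<theta> (Suc i)) (\<theta> (Suc i) - \<theta> i) (E (Suc i)))"

lemma backward_psd:
  assumes "backward N \<theta> P E" "P \<in> sym_psd" "\<And>i. i < N \<Longrightarrow> \<theta> i < \<theta> (Suc i)" "i \<le> N"
  shows "E i \<in> sym_psd"
  using assms(4)
proof (induction i rule: inc_induct)
  case (step i)
  then have "back (\<theta> (Suc i)) (\<theta> (Suc i) - \<theta> i) (E (Suc i)) \<in> sym_psd"
    using assms(3)[of i] by (intro back_psd) simp_all
  then show ?case using assms(1) step(2) by (simp add: backward_def)
qed (use assms in \<open>simp add: backward_def\<close>)

lemma backward_mono:
  assumes E: "backward N \<theta> P E" "P \<in> sym_psd" and E': "backward N \<theta> P' E'" "P' \<in> sym_psd"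
    and \<theta>: "\<And>i. i < N \<Longrightarrow> \<theta> i < \<theta> (Suc i)"
    and le: "\<And>x. quad P x \<le> quad P' x" and i: "i \<le> N"
  shows "quad (E i) x \<le> quad (E' i) x"
  using i
proof (induction i arbitrary: x rule: inc_induct)
  case base
  then show ?case using E E' le by (simp add: backward_def)
next
  case (step i)
  have "quad (back (\<theta> (Suc i)) (\<theta> (Suc i) - \<theta> i) (E (Suc i))) x
      \<le> quad (back (\<theta> (Suc i)) (\<theta> (Suc i) - \<theta> i) (E' (Suc i))) x"
    using step \<theta>[of i] backward_psd[OF E \<theta>, of "Suc i"] backward_psd[OF E' \<theta>, of "Suc i"]
    by (intro back_mono) simp_all
  then show ?case using E(1) E'(1) step(2) by (simp add: backward_def)
qed

text \<open>The difference equation is explicit when read from \<open>N\<close> downwards, which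
  gives existence and uniqueness on \<open>{..N}\<close>; extensionality settles the rest of the
  domain.\<close>

lemma backward_discrete_riccati:
  assumes P: "P \<in> sym_psd" and \<theta>: "\<And>i. i < N \<Longrightarrow> \<theta> i < \<theta> (Suc i)"
  shows "backward N \<theta> P (E_disc P N \<theta>)"
proof -
  have iff: "E i = back (\<theta> (Suc i)) (\<theta> (Suc i) - \<theta> i) (E (Suc i)) \<longleftrightarrow>
      E (Suc i) - E i = (\<theta> (Suc i) - \<theta> i) *\<^sub>R \<F> (\<theta> (Suc i)) (E (Suc i)) (\<theta> (Suc i) - \<theta> i)"
    for E :: "nat \<Rightarrow> real^'n^'n" and i
    unfolding back_def by (auto simp: algebra_simps)
  let ?sol = "\<lambda>E. E \<in> {..N} \<rightarrow>\<^sub>E sym_psd \<and> (\<forall>i<N. E (Suc i) - E i =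
      (\<theta> (Suc i) - \<theta> i) *\<^sub>R \<F> (\<theta> (Suc i)) (E (Suc i)) (\<theta> (Suc i) - \<theta> i)) \<and> E N = P"
  \<comment> \<open>Recursion on the number of steps to go: \<open>D k\<close> is the matrix with
    index \<open>N - k\<close>.\<close>
  define D where "D = rec_nat P (\<lambda>k D. back (\<theta> (N - k)) (\<theta> (N - k) - \<theta> (N - Suc k)) D)"
  define E where "E i = (if i \<le> N then D (N - i) else undefined)" for i
  have D: "D 0 = P" "D (Suc k) = back (\<theta> (N - k)) (\<theta> (N - k) - \<theta> (N - Suc k)) (D k)" for k
    by (simp_all add: D_def)
  have bE: "backward N \<theta> P E"
    unfolding backward_def
  proof (intro conjI allI impI)
    show "E N = P" by (simp add: E_def D)
    fix i assume i: "i < N"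
    then have "N - i = Suc (N - Suc i)" "N - (N - Suc i) = Suc i" by simp_all
    then show "E i = back (\<theta> (Suc i)) (\<theta> (Suc i) - \<theta> i) (E (Suc i))"
      using i by (simp add: E_def D)
  qed
  have "\<exists>!E. ?sol E"
  proof (rule ex1I[of _ E])
    have "E \<in> {..N} \<rightarrow>\<^sub>E sym_psd"
      using backward_psd[OF bE P \<theta>] by (intro PiE_I) (auto simp: E_def)
    with bE show "?sol E" unfolding iff[symmetric] by (simp add: backward_def)
    fix E' assume E': "?sol E'"
    then have bE': "backward N \<theta> P E'" unfolding iff[symmetric] by (simp add: backward_def)
    have "E' i = E i" if "i \<le> N" for i
      using that
    proof (induction i rule: inc_induct)
      case (step i)
      then show ?case using bE bE' by (simp add: backward_def)
    qed (use bE bE' in \<open>simp add: backward_def\<close>)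
    moreover have "E' i = E i" if "\<not> i \<le> N" for i
      using E' that by (auto simp: E_def)
    ultimately show "E' = E" by blast
  qed
  from theI'[OF this] show ?thesis
    unfolding iff[symmetric] by (simp add: discrete_riccati_def backward_def iff)
qed

text \<open>By comparison with the cost of the zero control.\<close>

lemma backward_bounded:
  assumes P: "P \<in> sym_psd"
  obtains C where "0 \<le> C"
    "\<And>N \<theta> E i. time_partition T N \<theta> \<Longrightarrow> backward N \<theta> P E \<Longrightarrow> i \<le> N \<Longrightarrow> norm (E i) \<le> C"
proof -
  \<comment> \<open>The cost from time \<open>s\<close> to \<open>T\<close> of the zero control
    started in \<open>x\<close>, including the final cost \<open>P\<close>.\<close>
  define J where "J s x = integral {s..T} (\<lambda>\<tau>. quad (Q \<tau>) (\<Phi> \<tau> s *v x)) + quad P (\<Phi> T s *v x)" for s x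
  have "continuous_on {0..T} Q" using Q_continuous by (rule continuous_on_subset) simp
  then obtain q where q: "0 \<le> q" "\<And>\<tau>. \<tau> \<in> {0..T} \<Longrightarrow> norm (Q \<tau>) \<le> q"
    by (rule continuous_on_compact_bound[OF compact_Icc]) (rule that)
  have "continuous_on ({0..T} \<times> {0..T}) (\<lambda>x. \<Phi> (fst x) (snd x))" by (intro continuous_intros)
  then obtain a where a: "0 \<le> a" and norm_a: "\<And>x. x \<in> {0..T} \<times> {0..T} \<Longrightarrow> norm (\<Phi> (fst x) (snd x)) \<le> a"
    by (rule continuous_on_compact_bound[OF compact_Times[OF compact_Icc compact_Icc]]) (rule that)
  have Phi_le: "norm (\<Phi> \<tau> s) \<le> a" if "\<tau> \<in> {0..T}" "s \<in> {0..T}" for \<tau> s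
    using norm_a[of "(\<tau>, s)"] that by simp
  have bound: "quad M (\<Phi> \<tau> s *v x) \<le> norm M * a\<^sup>2 * (norm x)\<^sup>2"
    if "\<tau> \<in> {0..T}" "s \<in> {0..T}" for M \<tau> s x
  proof -
    have "norm (\<Phi> \<tau> s *v x) \<le> a * norm x"
      using norm_matrix_vector_le[of "\<Phi> \<tau> s" x] mult_right_mono[OF Phi_le[OF that] norm_ge_zero[of x]]
      by simp
    then have "(norm (\<Phi> \<tau> s *v x))\<^sup>2 \<le> a\<^sup>2 * (norm x)\<^sup>2"
      using power_mono[of "norm (\<Phi> \<tau> s *v x)" "a * norm x" 2] by (simp add: power_mult_distrib)
    then have "norm M * (norm (\<Phi> \<tau> s *v x))\<^sup>2 \<le> norm M * (a\<^sup>2 * (norm x)\<^sup>2)"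
      by (rule mult_left_mono) simp
    then show ?thesis using quad_le_norm[of M "\<Phi> \<tau> s *v x"] by (simp add: mult.assoc)
  qed
  have Phi_int: "(\<lambda>\<tau>. quad (Q \<tau>) (\<Phi> \<tau> s *v x)) integrable_on {t..t'}" for s x t t'
    by (intro integrable_continuous_real continuous_intros)
  define C0 where "C0 = T * (q * a\<^sup>2) + norm P * a\<^sup>2"
  have J_le: "J s x \<le> C0 * (norm x)\<^sup>2" if s: "s \<in> {0..T}" for s x
  proof -
    have "integral {s..T} (\<lambda>\<tau>. quad (Q \<tau>) (\<Phi> \<tau> s *v x)) \<le> integral {s..T} (\<lambda>_. q * a\<^sup>2 * (norm x)\<^sup>2)"
    proof (intro integral_le Phi_int integrable_continuous_real continuous_intros)
      fix \<tau> assume "\<tau> \<in> {s..T}"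
      then have \<tau>: "\<tau> \<in> {0..T}" using s by simp
      have "norm (Q \<tau>) * a\<^sup>2 * (norm x)\<^sup>2 \<le> q * a\<^sup>2 * (norm x)\<^sup>2"
        using q(2)[OF \<tau>] by (intro mult_right_mono) simp_all
      with bound[OF \<tau> s, of "Q \<tau>" x]
      show "quad (Q \<tau>) (\<Phi> \<tau> s *v x) \<le> q * a\<^sup>2 * (norm x)\<^sup>2" by linarith
    qed
    also have "\<dots> = (T - s) * (q * a\<^sup>2 * (norm x)\<^sup>2)" using s by simp
    also have "\<dots> \<le> T * (q * a\<^sup>2 * (norm x)\<^sup>2)" using s q(1) by (intro mult_right_mono) simp_all
    finally show ?thesis
      using bound[of T s P x] s by (simp add: J_def C0_def algebra_simps)
  qed
  have E_le: "quad (E i) x \<le> J (\<theta> i) x"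
    if part: "time_partition T N \<theta>" and E: "backward N \<theta> P E" and i: "i \<le> N" for N \<theta> E i x
    using i
  proof (induction i arbitrary: x rule: inc_induct)
    case base
    then show ?case using part E by (simp add: J_def time_partition_def backward_def Phi_refl)
  next
    case (step i)
    let ?s = "\<theta> i" and ?t = "\<theta> (Suc i)"
    have st: "?s < ?t" "?t \<le> T"
      using part step(2) time_partition_range[OF part, of "Suc i"] by (simp_all add: time_partition_def)
    have psd: "E (Suc i) \<in> sym_psd"
      using part step(2) by (intro backward_psd[OF E P]) (simp_all add: time_partition_def)
    \<comment> \<open>The zero control on this step followed by the zero control on the rest is the
      zero control on the whole remaining interval, by the composition law of the flow.\<close>
    have "quad (E i) x \<le> stage_cost ?s ?t x 0 + quad (E (Suc i)) (state ?s x 0 ?t)"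
      using back_le[of "?t - ?s" "E (Suc i)" ?t x 0] st psd E step(2) by (simp add: backward_def)
    also have "\<dots> \<le> stage_cost ?s ?t x 0 + J ?t (\<Phi> ?t ?s *v x)"
      using step.IH[of "\<Phi> ?t ?s *v x"] by (simp add: state_def)
    also have "\<dots> = (integral {?s..?t} (\<lambda>\<tau>. quad (Q \<tau>) (\<Phi> \<tau> ?s *v x))
        + integral {?t..T} (\<lambda>\<tau>. quad (Q \<tau>) (\<Phi> \<tau> ?s *v x))) + quad P (\<Phi> T ?s *v x)"
      by (simp add: J_def stage_cost_def state_def matrix_vector_mul_assoc Phi_comp)
    also have "\<dots> = J ?s x"
      unfolding J_def using st by (subst Henstock_Kurzweil_Integration.integral_combine[OF _ _ Phi_int]) simp_all
    finally show ?case .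
  qed
  show ?thesis
  proof (rule that[of "max 0 (real CARD('n) * real CARD('n) * C0)"])
    fix N \<theta> E i
    assume part: "time_partition T N \<theta>" and E: "backward N \<theta> P E" and i: "i \<le> N"
    have "norm (E i) \<le> real CARD('n) * real CARD('n) * C0"
    proof (rule sym_psd_norm_le)
      show "E i \<in> sym_psd"
        using part i by (intro backward_psd[OF E P]) (simp_all add: time_partition_def)
      show "quad (E i) x \<le> C0 * (norm x)\<^sup>2" for x
        using E_le[OF part E i, of x] J_le[OF time_partition_range[OF part i], of x] by linarith
    qed
    then show "norm (E i) \<le> max 0 (real CARD('n) * real CARD('n) * C0)" by simp
  qed simp
qed

text \<open>Composing the right-hand side with the projection onto a ball of \<open>sym_psd\<close> makes it globally
  Lipschitz, so that a solution exists on all of \<open>[0, T]\<close>.\<close>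

lemma truncated_riccati_exists:
  fixes P :: "real^'n^'n"
  assumes C: "0 \<le> C" and T: "0 \<le> T" and K: "K = sym_psd \<inter> cball 0 C"
  obtains Y where "Y T = P"
    "\<And>t. t \<in> {0..T} \<Longrightarrow> (Y has_vector_derivative \<F> t (closest_point K (Y t)) 0) (at t within {0..T})"
proof -
  let ?\<pi> = "closest_point K"
  have "0 \<in> K" unfolding K using C by simp
  moreover have "convex K" "closed K"
    unfolding K by (auto intro!: convex_Int convex_sym_psd closed_Int closed_sym_psd)
  ultimately have K': "convex K" "closed K" "K \<noteq> {}" by blast+
  obtain L where L: "0 \<le> L" "\<And>t E E'. t \<in> {0..T} \<Longrightarrow> E \<in> sym_psd \<inter> cball 0 C \<Longrightarrow> E' \<in> sym_psd \<inter> cball 0 C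
      \<Longrightarrow> norm (\<F> t E 0 - \<F> t E' 0) \<le> L * norm (E - E')"
    by (rule ric_zero_lipschitz) (rule that)
  have "continuous_on {0..T} (\<lambda>t. \<F> t (?\<pi> P) 0)"
    by (intro ric_zero_continuous_on continuous_intros)
  then obtain M where M0: "0 \<le> M" and M: "\<And>t. t \<in> {0..T} \<Longrightarrow> norm (\<F> t (?\<pi> P) 0) \<le> M"
    by (rule continuous_on_compact_bound[OF compact_Icc]) (rule that)
  \<comment> \<open>The equation has a final condition, so it is solved in reversed time
    \<open>s = T - t\<close>. Beyond \<open>s = T\<close> the time argument is frozen at 0, which
    gives an equation on the whole half-line.\<close>
  define c where "c s = max 0 (T - s)" for s
  have c: "c s \<in> {0..T}" if "0 \<le> s" for s using that T by (simp add: c_def)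
  define g where "g s W = - \<F> (c s) (?\<pi> W) 0" for s and W :: "real^'n^'n"
  have g_cont: "continuous_on ({0..} \<times> UNIV) (\<lambda>(s, W). g s W)"
    unfolding g_def split_def c_def
    by (intro continuous_intros ric_zero_continuous_on continuous_on_compose2[OF continuous_on_closest_point[OF K']]) auto
  have L_cont: "continuous_on {0..} (\<lambda>_. L + M)" by (rule continuous_on_const)
  have g_lip: "norm (g s W - g s W') \<le> (L + M) * norm (W - W')" if s: "0 \<le> s" for s W W'
  proof -
    have "norm (g s W - g s W') = norm (\<F> (c s) (?\<pi> W) 0 - \<F> (c s) (?\<pi> W') 0)"
      by (simp add: g_def norm_minus_commute)
    also have "\<dots> \<le> L * norm (?\<pi> W - ?\<pi> W')"
      using closest_point_in_set[OF K'(2,3)] by (intro L(2) c s) (simp_all add: K)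
    also have "\<dots> \<le> L * norm (W - W')"
      using closest_point_lipschitz[OF K', of W W'] L(1) by (intro mult_left_mono) (simp_all add: dist_norm)
    also have "\<dots> \<le> (L + M) * norm (W - W')" using M0 by (intro mult_right_mono) simp_all
    finally show ?thesis .
  qed
  have g_bnd: "norm (g s P) \<le> L + M" if "0 \<le> s" for s
    using M[OF c[OF that]] L(1) by (simp add: g_def)
  obtain W where W: "W 0 = P" "\<And>s. 0 \<le> s \<Longrightarrow> (W has_vector_derivative g s (W s)) (at s within {0..})"
    by (rule picard_exists[OF g_cont L_cont g_lip g_bnd]) (assumption | rule that)+
  show ?thesis
  proof (rule that[of "\<lambda>t. W (T - t)"])
    show "W (T - T) = P" using W(1) by simp
    fix t assume t: "t \<in> {0..T}"
    have "((W \<circ> (\<lambda>t. T - t)) has_vector_derivative (- 1) *\<^sub>R g (T - t) (W (T - t))) (at t within {0..T})"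
    proof (rule vector_diff_chain_within)
      show "((\<lambda>t. T - t) has_vector_derivative - 1) (at t within {0..T})"
        by (auto intro!: derivative_eq_intros simp: has_real_derivative_iff_has_vector_derivative[symmetric])
      show "(W has_vector_derivative g (T - t) (W (T - t))) (at (T - t) within (\<lambda>t. T - t) ` {0..T})"
        using W(2)[of "T - t"] t by (auto intro: has_vector_derivative_within_subset)
    qed
    then show "((\<lambda>t. W (T - t)) has_vector_derivative \<F> t (?\<pi> (W (T - t))) 0) (at t within {0..T})"
      using t by (simp add: o_def g_def c_def)
  qed
qed

text \<open>A Gronwall argument running backwards from \<open>T\<close>, where the error is 0. One
  step multiplies the error by at most \<open>1 + L h \<le> exp (L h)\<close> and adds
  \<open>2 \<eta> h\<close>. The projection fixes the discrete values, which lie in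
  \<open>K\<close>, and does not increase distances.\<close>

lemma truncated_riccati_error:
  assumes C: "0 \<le> C" and T: "0 < T" and K: "K = sym_psd \<inter> cball 0 C"
    and Y: "Y T = P"
      "\<And>t. t \<in> {0..T} \<Longrightarrow> (Y has_vector_derivative \<F> t (closest_point K (Y t)) 0) (at t within {0..T})"
    and e: "0 < e"
  shows "\<exists>d>0. \<forall>N \<theta> E. time_partition T N \<theta> \<and> (\<forall>i<N. \<theta> (Suc i) - \<theta> i \<le> d) \<and> backward N \<theta> P E
      \<and> (\<forall>i\<le>N. E i \<in> K) \<longrightarrow> (\<forall>i\<le>N. norm (Y (\<theta> i) - E i) \<le> e)"
proof -
  let ?\<pi> = "closest_point K"
  have "0 \<in> K" unfolding K using C by simp
  moreover have "convex K" "closed K"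
    unfolding K by (auto intro!: convex_Int convex_sym_psd closed_Int closed_sym_psd)
  ultimately have K': "convex K" "closed K" "K \<noteq> {}" by blast+
  have K_compact: "compact K"
    unfolding K by (intro closed_Int_compact closed_sym_psd compact_cball)
  obtain L where L: "0 \<le> L" "\<And>t E E'. t \<in> {0..T} \<Longrightarrow> E \<in> sym_psd \<inter> cball 0 C \<Longrightarrow> E' \<in> sym_psd \<inter> cball 0 C
      \<Longrightarrow> norm (\<F> t E 0 - \<F> t E' 0) \<le> L * norm (E - E')"
    by (rule ric_zero_lipschitz) (rule that)
  \<comment> \<open>Chosen so that the accumulated error \<open>2 \<eta> T exp (L T)\<close> is
    \<open>e\<close>.\<close>
  define \<eta> where "\<eta> = e / (2 * T * exp (L * T))"
  have \<eta>: "0 < \<eta>" using e T by (simp add: \<eta>_def)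
  obtain d1 where d1: "0 < d1" "\<And>t E h. t \<in> {0..T} \<Longrightarrow> E \<in> K \<Longrightarrow> 0 < h \<Longrightarrow> h \<le> d1 \<Longrightarrow> norm (\<F> t E h - \<F> t E 0) \<le> \<eta>"
    by (rule ric_zero_step_uniform[OF K_compact _ \<eta>, of 0 T]) (simp add: K, rule that)
  define y where "y t = \<F> t (?\<pi> (Y t)) 0" for t
  have Y_cont: "continuous_on {0..T} Y"
    using Y(2) by (rule continuous_on_vector_derivative)
  have "continuous_on {0..T} y"
    unfolding y_def
    by (intro ric_zero_continuous_on continuous_intros continuous_on_compose2[OF continuous_on_closest_point[OF K'] Y_cont]) auto
  then have "uniformly_continuous_on {0..T} y"
    by (rule compact_uniformly_continuous) simp
  then obtain d2 where d2: "0 < d2"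
      "\<And>t s. t \<in> {0..T} \<Longrightarrow> s \<in> {0..T} \<Longrightarrow> dist s t < d2 \<Longrightarrow> dist (y s) (y t) < \<eta>"
    using \<eta> by (rule uniformly_continuous_onE) (rule that)
  have local: "norm (Y t - Y s - (t - s) *\<^sub>R y t) \<le> \<eta> * (t - s)"
    if st: "0 \<le> s" "s < t" "t \<le> T" "t - s < d2" for s t
  proof -
    have "(y has_integral (Y t - Y s)) {s..t}"
      using st unfolding y_def
      by (intro fundamental_theorem_of_calculus has_vector_derivative_within_subset[OF Y(2)]) auto
    moreover have "((\<lambda>_. y t) has_integral (t - s) *\<^sub>R y t) {s..t}"
      using has_integral_const_real[of "y t" s t] st by simp
    ultimately have "((\<lambda>\<tau>. y \<tau> - y t) has_integral (Y t - Y s - (t - s) *\<^sub>R y t)) {s..t}"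
      by (rule has_integral_diff)
    then have "norm (Y t - Y s - (t - s) *\<^sub>R y t) \<le> \<eta> * measure lborel {s..t}"
    proof (rule has_integral_bound_real[OF less_imp_le[OF \<eta>] finite.emptyI])
      show "norm (y \<tau> - y t) \<le> \<eta>" if "\<tau> \<in> {s..t} - {}" for \<tau>
        using d2(2)[of t \<tau>] that st by (simp add: dist_norm dist_real_def)
    qed
    then show ?thesis using st by simp
  qed
  show ?thesis
  \<comment> \<open>Uniform continuity asks for steps strictly below \<open>d2\<close>, whereas the
    fineness condition is not strict; hence the half.\<close>
  proof (intro exI[of _ "min d1 (d2 / 2)"] conjI allI impI)
    show "0 < min d1 (d2 / 2)" using d1(1) d2(1) by simp
    fix N \<theta> E i
    assume "time_partition T N \<theta> \<and> (\<forall>i<N. \<theta> (Suc i) - \<theta> i \<le> min d1 (d2 / 2)) \<and> backward N \<theta> P E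
      \<and> (\<forall>i\<le>N. E i \<in> K)" and i: "i \<le> N"
    then have part: "time_partition T N \<theta>" and fine: "\<And>i. i < N \<Longrightarrow> \<theta> (Suc i) - \<theta> i \<le> min d1 (d2 / 2)"
      and E: "backward N \<theta> P E" and EK: "\<And>i. i \<le> N \<Longrightarrow> E i \<in> K" by blast+
    have "norm (Y (\<theta> i) - E i) \<le> 2 * \<eta> * (T - \<theta> i) * exp (L * (T - \<theta> i))"
      using i
    proof (induction i rule: inc_induct)
      case base
      then show ?case using part E Y(1) by (simp add: time_partition_def backward_def)
    next
      case (step i)
      let ?s = "\<theta> i" and ?t = "\<theta> (Suc i)"
      define h where "h = ?t - ?s"
      define D where "D = Y ?t - E (Suc i)"
      have t: "?t \<in> {0..T}" and s: "?s \<in> {0..T}"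
        using step(2) time_partition_range[OF part, of "Suc i"] time_partition_range[OF part, of i] by simp_all
      have h: "0 < h" "h \<le> d1" "h < d2"
        using part fine[OF step(2)] step(2) d2(1) by (simp_all add: h_def time_partition_def)
      have Ei: "E (Suc i) \<in> K" using EK step(2) by simp
      have "norm (y ?t - \<F> ?t (E (Suc i)) 0) \<le> L * norm (?\<pi> (Y ?t) - E (Suc i))"
        unfolding y_def using closest_point_in_set[OF K'(2,3)] Ei by (intro L(2) t) (simp_all add: K)
      also have "\<dots> = L * norm (?\<pi> (Y ?t) - ?\<pi> (E (Suc i)))"
        by (simp add: closest_point_self[OF Ei])
      also have "\<dots> \<le> L * norm D"
        using closest_point_lipschitz[OF K', of "Y ?t" "E (Suc i)"] L(1)
        by (intro mult_left_mono) (simp_all add: dist_norm D_def)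
      finally have lip: "norm (y ?t - \<F> ?t (E (Suc i)) 0) \<le> L * norm D" .
      have cons: "norm (\<F> ?t (E (Suc i)) h - \<F> ?t (E (Suc i)) 0) \<le> \<eta>"
        using h by (intro d1(2) t Ei) simp_all
      have loc: "norm (Y ?t - Y ?s - h *\<^sub>R y ?t) \<le> \<eta> * h"
        using local[of ?s ?t] s t h by (simp add: h_def)
      have "E i = E (Suc i) - h *\<^sub>R \<F> ?t (E (Suc i)) h"
        using E step(2) by (simp add: backward_def back_def h_def)
      \<comment> \<open>The terms after \<open>D\<close> are the consistency error of the scheme,
        the local error of \<open>Y\<close> and the change of the vector field caused by
        \<open>D\<close>; the first two contribute \<open>\<eta> h\<close> each.\<close>
      then have eq: "Y ?s - E i = D + (h *\<^sub>R (\<F> ?t (E (Suc i)) h - \<F> ?t (E (Suc i)) 0)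
          - (Y ?t - Y ?s - h *\<^sub>R y ?t) - h *\<^sub>R (y ?t - \<F> ?t (E (Suc i)) 0))"
        by (simp add: D_def algebra_simps)
      have "norm (Y ?s - E i) \<le> norm D + (norm (h *\<^sub>R (\<F> ?t (E (Suc i)) h - \<F> ?t (E (Suc i)) 0))
          + norm (Y ?t - Y ?s - h *\<^sub>R y ?t) + norm (h *\<^sub>R (y ?t - \<F> ?t (E (Suc i)) 0)))"
        unfolding eq by (intro norm_triangle_mono norm_triangle_le_diff order_refl norm_triangle_ineq4 add_right_mono)
      also have "\<dots> \<le> norm D + (h * \<eta> + \<eta> * h + h * (L * norm D))"
        unfolding norm_scaleR abs_of_pos[OF h(1)]
        using mult_left_mono[OF cons less_imp_le[OF h(1)]] mult_left_mono[OF lip less_imp_le[OF h(1)]] loc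
        by linarith
      also have "\<dots> = (1 + L * h) * norm D + 2 * \<eta> * h"
        by (simp add: algebra_simps)
      also have "\<dots> \<le> exp (L * h) * (2 * \<eta> * (T - ?t) * exp (L * (T - ?t))) + 2 * \<eta> * h * exp (L * (T - ?s))"
      proof (rule add_mono)
        show "(1 + L * h) * norm D \<le> exp (L * h) * (2 * \<eta> * (T - ?t) * exp (L * (T - ?t)))"
          using step.IH by (intro mult_mono exp_ge_add_one_self) (simp_all add: D_def)
        have "2 * \<eta> * h * 1 \<le> 2 * \<eta> * h * exp (L * (T - ?s))"
          using \<eta> h(1) L(1) s by (intro mult_left_mono) simp_all
        then show "2 * \<eta> * h \<le> 2 * \<eta> * h * exp (L * (T - ?s))" by simp
      qed
      also have "exp (L * h) * (2 * \<eta> * (T - ?t) * exp (L * (T - ?t))) = 2 * \<eta> * (T - ?t) * exp (L * (T - ?s))"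
      proof -
        have "exp (L * h) * exp (L * (T - ?t)) = exp (L * (T - ?s))"
          by (simp add: h_def algebra_simps flip: exp_add)
        then show ?thesis by (metis mult.left_commute)
      qed
      also have "2 * \<eta> * (T - ?t) * exp (L * (T - ?s)) + 2 * \<eta> * h * exp (L * (T - ?s))
          = 2 * \<eta> * (T - ?s) * exp (L * (T - ?s))"
        by (simp add: h_def algebra_simps)
      finally show ?case .
    qed
    also have "\<dots> \<le> 2 * \<eta> * T * exp (L * T)"
      using time_partition_range[OF part i] \<eta> L(1) T
      by (intro mult_mono) (auto intro!: mult_left_mono)
    also have "\<dots> = e" using T by (simp add: \<eta>_def)
    finally show "norm (Y (\<theta> i) - E i) \<le> e" .
  qed
qed

text \<open>Free of extensionality, so that restrictions to shorter intervals and time shifts of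
  solutions are solutions again.\<close>

definition "riccati_solution P T E \<longleftrightarrow> (\<forall>t\<in>{0..T}. E t \<in> sym_psd) \<and>
  (\<forall>t\<in>{0..T}. (E has_vector_derivative \<F> t (E t) 0) (at t within {0..T})) \<and> E T = P"

lemma riccati_solution_continuous: "riccati_solution P T E \<Longrightarrow> continuous_on {0..T} E"
  by (rule continuous_on_vector_derivative[where f'="\<lambda>t. \<F> t (E t) 0"]) (simp add: riccati_solution_def)

lemma riccati_solution_exists:
  assumes P: "P \<in> sym_psd" and T: "0 < T"
  obtains Y where "riccati_solution P T Y"
    "\<And>e. 0 < e \<Longrightarrow> \<exists>d>0. \<forall>N \<theta>. time_partition T N \<theta> \<and> mesh N \<theta> \<le> d \<longrightarrow>
        (\<forall>i\<le>N. norm (Y (\<theta> i) - E_disc P N \<theta> i) \<le> e)"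
proof -
  obtain C where C: "0 \<le> C"
    "\<And>N \<theta> E i. time_partition T N \<theta> \<Longrightarrow> backward N \<theta> P E \<Longrightarrow> i \<le> N \<Longrightarrow> norm (E i) \<le> C"
    by (rule backward_bounded[OF P, of T]) (rule that)
  define K where "K = (sym_psd :: (real^'n^'n) set) \<inter> cball 0 C"
  obtain Y where Y: "Y T = P"
    "\<And>t. t \<in> {0..T} \<Longrightarrow> (Y has_vector_derivative \<F> t (closest_point K (Y t)) 0) (at t within {0..T})"
    by (rule truncated_riccati_exists[OF C(1) less_imp_le[OF T] K_def, of P]) (rule that)
  have bw: "backward N \<theta> P (E_disc P N \<theta>)" if "time_partition T N \<theta>" for N \<theta>
    using that by (intro backward_discrete_riccati P) (simp add: time_partition_def)
  have in_K: "E_disc P N \<theta> i \<in> K" if part: "time_partition T N \<theta>" and i: "i \<le> N" for N \<theta> i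
    using C(2)[OF part bw[OF part] i] backward_psd[OF bw[OF part] P _ i] part
    by (simp add: K_def time_partition_def)
  have conv: "\<exists>d>0. \<forall>N \<theta>. time_partition T N \<theta> \<and> mesh N \<theta> \<le> d \<longrightarrow>
        (\<forall>i\<le>N. norm (Y (\<theta> i) - E_disc P N \<theta> i) \<le> e)" if e: "0 < e" for e
  proof -
    obtain d where d: "0 < d"
      "\<forall>N \<theta> E. time_partition T N \<theta> \<and> (\<forall>i<N. \<theta> (Suc i) - \<theta> i \<le> d) \<and> backward N \<theta> P E
        \<and> (\<forall>i\<le>N. E i \<in> K) \<longrightarrow> (\<forall>i\<le>N. norm (Y (\<theta> i) - E i) \<le> e)"
      using truncated_riccati_error[OF C(1) T K_def Y e] by blast
    show ?thesis
    proof (intro exI[of _ d] conjI allI impI d(1))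
      fix N \<theta> i assume part: "time_partition T N \<theta> \<and> mesh N \<theta> \<le> d" and i: "i \<le> N"
      have "\<theta> (Suc i) - \<theta> i \<le> d" if "i < N" for i
        using time_partition_step_le_mesh[OF that, of \<theta>] part by linarith
      then show "norm (Y (\<theta> i) - E_disc P N \<theta> i) \<le> e"
        using part bw in_K by (intro d(2)[rule_format, OF _ i]) blast
    qed
  qed
  have Y_cont: "continuous_on {0..T} Y"
    using Y(2) by (rule continuous_on_vector_derivative)
  \<comment> \<open>\<open>K\<close> is closed, so approximation by discrete values in
    \<open>K\<close> is enough. The point \<open>t\<close> is close to a node of a fine uniform
    partition, and there \<open>Y\<close> is close to the discrete value.\<close>
  have Y_in: "Y t \<in> K" if t: "t \<in> {0..T}" for t
  proof -
    have "Y t \<in> closure K"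
      unfolding closure_approachable
    proof (intro allI impI)
      fix e :: real assume e: "0 < e"
      obtain r where r: "0 < r" "\<And>s. s \<in> {0..T} \<Longrightarrow> dist s t < r \<Longrightarrow> dist (Y s) (Y t) < e / 2"
        using Y_cont t e unfolding continuous_on_iff by (meson half_gt_zero)
      obtain d where d: "0 < d" "\<forall>N \<theta>. time_partition T N \<theta> \<and> mesh N \<theta> \<le> d \<longrightarrow>
          (\<forall>i\<le>N. norm (Y (\<theta> i) - E_disc P N \<theta> i) \<le> e / 2)"
        using conv[OF half_gt_zero[OF e]] by blast
      obtain N where N: "T / min d r < real N" using reals_Archimedean2 by blast
      have N0: "0 < N" using N T d(1) r(1) by (cases N) (auto simp: divide_less_0_iff)
      define h where "h = T / real N"
      have "0 < min d r" using d(1) r(1) by simp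
      then have "T < min d r * real N" using N by (simp only: pos_divide_less_eq mult.commute)
      then have "h < min d r" unfolding h_def using N0 by (simp only: pos_divide_less_eq of_nat_0_less_iff)
      then have h: "0 < h" "h < d" "h < r" using N0 T by (simp_all add: h_def)
      let ?\<theta> = "\<lambda>j. real j * h"
      have part: "time_partition T N ?\<theta>" unfolding h_def by (rule time_partition_uniform[OF T N0])
      have "mesh N ?\<theta> \<le> d"
        unfolding mesh_def using N0 h by (intro Max.boundedI) (auto simp: of_nat_diff algebra_simps)
      \<comment> \<open>The index of the last node not beyond \<open>t\<close>; its distance to
        \<open>t\<close> is less than \<open>h\<close>.\<close>
      define i where "i = nat \<lfloor>t / h\<rfloor>"
      have fl: "real i = of_int \<lfloor>t / h\<rfloor>" using t h by (simp add: i_def)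
      have "real i \<le> t / h" "t / h < real i + 1" unfolding fl by linarith+
      then have ti: "real i * h \<le> t" "t < real i * h + h" using h by (simp_all add: field_simps)
      have "real i * h \<le> real N * h" using ti t N0 by (simp add: h_def)
      then have i: "i \<le> N" using h by simp
      have "dist (Y (?\<theta> i)) (Y t) < e / 2"
        using ti h t by (intro r(2)) (auto simp: dist_real_def)
      moreover have "dist (E_disc P N ?\<theta> i) (Y (?\<theta> i)) \<le> e / 2"
        using d(2)[rule_format, OF conjI[OF part \<open>mesh N ?\<theta> \<le> d\<close>] i] by (simp add: dist_norm norm_minus_commute)
      ultimately have "dist (E_disc P N ?\<theta> i) (Y t) < e"
        using dist_triangle[of "E_disc P N ?\<theta> i" "Y t" "Y (?\<theta> i)"] by linarith
      then show "\<exists>y\<in>K. dist y (Y t) < e" using in_K[OF part i] by blast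
    qed
    moreover have "closed K" unfolding K_def by (intro closed_Int closed_sym_psd closed_cball)
    ultimately show ?thesis by simp
  qed
  have "riccati_solution P T Y"
    unfolding riccati_solution_def using Y Y_in by (auto simp: K_def closest_point_self)
  then show ?thesis using conv by (rule that)
qed

text \<open>On a ball containing both curves, the squared distance multiplied by
  \<open>exp (2 L t)\<close> is nondecreasing; as it vanishes at \<open>T\<close>, it vanishes
  before.\<close>

lemma riccati_solution_unique:
  assumes E: "riccati_solution P T E" and E': "riccati_solution P T E'" and t: "t \<in> {0..T}"
  shows "E t = E' t"
proof (cases "t = T")
  case True
  then show ?thesis using E E' by (simp add: riccati_solution_def)
next
  case False
  have "bounded (E ` {0..T} \<union> E' ` {0..T})"
    using E E' unfolding bounded_Un
    by (intro conjI compact_imp_bounded compact_continuous_image riccati_solution_continuous compact_Icc)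
  then obtain C where C: "\<And>t. t \<in> {0..T} \<Longrightarrow> norm (E t) \<le> C \<and> norm (E' t) \<le> C"
    unfolding bounded_iff by blast
  obtain L where L: "0 \<le> L" "\<And>t E E'. t \<in> {0..T} \<Longrightarrow> E \<in> sym_psd \<inter> cball 0 C \<Longrightarrow> E' \<in> sym_psd \<inter> cball 0 C
      \<Longrightarrow> norm (\<F> t E 0 - \<F> t E' 0) \<le> L * norm (E - E')"
    by (rule ric_zero_lipschitz) (rule that)
  define D where "D t = E t - E' t" for t
  define D' where "D' t = \<F> t (E t) 0 - \<F> t (E' t) 0" for t
  define \<phi> where "\<phi> t = (D t \<bullet> D t) * exp (2 * L * t)" for t
  have D: "(D has_vector_derivative D' s) (at s within {0..T})" if "s \<in> {0..T}" for s
    unfolding D_def[abs_def] D'_def using E E' that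
    by (intro has_vector_derivative_diff) (auto simp: riccati_solution_def)
  have \<phi>: "(\<phi> has_real_derivative (2 * (D s \<bullet> D' s) + 2 * L * (D s \<bullet> D s)) * exp (2 * L * s)) (at s within {0..T})"
    if s: "s \<in> {0..T}" for s
  proof -
    have "((\<lambda>s. D s \<bullet> D s) has_vector_derivative (D s \<bullet> D' s + D' s \<bullet> D s)) (at s within {0..T})"
      by (rule bounded_bilinear.has_vector_derivative[OF bounded_bilinear_inner D[OF s] D[OF s]])
    then have d: "((\<lambda>s. D s \<bullet> D s) has_real_derivative 2 * (D s \<bullet> D' s)) (at s within {0..T})"
      by (simp add: has_real_derivative_iff_has_vector_derivative inner_commute)
    show ?thesis unfolding \<phi>_def[abs_def]
      by (rule derivative_eq_intros d refl | simp add: algebra_simps)+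
  qed
  have nonneg: "0 \<le> (2 * (D s \<bullet> D' s) + 2 * L * (D s \<bullet> D s)) * exp (2 * L * s)" if s: "s \<in> {0..T}" for s
  proof -
    have "norm (D' s) \<le> L * norm (D s)"
      unfolding D_def D'_def using C[OF s] E E' s
      by (intro L(2) s) (auto simp: riccati_solution_def)
    then have "norm (D s) * norm (D' s) \<le> norm (D s) * (L * norm (D s))"
      by (rule mult_left_mono) simp
    moreover have "- (D s \<bullet> D' s) \<le> norm (D s) * norm (D' s)"
      using norm_cauchy_schwarz[of "- D s" "D' s"] by simp
    ultimately have "- (D s \<bullet> D' s) \<le> L * (D s \<bullet> D s)"
      by (simp add: power2_norm_eq_inner[symmetric] power2_eq_square mult.left_commute)
    then show ?thesis by (intro mult_nonneg_nonneg) simp_all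
  qed
  have "\<exists>s\<in>{t<..<T}. \<phi> T - \<phi> t = (2 * (D s \<bullet> D' s) + 2 * L * (D s \<bullet> D s)) * exp (2 * L * s) * (T - t)"
  proof (rule mvt_simple)
    show "t < T" using t False by simp
    fix s assume "t \<le> s" "s \<le> T"
    then show "(\<phi> has_derivative (*) ((2 * (D s \<bullet> D' s) + 2 * L * (D s \<bullet> D s)) * exp (2 * L * s))) (at s within {t..T})"
      using \<phi>[of s] t by (auto simp: has_field_derivative_def intro: has_derivative_subset)
  qed
  then obtain s where s: "s \<in> {t<..<T}"
    "\<phi> T - \<phi> t = (2 * (D s \<bullet> D' s) + 2 * L * (D s \<bullet> D s)) * exp (2 * L * s) * (T - t)" by blast
  have "0 \<le> \<phi> T - \<phi> t"
    unfolding s(2) using s(1) t by (intro mult_nonneg_nonneg nonneg) auto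
  moreover have "\<phi> T = 0" using E E' by (simp add: \<phi>_def D_def riccati_solution_def)
  ultimately have "\<phi> t \<le> 0" by simp
  then have "D t \<bullet> D t \<le> 0" by (simp add: \<phi>_def mult_le_0_iff)
  then have "D t = 0" by (metis inner_gt_zero_iff not_le)
  then show ?thesis by (simp add: D_def)
qed

text \<open>Restricting any solution to \<open>[0, T]\<close> makes it extensional, and uniqueness
  on \<open>[0, T]\<close> then justifies the definite description.\<close>

lemma riccati_solution_finite_riccati:
  assumes P: "P \<in> sym_psd" and T: "0 < T"
  shows "riccati_solution P T (E_fin P T)"
proof -
  let ?sol = "\<lambda>E. E \<in> {0..T} \<rightarrow>\<^sub>E sym_psd \<and>
     (\<forall>t\<in>{0..T}. (E has_vector_derivative \<F> t (E t) 0) (at t within {0..T})) \<and> E T = P"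
  have sol: "riccati_solution P T E" if "?sol E" for E
    using that by (auto simp: riccati_solution_def)
  obtain Y where Y: "riccati_solution P T Y"
    by (rule riccati_solution_exists[OF P T]) (rule that)
  have "\<exists>!E. ?sol E"
  proof (rule ex1I[of _ "restrict Y {0..T}"])
    have "(restrict Y {0..T} has_vector_derivative \<F> t (Y t) 0) (at t within {0..T})" if "t \<in> {0..T}" for t
    proof (rule has_vector_derivative_transform[OF that])
      show "(Y has_vector_derivative \<F> t (Y t) 0) (at t within {0..T})"
        using Y that by (simp add: riccati_solution_def)
    qed simp
    then show "?sol (restrict Y {0..T})"
      using Y T by (auto simp: riccati_solution_def)
    fix E assume E: "?sol E"
    show "E = restrict Y {0..T}"
    proof
      fix t show "E t = restrict Y {0..T} t"
        using riccati_solution_unique[OF sol[OF E] Y, of t] E by (cases "t \<in> {0..T}") auto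
    qed
  qed
  from theI'[OF this] show ?thesis
    using sol unfolding finite_riccati_def by blast
qed

lemma finite_riccati_eq:
  assumes "riccati_solution P T E" "P \<in> sym_psd" "0 < T" "t \<in> {0..T}"
  shows "E_fin P T t = E t"
  using riccati_solution_unique[OF riccati_solution_finite_riccati assms(1)] assms by blast

lemma discrete_riccati_converges:
  assumes P: "P \<in> sym_psd" and T: "0 < T" and e: "0 < e"
  shows "\<exists>d>0. \<forall>N \<theta>. time_partition T N \<theta> \<and> mesh N \<theta> \<le> d \<longrightarrow>
    (\<forall>i\<le>N. norm (E_fin P T (\<theta> i) - E_disc P N \<theta> i) \<le> e)"
proof -
  obtain Y where Y: "riccati_solution P T Y"
    and conv: "\<And>e. 0 < e \<Longrightarrow> \<exists>d>0. \<forall>N \<theta>. time_partition T N \<theta> \<and> mesh N \<theta> \<le> d \<longrightarrow>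
        (\<forall>i\<le>N. norm (Y (\<theta> i) - E_disc P N \<theta> i) \<le> e)"
    by (rule riccati_solution_exists[OF P T]) (rule that)
  from conv[OF e] obtain d where d: "0 < d" "\<forall>N \<theta>. time_partition T N \<theta> \<and> mesh N \<theta> \<le> d \<longrightarrow>
      (\<forall>i\<le>N. norm (Y (\<theta> i) - E_disc P N \<theta> i) \<le> e)" by blast
  show ?thesis
  proof (intro exI[of _ d] conjI allI impI d(1))
    fix N \<theta> i assume part: "time_partition T N \<theta> \<and> mesh N \<theta> \<le> d" and i: "i \<le> N"
    then have "E_fin P T (\<theta> i) = Y (\<theta> i)"
      by (intro finite_riccati_eq[OF Y P T] time_partition_range) simp_all
    with d(2)[rule_format, OF part i]
    show "norm (E_fin P T (\<theta> i) - E_disc P N \<theta> i) \<le> e" by simp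
  qed
qed

end

subsection \<open>Absolutely continuous trajectories\<close>

text \<open>A Cousin-type argument: on a fine tagged division the intervals tagged outside \<open>N\<close> are handled
  by the derivative, those tagged in \<open>N\<close> have small total length and are handled by absolute
  continuity.\<close>

lemma abs_cont_increment_ge:
  fixes \<phi> :: "real \<Rightarrow> real"
  assumes ab: "a \<le> b" and AC: "abs_cont_on {a..b} \<phi>" and N: "negligible N"
    and der: "\<And>t. t \<in> {a..b} - N \<Longrightarrow> \<exists>d. (\<phi> has_real_derivative d) (at t within {a..b}) \<and> - l t \<le> d"
    and int: "(l has_integral I) {a..b}"
  shows "- I \<le> \<phi> b - \<phi> a"
proof -
  \<comment> \<open>The error consists of \<open>e (b - a)\<close> from the derivative at tags
    outside \<open>N\<close>, one \<open>e\<close> from the Riemann sum and one \<open>e\<close>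
    from absolute continuity.\<close>
  have main: "- I \<le> \<phi> b - \<phi> a + e * (b - a + 2)" if e: "0 < e" for e
  proof -
    obtain \<delta> where \<delta>: "0 < \<delta>" and AC\<delta>: "\<forall>J. finite J \<and> (\<forall>(u, v)\<in>J. u \<le> v \<and> {u..v} \<subseteq> {a..b}) \<and>
        disjoint_family_on (\<lambda>(u, v). {u<..<v}) J \<and> (\<Sum>(u, v)\<in>J. v - u) < \<delta> \<longrightarrow>
        (\<Sum>(u, v)\<in>J. norm (\<phi> v - \<phi> u)) < e"
      using AC e unfolding abs_cont_on_def by blast
    \<comment> \<open>Nothing is known about \<open>l\<close> on \<open>N\<close>; its values there
      are set to 0, so that tags in \<open>N\<close> do not enter the Riemann sum.\<close>
    define l' where "l' t = (if t \<in> N then 0 else l t)" for t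
    have "(l' has_integral I) {a..b}"
      by (rule has_integral_spike[OF N _ int]) (simp add: l'_def)
    then obtain g1 where g1: "gauge g1" "\<forall>p. p tagged_division_of {a..b} \<and> g1 fine p \<longrightarrow>
        norm ((\<Sum>(x, K)\<in>p. measure lborel K *\<^sub>R l' x) - I) < e"
      using e unfolding has_integral_real by meson
    \<comment> \<open>The Riemann sums of the indicator are the total length of the intervals tagged
      in \<open>N\<close>; a fine division makes it less than \<open>\<delta>\<close>.\<close>
    have "(indicator N has_integral (0::real)) {a..b}"
      using N unfolding negligible_def box_real[symmetric] by blast
    then obtain g2 where g2: "gauge g2" "\<forall>p. p tagged_division_of {a..b} \<and> g2 fine p \<longrightarrow>
        norm ((\<Sum>(x, K)\<in>p. measure lborel K *\<^sub>R (indicator N x :: real)) - 0) < \<delta>"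
      using \<delta> unfolding has_integral_real by meson
    have "\<exists>r>0. t \<in> {a..b} - N \<longrightarrow> (\<exists>d\<ge>- l t. \<forall>y\<in>{a..b}. \<bar>y - t\<bar> < r \<longrightarrow> \<bar>\<phi> y - \<phi> t - d * (y - t)\<bar> \<le> e * \<bar>y - t\<bar>)" for t
    proof (cases "t \<in> {a..b} - N")
      case True
      then obtain d where d: "(\<phi> has_real_derivative d) (at t within {a..b})" "- l t \<le> d"
        using der by blast
      then obtain r where "r > 0" "\<forall>y\<in>{a..b}. norm (y - t) < r \<longrightarrow> norm (\<phi> y - \<phi> t - d * (y - t)) \<le> e * norm (y - t)"
        using e unfolding has_field_derivative_def has_derivative_within_alt by blast
      with d show ?thesis by auto
    qed (use zero_less_one in blast)
    then obtain r where r: "\<And>t. 0 < r t" "\<And>t. t \<in> {a..b} - N \<Longrightarrow>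
        \<exists>d\<ge>- l t. \<forall>y\<in>{a..b}. \<bar>y - t\<bar> < r t \<longrightarrow> \<bar>\<phi> y - \<phi> t - d * (y - t)\<bar> \<le> e * \<bar>y - t\<bar>"
      by metis
    have "gauge (\<lambda>x. (g1 x \<inter> g2 x) \<inter> ball x (r x))"
      using g1(1) g2(1) r(1) by (intro gauge_Int gauge_ball_dependent) auto
    then obtain p where p: "p tagged_division_of {a..b}" and "(\<lambda>x. (g1 x \<inter> g2 x) \<inter> ball x (r x)) fine p"
      by (rule fine_division_exists_real)
    then have fine: "g1 fine p" "g2 fine p" "(\<lambda>x. ball x (r x)) fine p"
      unfolding fine_def by blast+
    have fin: "finite p" using p by blast
    have piece: "\<exists>u v. snd c = {u..v} \<and> u \<le> fst c \<and> fst c \<le> v \<and> a \<le> u \<and> v \<le> b" if cp: "c \<in> p" for c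
    proof -
      obtain x K where c: "c = (x, K)" by (cases c)
      obtain u v where K: "K = {u..v}"
        using tagged_division_ofD(4)[OF p, of x K] cp c unfolding box_real by blast
      moreover have "x \<in> K" "K \<subseteq> {a..b}"
        using tagged_division_ofD(2,3)[OF p, of x K] cp c by auto
      ultimately show ?thesis using c by auto
    qed
    define u where "u c = Inf (snd c)" for c :: "real \<times> real set"
    define v where "v c = Sup (snd c)" for c :: "real \<times> real set"
    have uv: "snd c = {u c..v c}" "u c \<le> fst c" "fst c \<le> v c" "a \<le> u c" "v c \<le> b"
      "measure lborel (snd c) = v c - u c" if c: "c \<in> p" for c
    proof -
      obtain s t where st: "snd c = {s..t}" "s \<le> fst c" "fst c \<le> t" "a \<le> s" "t \<le> b"
        using piece[OF c] by blast
      then have "u c = s" "v c = t" by (simp_all add: u_def v_def)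
      with st show "snd c = {u c..v c}" "u c \<le> fst c" "fst c \<le> v c" "a \<le> u c" "v c \<le> b"
        "measure lborel (snd c) = v c - u c" by simp_all
    qed
    \<comment> \<open>Degenerate intervals are left out: for the others disjoint interiors make
      \<open>c \<mapsto> (u c, v c)\<close> injective, and absolute continuity is stated for sets of
      pairs.\<close>
    define pN where "pN = {c \<in> p. fst c \<in> N \<and> u c < v c}"
    have pN: "finite pN" "pN \<subseteq> p" using fin by (auto simp: pN_def)
    have disj: "{u c<..<v c} \<inter> {u c'<..<v c'} = {}" if "c \<in> pN" "c' \<in> pN" "c \<noteq> c'" for c c'
    proof -
      have "interior (snd c) \<inter> interior (snd c') = {}"
        using tagged_division_ofD(5)[OF p, of "fst c" "snd c" "fst c'" "snd c'"] that pN(2) by auto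
      moreover have "interior (snd c) = {u c<..<v c}" if "c \<in> pN" for c
        using uv(1)[OF subsetD[OF pN(2) that]] by (metis interior_atLeastAtMost_real)
      ultimately show ?thesis using that by simp
    qed
    have inj: "inj_on (\<lambda>c. (u c, v c)) pN"
    proof (rule inj_onI, rule ccontr)
      fix c c' assume c: "c \<in> pN" "c' \<in> pN" "(u c, v c) = (u c', v c')" "c \<noteq> c'"
      then have "{u c<..<v c} = {}" using disj[OF c(1,2,4)] by simp
      then show False using c(1) by (simp add: pN_def)
    qed
    have "(\<Sum>c\<in>pN. norm (\<phi> (v c) - \<phi> (u c))) < e"
    proof -
      let ?J = "(\<lambda>c. (u c, v c)) ` pN"
      have "(\<Sum>(u, v)\<in>?J. norm (\<phi> v - \<phi> u)) < e"
      proof (rule AC\<delta>[rule_format], intro conjI)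
        show "finite ?J" using pN(1) by simp
        show "\<forall>(u, v)\<in>?J. u \<le> v \<and> {u..v} \<subseteq> {a..b}"
        proof (clarsimp)
          fix c assume "c \<in> pN"
          then have "c \<in> p" using pN(2) by blast
          from uv[OF this] show "u c \<le> v c \<and> (u c \<le> v c \<longrightarrow> a \<le> u c \<and> v c \<le> b)" by auto
        qed
        show "disjoint_family_on (\<lambda>(u, v). {u<..<v}) ?J"
          using disj unfolding disjoint_family_on_def by fastforce
        have "(\<Sum>(u, v)\<in>?J. v - u) = (\<Sum>c\<in>pN. v c - u c)"
          using sum.reindex[OF inj, of "\<lambda>(u, v). v - u"] by (simp add: o_def)
        also have "\<dots> \<le> (\<Sum>(x, K)\<in>p. measure lborel K *\<^sub>R (indicator N x :: real))"
          unfolding split_def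
        proof (rule sum_le_included[OF pN(1) fin, where i="\<lambda>c. c"])
          show "\<forall>c\<in>p. 0 \<le> measure lborel (snd c) *\<^sub>R (indicator N (fst c) :: real)" by simp
          show "\<forall>c\<in>pN. \<exists>c'\<in>p. c' = c \<and> v c - u c \<le> measure lborel (snd c') *\<^sub>R (indicator N (fst c') :: real)"
            using uv(6) by (auto simp: pN_def)
        qed
        also have "\<dots> < \<delta>" using g2(2)[rule_format, OF conjI[OF p fine(2)]] by simp
        finally show "(\<Sum>(u, v)\<in>?J. v - u) < \<delta>" .
      qed
      then show ?thesis
        using sum.reindex[OF inj, of "\<lambda>(u, v). norm (\<phi> v - \<phi> u)"] by (simp add: o_def)
    qed
    moreover have len: "(\<Sum>c\<in>p. v c - u c) = b - a" and "(\<Sum>c\<in>p. \<phi> (v c) - \<phi> (u c)) = \<phi> b - \<phi> a"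
      using additive_tagged_division_1[OF ab p, of "\<lambda>x. x"] additive_tagged_division_1[OF ab p, of \<phi>]
      by (simp_all add: u_def v_def split_def)
    moreover have "(\<Sum>c\<in>p. (v c - u c) * l' (fst c)) < I + e"
    proof -
      have "(\<Sum>(x, K)\<in>p. measure lborel K *\<^sub>R l' x) = (\<Sum>c\<in>p. (v c - u c) * l' (fst c))"
        unfolding split_def using uv(6) by (intro sum.cong) auto
      then show ?thesis using g1(2)[rule_format, OF conjI[OF p fine(1)]] by (simp add: abs_less_iff)
    qed
    moreover have "(\<Sum>c\<in>p. - ((v c - u c) * l' (fst c)) - e * (v c - u c)
        - (if c \<in> pN then norm (\<phi> (v c) - \<phi> (u c)) else 0)) \<le> (\<Sum>c\<in>p. \<phi> (v c) - \<phi> (u c))"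
    proof (rule sum_mono)
      fix c assume c: "c \<in> p"
      let ?x = "fst c"
      show "- ((v c - u c) * l' ?x) - e * (v c - u c)
        - (if c \<in> pN then norm (\<phi> (v c) - \<phi> (u c)) else 0) \<le> \<phi> (v c) - \<phi> (u c)"
      proof (cases "?x \<in> N")
        case True
        have "0 \<le> e * (v c - u c)" using uv[OF c] e by simp
        moreover have "c \<in> pN \<or> u c = v c" using uv[OF c] c True by (auto simp: pN_def)
        ultimately show ?thesis using True by (auto simp: l'_def)
      next
        case False
        then have x: "?x \<in> {a..b} - N" using uv[OF c] by auto
        then obtain d where d: "- l ?x \<le> d"
          "\<And>y. y \<in> {a..b} \<Longrightarrow> \<bar>y - ?x\<bar> < r ?x \<Longrightarrow> \<bar>\<phi> y - \<phi> ?x - d * (y - ?x)\<bar> \<le> e * \<bar>y - ?x\<bar>"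
          using r(2) by blast
        have "snd c \<subseteq> ball ?x (r ?x)" using bspec[OF fine(3)[unfolded fine_def] c] unfolding split_def .
        moreover have "u c \<in> snd c" "v c \<in> snd c" using uv[OF c] by simp_all
        ultimately have "u c \<in> ball ?x (r ?x)" "v c \<in> ball ?x (r ?x)" by blast+
        then have "\<bar>u c - ?x\<bar> < r ?x" "\<bar>v c - ?x\<bar> < r ?x" by (simp_all add: dist_real_def abs_minus_commute)
        then have "\<bar>\<phi> (u c) - \<phi> ?x - d * (u c - ?x)\<bar> \<le> e * \<bar>u c - ?x\<bar>"
          "\<bar>\<phi> (v c) - \<phi> ?x - d * (v c - ?x)\<bar> \<le> e * \<bar>v c - ?x\<bar>"
          using uv[OF c] by (intro d(2); simp)+
        moreover have "\<bar>u c - ?x\<bar> = ?x - u c" "\<bar>v c - ?x\<bar> = v c - ?x" using uv[OF c] by simp_all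
        ultimately have "d * (v c - u c) - e * (v c - u c) \<le> \<phi> (v c) - \<phi> (u c)"
          by (simp add: abs_le_iff algebra_simps)
        moreover have "- l ?x * (v c - u c) \<le> d * (v c - u c)"
          using uv[OF c] d(1) by (intro mult_right_mono) auto
        ultimately show ?thesis using False by (simp add: l'_def pN_def mult.commute)
      qed
    qed
    moreover have "(\<Sum>c\<in>p. - ((v c - u c) * l' (fst c)) - e * (v c - u c)
        - (if c \<in> pN then norm (\<phi> (v c) - \<phi> (u c)) else 0))
        = - (\<Sum>c\<in>p. (v c - u c) * l' (fst c)) - e * (\<Sum>c\<in>p. v c - u c) - (\<Sum>c\<in>pN. norm (\<phi> (v c) - \<phi> (u c)))"
    proof -
      have "(\<Sum>c\<in>p. if c \<in> pN then norm (\<phi> (v c) - \<phi> (u c)) else 0) = (\<Sum>c\<in>pN. norm (\<phi> (v c) - \<phi> (u c)))"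
        using sum.inter_restrict[OF fin, of "\<lambda>c. norm (\<phi> (v c) - \<phi> (u c))" pN] pN(2)
        by (simp add: Int_absorb1)
      moreover have "(\<Sum>c\<in>p. e * (v c - u c)) = e * (\<Sum>c\<in>p. v c - u c)"
        by (rule sum_distrib_left[symmetric])
      ultimately show ?thesis by (simp only: sum_subtractf sum_negf)
    qed
    moreover have "e * (\<Sum>c\<in>p. v c - u c) = e * (b - a)" by (simp only: len)
    ultimately have "- (I + e) - e * (b - a) - e \<le> \<phi> b - \<phi> a" by linarith
    then show ?thesis by (simp add: algebra_simps)
  qed
  show ?thesis
  proof (rule field_le_epsilon)
    fix e :: real assume e: "0 < e"
    have "0 < b - a + 2" using ab by simp
    with main[of "e / (b - a + 2)"] e show "- I \<le> \<phi> b - \<phi> a + e" by simp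
  qed
qed

lemma abs_cont_on_imp_continuous_on:
  fixes f :: "real \<Rightarrow> 'a::real_normed_vector"
  assumes "abs_cont_on {a..b} f"
  shows "continuous_on {a..b} f"
  unfolding continuous_on_iff
proof (intro ballI allI impI)
  fix s e :: real assume s: "s \<in> {a..b}" and e: "0 < e"
  then obtain d where d: "0 < d" "\<And>I. finite I \<and> (\<forall>(u, v)\<in>I. u \<le> v \<and> {u..v} \<subseteq> {a..b}) \<and>
        disjoint_family_on (\<lambda>(u, v). {u<..<v}) I \<and> (\<Sum>(u, v)\<in>I. v - u) < d \<longrightarrow>
        (\<Sum>(u, v)\<in>I. norm (f v - f u)) < e"
    using assms unfolding abs_cont_on_def by blast
  have "dist (f t) (f s) < e" if t: "t \<in> {a..b}" "dist t s < d" for t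
  proof -
    have "norm (f (max s t) - f (min s t)) < e"
      using d(2)[of "{(min s t, max s t)}"] t s
      by (auto simp: disjoint_family_on_def dist_real_def)
    then show ?thesis by (auto simp: dist_norm norm_minus_commute max_def min_def split: if_splits)
  qed
  with d(1) show "\<exists>d>0. \<forall>t\<in>{a..b}. dist t s < d \<longrightarrow> dist (f t) (f s) < e" by blast
qed

text \<open>One criterion for all functions built from an absolutely continuous one together with
  Lipschitz data: quadratic forms along a trajectory, differences of trajectories,
  restrictions.\<close>

lemma abs_cont_on_controlled:
  fixes f :: "real \<Rightarrow> 'a::real_normed_vector" and g :: "real \<Rightarrow> 'b::real_normed_vector"
  assumes f: "abs_cont_on S f" and T: "T \<subseteq> S" and K: "0 \<le> K"
    and g: "\<And>u v. u \<in> T \<Longrightarrow> v \<in> T \<Longrightarrow> u \<le> v \<Longrightarrow> norm (g v - g u) \<le> K * (norm (f v - f u) + (v - u))"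
  shows "abs_cont_on T g"
  unfolding abs_cont_on_def
proof (intro allI impI)
  fix e :: real assume e: "0 < e"
  \<comment> \<open>One half for each of the two sums; \<open>K + 1\<close> avoids division by
    zero.\<close>
  define e' where "e' = e / (K + 1) / 2"
  have e': "0 < e'" using e K by (simp add: e'_def)
  then obtain d where d: "0 < d" "\<And>I. finite I \<and> (\<forall>(u, v)\<in>I. u \<le> v \<and> {u..v} \<subseteq> S) \<and>
        disjoint_family_on (\<lambda>(u, v). {u<..<v}) I \<and> (\<Sum>(u, v)\<in>I. v - u) < d \<longrightarrow>
        (\<Sum>(u, v)\<in>I. norm (f v - f u)) < e'"
    using f unfolding abs_cont_on_def by blast
  show "\<exists>d>0. \<forall>I. finite I \<and> (\<forall>(u, v)\<in>I. u \<le> v \<and> {u..v} \<subseteq> T) \<and>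
        disjoint_family_on (\<lambda>(u, v). {u<..<v}) I \<and> (\<Sum>(u, v)\<in>I. v - u) < d \<longrightarrow>
        (\<Sum>(u, v)\<in>I. norm (g v - g u)) < e"
  proof (intro exI[of _ "min d e'"] conjI allI impI)
    show "0 < min d e'" using d(1) e' by simp
    fix I assume I: "finite I \<and> (\<forall>(u, v)\<in>I. u \<le> v \<and> {u..v} \<subseteq> T) \<and>
        disjoint_family_on (\<lambda>(u, v). {u<..<v}) I \<and> (\<Sum>(u, v)\<in>I. v - u) < min d e'"
    have "(\<Sum>(u, v)\<in>I. norm (g v - g u)) \<le> (\<Sum>(u, v)\<in>I. K * (norm (f v - f u) + (v - u)))"
    proof (rule sum_mono, clarify)
      fix u v assume "(u, v) \<in> I"
      then have "u \<le> v" "{u..v} \<subseteq> T" using I by auto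
      then show "norm (g v - g u) \<le> K * (norm (f v - f u) + (v - u))" by (intro g) auto
    qed
    also have "\<dots> = K * ((\<Sum>(u, v)\<in>I. norm (f v - f u)) + (\<Sum>(u, v)\<in>I. v - u))"
      by (simp add: split_def sum.distrib flip: sum_distrib_left)
    also have "\<dots> \<le> K * (e' + e')"
    proof -
      have "\<forall>(u, v)\<in>I. u \<le> v \<and> {u..v} \<subseteq> S" using I T by blast
      moreover have "(\<Sum>(u, v)\<in>I. v - u) < d" using I by simp
      ultimately have "(\<Sum>(u, v)\<in>I. norm (f v - f u)) < e'" using d(2)[of I] I by blast
      then show ?thesis using I K by (intro mult_left_mono add_mono) auto
    qed
    also have "e' + e' = e / (K + 1)" by (simp only: e'_def field_sum_of_halves)
    also have "K * (e / (K + 1)) < e" using e K by (simp add: field_simps)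
    finally show "(\<Sum>(u, v)\<in>I. norm (g v - g u)) < e" .
  qed
qed

lemma abs_cont_on_subset: "abs_cont_on S f \<Longrightarrow> T \<subseteq> S \<Longrightarrow> abs_cont_on T f"
  for f :: "real \<Rightarrow> 'a::real_normed_vector"
  by (rule abs_cont_on_controlled[of S f T 1]) simp_all

lemma bounded_derivative_lipschitz:
  fixes f :: "real \<Rightarrow> 'a::real_normed_vector"
  assumes f: "\<And>t. t \<in> {a..b} \<Longrightarrow> (f has_vector_derivative f' t) (at t within {a..b})"
    and bound: "\<And>t. t \<in> {a..b} \<Longrightarrow> norm (f' t) \<le> M"
    and uv: "u \<in> {a..b}" "v \<in> {a..b}"
  shows "norm (f v - f u) \<le> M * \<bar>v - u\<bar>"
proof -
  have "norm (f v - f u) \<le> M * norm (v - u)"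
  proof (rule differentiable_bound[of "{a..b}" f "\<lambda>t h. h *\<^sub>R f' t"])
    show "onorm (\<lambda>h. h *\<^sub>R f' t) \<le> M" if "t \<in> {a..b}" for t
      using bound[OF that] by (simp add: onorm_scaleR_left onorm_id)
  qed (use f uv in \<open>simp_all add: has_vector_derivative_def\<close>)
  then show ?thesis by simp
qed

text \<open>The product rule for \<open><E x, x>\<close> holds outside a null set, and the form is
  absolutely continuous since its increments are controlled by those of \<open>x\<close> and by
  elapsed time. Used twice: with a Riccati solution to compare value and cost, and with a scalar
  weight to show that states are unique.\<close>

lemma quad_increment_ge:
  fixes x :: "real \<Rightarrow> real^'n" and E E' :: "real \<Rightarrow> real^'n^'n"
  assumes ab: "a \<le> b" and AC: "abs_cont_on {a..b} x"
    and E: "\<And>t. t \<in> {a..b} \<Longrightarrow> (E has_vector_derivative E' t) (at t within {a..b})"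
    and E': "continuous_on {a..b} E'" and sym: "\<And>t. t \<in> {a..b} \<Longrightarrow> transpose (E t) = E t"
    and N: "negligible N"
    and x: "\<And>t. t \<in> {a..b} - N \<Longrightarrow> (x has_vector_derivative v t) (at t within {a..b})"
    and ge: "\<And>t. t \<in> {a..b} - N \<Longrightarrow> - l t \<le> quad (E' t) (x t) + 2 * ((E t *v x t) \<bullet> v t)"
    and int: "(l has_integral I) {a..b}"
  shows "- I \<le> quad (E b) (x b) - quad (E a) (x a)"
proof (rule abs_cont_increment_ge[OF ab _ N _ int])
  have x_cont: "continuous_on {a..b} x" using AC by (rule abs_cont_on_imp_continuous_on)
  have E_cont: "continuous_on {a..b} E" using E by (rule continuous_on_vector_derivative)
  obtain c1 where c1: "0 \<le> c1" "\<And>t. t \<in> {a..b} \<Longrightarrow> norm (x t) \<le> c1"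
    by (rule continuous_on_compact_bound[OF compact_Icc x_cont]) (rule that)
  obtain c2 where c2: "0 \<le> c2" "\<And>t. t \<in> {a..b} \<Longrightarrow> norm (E t) \<le> c2"
    by (rule continuous_on_compact_bound[OF compact_Icc E_cont]) (rule that)
  obtain c3 where c3: "0 \<le> c3" "\<And>t. t \<in> {a..b} \<Longrightarrow> norm (E' t) \<le> c3"
    by (rule continuous_on_compact_bound[OF compact_Icc E']) (rule that)
  show "abs_cont_on {a..b} (\<lambda>t. quad (E t) (x t))"
  proof (rule abs_cont_on_controlled[OF AC order_refl, of "c2 * (2 * c1) + c3 * c1\<^sup>2"])
    show "0 \<le> c2 * (2 * c1) + c3 * c1\<^sup>2" using c1(1) c2(1) c3(1) by simp
    fix s t assume st: "s \<in> {a..b}" "t \<in> {a..b}" "s \<le> t"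
    \<comment> \<open>Symmetry lets the difference of two squares factor, which isolates the
      increment of \<open>x\<close>.\<close>
    have eq: "quad (E t) (x t) - quad (E s) (x s)
        = quad (E t - E s) (x t) + (E s *v (x t + x s)) \<bullet> (x t - x s)"
      using sym_inner[OF sym[OF st(1)], of "x t" "x s"]
      by (simp add: quad_diff algebra_simps inner_add_left inner_diff_right)
    have "\<bar>quad (E t - E s) (x t)\<bar> \<le> norm (E t - E s) * (norm (x t))\<^sup>2"
      using quad_le_norm[of "E t - E s" "x t"] quad_le_norm[of "E s - E t" "x t"]
      by (simp add: abs_le_iff quad_diff norm_minus_commute)
    also have "\<dots> \<le> c3 * (t - s) * c1\<^sup>2"
      using bounded_derivative_lipschitz[OF E c3(2) st(1,2)] c1(2)[OF st(2)] st c3(1)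
      by (intro mult_mono power_mono) simp_all
    finally have 1: "\<bar>quad (E t - E s) (x t)\<bar> \<le> c3 * (t - s) * c1\<^sup>2" .
    have "\<bar>(E s *v (x t + x s)) \<bullet> (x t - x s)\<bar> \<le> norm (E s) * norm (x t + x s) * norm (x t - x s)"
      by (intro order_trans[OF Cauchy_Schwarz_ineq2] mult_right_mono norm_matrix_vector_le) simp
    also have "\<dots> \<le> c2 * (2 * c1) * norm (x t - x s)"
      using norm_triangle_ineq[of "x t" "x s"] c1(2)[OF st(1)] c1(2)[OF st(2)] c2(2)[OF st(1)] c1(1) c2(1)
      by (intro mult_mono mult_right_mono) simp_all
    finally have 2: "\<bar>(E s *v (x t + x s)) \<bullet> (x t - x s)\<bar> \<le> c2 * (2 * c1) * norm (x t - x s)" .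
    have "\<bar>quad (E t) (x t) - quad (E s) (x s)\<bar> \<le> c2 * (2 * c1) * norm (x t - x s) + c3 * c1\<^sup>2 * (t - s)"
      unfolding eq using 1 2 by (simp add: algebra_simps)
    also have "\<dots> \<le> (c2 * (2 * c1) + c3 * c1\<^sup>2) * (norm (x t - x s) + (t - s))"
    proof -
      have "0 \<le> c2 * (2 * c1) * (t - s)" "0 \<le> c3 * c1\<^sup>2 * norm (x t - x s)" using c1(1) c2(1) c3(1) st by simp_all
      then show ?thesis by (simp only: distrib_left distrib_right)
    qed
    finally show "norm (quad (E t) (x t) - quad (E s) (x s)) \<le> (c2 * (2 * c1) + c3 * c1\<^sup>2) * (norm (x t - x s) + (t - s))"
      by simp
  qed
  fix t assume t: "t \<in> {a..b} - N"
  have tab: "t \<in> {a..b}" using t by simp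
  note d = bounded_bilinear.has_vector_derivative[OF bounded_bilinear_inner
      has_vector_derivative_matrix_vector_mult[OF E[OF tab] x[OF t]] x[OF t]]
  have "(E t *v x t) \<bullet> v t + (E t *v v t + E' t *v x t) \<bullet> x t = quad (E' t) (x t) + 2 * ((E t *v x t) \<bullet> v t)"
    using sym_inner[OF sym[OF tab], of "x t" "v t"] by (simp add: inner_add_left)
  with d have "((\<lambda>t. quad (E t) (x t)) has_real_derivative quad (E' t) (x t) + 2 * ((E t *v x t) \<bullet> v t)) (at t within {a..b})"
    unfolding has_real_derivative_iff_has_vector_derivative by (rule has_vector_derivative_eq_rhs)
  with ge[OF t]
  show "\<exists>d. ((\<lambda>t. quad (E t) (x t)) has_real_derivative d) (at t within {a..b}) \<and> - l t \<le> d"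
    by blast
qed

lemma trajectory_negligible:
  assumes "trajectory A B x0 x u"
  obtains N where "negligible N"
    "\<And>t S. 0 \<le> t \<Longrightarrow> t \<notin> N \<Longrightarrow> (x has_vector_derivative (A t *v x t + B t *v u t)) (at t within S)"
proof -
  have "AE t in lebesgue. 0 \<le> t \<longrightarrow> (x has_vector_derivative (A t *v x t + B t *v u t)) (at t)"
    using assms by (simp add: trajectory_def)
  then obtain N where N: "N \<in> null_sets lebesgue"
      "{t \<in> space lebesgue. \<not> (0 \<le> t \<longrightarrow> (x has_vector_derivative (A t *v x t + B t *v u t)) (at t))} \<subseteq> N"
    unfolding eventually_ae_filter by blast
  show ?thesis
  proof (rule that[of N])
    show "negligible N" using N(1) by (simp add: negligible_iff_null_sets)
    fix t :: real and S assume "0 \<le> t" "t \<notin> N"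
    then have "(x has_vector_derivative (A t *v x t + B t *v u t)) (at t)" using N(2) by auto
    then show "(x has_vector_derivative (A t *v x t + B t *v u t)) (at t within S)"
      by (rule has_vector_derivative_at_within)
  qed
qed

lemma trajectory_abs_cont_on:
  assumes "trajectory A B x0 x u" "0 \<le> a"
  shows "abs_cont_on {a..b} x"
proof -
  have "abs_cont_on {0..max b 1} x"
    using assms(1) by (simp add: trajectory_def AC_def)
  then show ?thesis by (rule abs_cont_on_subset) (use assms(2) in auto)
qed

context lq
begin

text \<open>The difference \<open>z\<close> of the two curves satisfies \<open>z' = A z\<close>
  almost everywhere and starts at 0. Gronwall's inequality is obtained from the increment estimate
  for a scalar multiple of the identity.\<close>

lemma state_unique:
  assumes st: "0 \<le> s" "s < b" and traj: "trajectory A B x0 x u"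
    and u: "\<And>\<tau>. \<tau> \<in> {s..<b} \<Longrightarrow> u \<tau> = w" and t: "t \<in> {s..b}"
  shows "x t = state s (x s) w t"
proof -
  let ?y = "state s (x s) w"
  obtain N where N: "negligible N"
    "\<And>t S. 0 \<le> t \<Longrightarrow> t \<notin> N \<Longrightarrow> (x has_vector_derivative (A t *v x t + B t *v u t)) (at t within S)"
    by (rule trajectory_negligible[OF traj]) (rule that)
  define z where "z \<tau> = x \<tau> - ?y \<tau>" for \<tau>
  have "continuous_on {s..b} A" using A_continuous by (rule continuous_on_subset) simp
  then obtain M where M0: "0 \<le> M" and A_le: "\<And>\<tau>. \<tau> \<in> {s..b} \<Longrightarrow> norm (A \<tau>) \<le> M"
    by (rule continuous_on_compact_bound[OF compact_Icc]) (rule that)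
  have "continuous_on {s..b} (\<lambda>\<tau>. A \<tau> *v ?y \<tau> + B \<tau> *v w)"
    by (intro continuous_intros state_continuous_on)
  then obtain M' where M'0: "0 \<le> M'" and y'_le: "\<And>\<tau>. \<tau> \<in> {s..b} \<Longrightarrow> norm (A \<tau> *v ?y \<tau> + B \<tau> *v w) \<le> M'"
    by (rule continuous_on_compact_bound[OF compact_Icc]) (rule that)
  have AC: "abs_cont_on {s..b} z"
  proof (rule abs_cont_on_controlled[OF trajectory_abs_cont_on[OF traj st(1)] order_refl, of "1 + M'"])
    fix p q assume pq: "p \<in> {s..b}" "q \<in> {s..b}" "p \<le> q"
    have "norm (z q - z p) \<le> norm (x q - x p) + norm (?y q - ?y p)"
      using norm_triangle_ineq4[of "x q - x p" "?y q - ?y p"] by (simp add: z_def algebra_simps)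
    also have "\<dots> \<le> norm (x q - x p) + M' * (q - p)"
      using bounded_derivative_lipschitz[OF state_has_vector_derivative y'_le pq(1,2)] pq(3) by simp
    also have "\<dots> \<le> (1 + M') * (norm (x q - x p) + (q - p))"
      using mult_nonneg_nonneg[OF M'0 norm_ge_zero[of "x q - x p"]] pq(3) by (simp add: distrib_left distrib_right)
    finally show "norm (z q - z p) \<le> (1 + M') * (norm (x q - x p) + (q - p))" .
  qed (use M'0 in simp)
  \<comment> \<open>The control equals \<open>w\<close> only before \<open>b\<close>, so the end
    point joins the exceptional set.\<close>
  define N' where "N' = N \<union> {b}"
  have N': "negligible N'" unfolding N'_def using N(1) by (intro negligible_Un) simp_all
  have z: "(z has_vector_derivative A \<tau> *v z \<tau>) (at \<tau> within {s..t})" if \<tau>: "\<tau> \<in> {s..t} - N'" for \<tau>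
  proof -
    have "\<tau> \<in> {s..b}" "\<tau> \<in> {s..<b}" "\<tau> \<notin> N" "0 \<le> \<tau>" using \<tau> t st by (auto simp: N'_def)
    then have "(x has_vector_derivative (A \<tau> *v x \<tau> + B \<tau> *v w)) (at \<tau> within {s..t})"
      "(?y has_vector_derivative (A \<tau> *v ?y \<tau> + B \<tau> *v w)) (at \<tau> within {s..t})"
      using N(2)[of \<tau> "{s..t}"] u[of \<tau>] has_vector_derivative_within_subset[OF state_has_vector_derivative[of \<tau> s b]] t
      by auto
    from has_vector_derivative_diff[OF this] show ?thesis
      unfolding z_def[abs_def] by (simp add: algebra_simps)
  qed
  \<comment> \<open>The weight decays at twice the rate bound \<open>M\<close>, so that
    \<open>c |z|^2\<close> does not increase; it is used with a minus sign because increments are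
    bounded from below.\<close>
  define c where "c \<tau> = exp (- 2 * M * \<tau>)" for \<tau>
  have c: "((\<lambda>\<tau>. - c \<tau> *\<^sub>R (mat 1 :: real^'n^'n)) has_vector_derivative (2 * M * c \<tau>) *\<^sub>R mat 1) (at \<tau> within {s..t})" for \<tau>
  proof -
    have "((\<lambda>\<tau>. - c \<tau>) has_real_derivative 2 * M * c \<tau>) (at \<tau> within {s..t})"
      unfolding c_def[abs_def] by (rule derivative_eq_intros refl | simp)+
    from has_vector_derivative_scaleR[OF this has_vector_derivative_const] show ?thesis by simp
  qed
  have quad_scalar: "quad (k *\<^sub>R (mat 1 :: real^'n^'n)) y = k * (y \<bullet> y)" for k y
    by (simp add: quad_scaleR)
  have scalar: "(k *\<^sub>R (mat 1 :: real^'n^'n)) *v y = k *\<^sub>R y" for k y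
    by (simp flip: scaleR_matrix_vector_assoc)
  have "- 0 \<le> quad (- c t *\<^sub>R mat 1) (z t) - quad (- c s *\<^sub>R mat 1) (z s)"
  proof (rule quad_increment_ge[OF _ _ c _ _ N' z])
    show "s \<le> t" using t by simp
    show "abs_cont_on {s..t} z" using AC by (rule abs_cont_on_subset) (use t in simp)
    show "continuous_on {s..t} (\<lambda>\<tau>. (2 * M * c \<tau>) *\<^sub>R (mat 1 :: real^'n^'n))"
      unfolding c_def by (intro continuous_intros)
    show "transpose (- c \<tau> *\<^sub>R (mat 1 :: real^'n^'n)) = - c \<tau> *\<^sub>R mat 1" for \<tau>
      by (simp only: transpose_scalar transpose_mat)
    show "((\<lambda>_. 0 :: real) has_integral 0) {s..t}" by simp
    fix \<tau> assume "\<tau> \<in> {s..t} - N'"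
    then have \<tau>: "\<tau> \<in> {s..b}" using t by auto
    have "z \<tau> \<bullet> (A \<tau> *v z \<tau>) \<le> norm (A \<tau>) * (norm (z \<tau>))\<^sup>2"
      using quad_le_norm[of "A \<tau>" "z \<tau>"] by (simp add: inner_commute)
    also have "\<dots> \<le> M * (z \<tau> \<bullet> z \<tau>)"
      unfolding power2_norm_eq_inner by (intro mult_right_mono A_le \<tau>) simp
    finally have "c \<tau> * (z \<tau> \<bullet> (A \<tau> *v z \<tau>)) \<le> c \<tau> * (M * (z \<tau> \<bullet> z \<tau>))"
      by (rule mult_left_mono) (simp add: c_def)
    then show "- 0 \<le> quad ((2 * M * c \<tau>) *\<^sub>R mat 1) (z \<tau>) + 2 * (((- c \<tau> *\<^sub>R mat 1) *v z \<tau>) \<bullet> (A \<tau> *v z \<tau>))"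
      unfolding quad_scalar scalar by (simp add: algebra_simps)
  qed
  moreover have "z s = 0" by (simp add: z_def state_refl)
  ultimately have "c t * (z t \<bullet> z t) \<le> 0"
    unfolding quad_scalar by simp
  then have "z t \<bullet> z t \<le> 0" by (simp add: c_def mult_le_0_iff)
  then have "z t = 0" by (metis inner_gt_zero_iff not_le)
  then show ?thesis by (simp add: z_def)
qed

text \<open>By completing the square along the trajectory.\<close>

lemma riccati_solution_le_cost:
  assumes E: "riccati_solution P T E" and P: "P \<in> sym_psd" and T: "0 < T"
    and traj: "trajectory A B x0 x u"
    and int: "((\<lambda>t. quad (Q t) (x t) + quad (R t) (u t)) has_integral I) {0..T}"
  shows "quad (E 0) x0 \<le> I + quad P (x T)"
proof -
  obtain N where N: "negligible N"
    "\<And>t S. 0 \<le> t \<Longrightarrow> t \<notin> N \<Longrightarrow> (x has_vector_derivative (A t *v x t + B t *v u t)) (at t within S)"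
    by (rule trajectory_negligible[OF traj]) (rule that)
  have E_psd: "E t \<in> sym_psd" if "t \<in> {0..T}" for t
    using E that by (simp add: riccati_solution_def)
  have "- I \<le> quad (E T) (x T) - quad (E 0) (x 0)"
  proof (rule quad_increment_ge[OF less_imp_le[OF T] trajectory_abs_cont_on[OF traj order_refl] _ _ _ N(1) _ _ int])
    show "(E has_vector_derivative \<F> t (E t) 0) (at t within {0..T})" if "t \<in> {0..T}" for t
      using E that by (simp add: riccati_solution_def)
    show "continuous_on {0..T} (\<lambda>t. \<F> t (E t) 0)"
      by (intro ric_zero_continuous_on continuous_intros riccati_solution_continuous[OF E])
    show "transpose (E t) = E t" if "t \<in> {0..T}" for t
      using E_psd[OF that] by (rule sym_psd_transpose)
    show "(x has_vector_derivative (A t *v x t + B t *v u t)) (at t within {0..T})" if "t \<in> {0..T} - N" for t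
      using that by (intro N(2)) auto
    fix t assume "t \<in> {0..T} - N"
    then have psd: "E t \<in> sym_psd" using E_psd[of t] by simp
    define y where "y = transpose (B t) *v (E t *v x t)"
    \<comment> \<open>The optimal feedback is \<open>- w\<close>; the slack in the inequality to be
      shown is the square \<open><R (w + u), w + u>\<close>.\<close>
    define w where "w = matrix_inv (R t) *v y"
    have Rw: "R t *v w = y"
      unfolding w_def by (subst matrix_vector_mul_assoc) (simp add: sym_pd_inverse(1)[OF R_pd])
    have "quad (R t) (w + u t) = y \<bullet> w + 2 * (y \<bullet> u t) + quad (R t) (u t)"
      using sym_quad_plus[OF sym_pd_transpose[OF R_pd], of t w "u t"] by (simp only: Rw)
    moreover have "0 \<le> quad (R t) (w + u t)" by (intro sym_psd_nonneg sym_pd_imp_psd R_pd)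
    moreover have "y \<bullet> u t = (E t *v x t) \<bullet> (B t *v u t)" unfolding y_def by (rule inner_transpose)
    moreover have "quad (\<F> t (E t) 0) (x t) = y \<bullet> w - quad (Q t) (x t) - 2 * ((E t *v x t) \<bullet> (A t *v x t))"
      unfolding ric_zero_quad[OF psd] w_def y_def by (simp only: inner_commute)
    ultimately show "- (quad (Q t) (x t) + quad (R t) (u t))
        \<le> quad (\<F> t (E t) 0) (x t) + 2 * ((E t *v x t) \<bullet> (A t *v x t + B t *v u t))"
      by (simp add: inner_add_right)
  qed
  then show ?thesis
    using E traj by (simp add: riccati_solution_def trajectory_def)
qed

end

subsection \<open>Infinite horizon\<close>

lemma mesh_uniform:
  assumes "0 < N" "0 \<le> h"
  shows "mesh N (\<lambda>j. real j * h) \<le> h"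
  unfolding mesh_def using assms by (intro Max.boundedI) (auto simp: of_nat_diff algebra_simps)

context lq
begin

text \<open>A concrete sequence of partitions along which order relations pass from the scheme to
  the Riccati solution; \<open>Suc N\<close> guarantees at least one step.\<close>

lemma discrete_riccati_uniform_tendsto:
  assumes P: "P \<in> sym_psd" and T: "0 < T"
  shows "(\<lambda>N. E_disc P (Suc N) (\<lambda>j. real j * (T / real (Suc N))) 0)
    \<longlonglongrightarrow> E_fin P T 0"
  unfolding LIMSEQ_iff
proof (intro allI impI)
  fix e :: real assume e: "0 < e"
  obtain d where d: "0 < d" "\<forall>N \<theta>. time_partition T N \<theta> \<and> mesh N \<theta> \<le> d \<longrightarrow>
    (\<forall>i\<le>N. norm (E_fin P T (\<theta> i) - E_disc P N \<theta> i) \<le> e / 2)"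
    using discrete_riccati_converges[OF P T half_gt_zero[OF e]] by blast
  obtain M :: nat where M: "T / d < real M" using reals_Archimedean2 by blast
  show "\<exists>M. \<forall>N\<ge>M. norm (E_disc P (Suc N) (\<lambda>j. real j * (T / real (Suc N))) 0
      - E_fin P T 0) < e"
  proof (intro exI[of _ M] allI impI)
    fix N assume N: "M \<le> N"
    let ?h = "T / real (Suc N)"
    have "T / d < real (Suc N)" using M N by linarith
    then have "?h \<le> d" using d(1) by (simp add: field_simps)
    moreover have "mesh (Suc N) (\<lambda>j. real j * ?h) \<le> ?h"
      using T by (intro mesh_uniform) simp_all
    ultimately have "mesh (Suc N) (\<lambda>j. real j * ?h) \<le> d" by linarith
    with time_partition_uniform[OF T zero_less_Suc[of N]]
    have "norm (E_fin P T (real 0 * ?h) - E_disc P (Suc N) (\<lambda>j. real j * ?h) 0) \<le> e / 2"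
      by (intro d(2)[rule_format]) simp_all
    then show "norm (E_disc P (Suc N) (\<lambda>j. real j * ?h) 0 - E_fin P T 0) < e"
      using e by (simp add: norm_minus_commute)
  qed
qed

text \<open>Inherited from \<open>backward_mono\<close> in the limit of fine partitions.\<close>

lemma finite_riccati_mono:
  assumes P: "P \<in> sym_psd" and P': "P' \<in> sym_psd" and T: "0 < T"
    and le: "\<And>x. quad P x \<le> quad P' x"
  shows "quad (E_fin P T 0) x \<le> quad (E_fin P' T 0) x"
proof (rule LIMSEQ_le)
  show "(\<lambda>N. quad (E_disc P (Suc N) (\<lambda>j. real j * (T / real (Suc N))) 0) x)
    \<longlonglongrightarrow> quad (E_fin P T 0) x"
    by (intro tendsto_intros discrete_riccati_uniform_tendsto P T)
  show "(\<lambda>N. quad (E_disc P' (Suc N) (\<lambda>j. real j * (T / real (Suc N))) 0) x)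
    \<longlonglongrightarrow> quad (E_fin P' T 0) x"
    by (intro tendsto_intros discrete_riccati_uniform_tendsto P' T)
  show "\<exists>M. \<forall>N\<ge>M. quad (E_disc P (Suc N) (\<lambda>j. real j * (T / real (Suc N))) 0) x
      \<le> quad (E_disc P' (Suc N) (\<lambda>j. real j * (T / real (Suc N))) 0) x"
  proof (intro exI allI impI)
    fix N
    let ?\<theta> = "\<lambda>j. real j * (T / real (Suc N))"
    have \<theta>: "?\<theta> i < ?\<theta> (Suc i)" for i
      using T by (simp add: divide_strict_right_mono)
    have "backward (Suc N) ?\<theta> P (E_disc P (Suc N) ?\<theta>)" "backward (Suc N) ?\<theta> P' (E_disc P' (Suc N) ?\<theta>)"
      by (rule backward_discrete_riccati; intro P P' \<theta>)+
    then show "quad (E_disc P (Suc N) ?\<theta> 0) x \<le> quad (E_disc P' (Suc N) ?\<theta> 0) x"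
      by (rule backward_mono[OF _ P _ P' _ le]) (rule \<theta>, simp)
  qed
qed

lemma riccati_solution_restrict:
  assumes "riccati_solution P T E" "0 \<le> S" "S \<le> T"
  shows "riccati_solution (E S) S E"
  using assms unfolding riccati_solution_def
  by (auto intro: has_vector_derivative_within_subset[where S = "{0..T}"])

section \<open>Uniqueness of stationary matrices\<close>

lemma stationary_pd:
  assumes E: "E \<in> sym_psd" "\<F> t E 0 = 0" and Q: "Q t \<in> sym_pd"
  shows "E \<in> sym_pd"
proof -
  have "quad E x \<noteq> 0" if "x \<noteq> 0" for x
  proof
    assume "quad E x = 0"
    then have "E *v x = 0" by (rule sym_psd_kernel[OF E(1)])
    \<comment> \<open>On the kernel of \<open>E\<close> only the term with \<open>Q\<close> survives
      in the stationary equation.\<close>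
    then have "quad (Q t) x = 0" using ric_zero_quad[OF E(1), of t x] E(2) by simp
    then show False using sym_pd_pos[OF Q that] by simp
  qed
  then show ?thesis
    using E(1) unfolding sym_pd_def sym_psd_def by (simp add: order_less_le)
qed

text \<open>At a direction \<open>v\<close> where the ratio of \<open>E\<close> and \<open>E'\<close> is maximal, \<open>E v = l E' v\<close>; comparing the two
  equations there forces \<open>l \<le> 1\<close>.\<close>

lemma stationary_le:
  assumes E: "E \<in> sym_psd" "\<F> t E 0 = 0" and E': "E' \<in> sym_psd" "\<F> t E' 0 = 0" and Q: "Q t \<in> sym_pd"
  shows "quad E x \<le> quad E' x"
proof -
  have pd: "E' \<in> sym_pd" using E' Q by (rule stationary_pd)
  obtain l v where v: "v \<noteq> 0" "quad E v = l * quad E' v" "\<And>x. quad E x \<le> l * quad E' x"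
    by (rule quad_ratio_max[OF pd, of E]) (rule that)
  have "l \<le> 1"
  proof (rule ccontr)
    assume "\<not> l \<le> 1"
    then have l: "1 < l" by simp
    have "l *\<^sub>R E' - E \<in> sym_psd"
      using E(1) E'(1) v(3)
      by (intro sym_psdI) (simp_all add: transpose_diff transpose_scalar sym_psd_transpose quad_diff quad_scaleR)
    then have "(l *\<^sub>R E' - E) *v v = 0"
      by (rule sym_psd_kernel) (simp add: quad_diff quad_scaleR v(2))
    then have Ev: "E *v v = l *\<^sub>R (E' *v v)"
      by (simp add: matrix_vector_mult_diff_rdistrib scaleR_matrix_vector_assoc)
    define \<kappa> where "\<kappa> = quad (matrix_inv (R t)) (transpose (B t) *v (E' *v v))"
    define \<alpha> where "\<alpha> = (E' *v v) \<bullet> (A t *v v)"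
    have "quad (matrix_inv (R t)) (transpose (B t) *v (E *v v)) = l * l * \<kappa>"
      by (simp add: Ev \<kappa>_def matrix_vector_mult_scaleR)
    then have 1: "l * l * \<kappa> - quad (Q t) v - 2 * (l * \<alpha>) = 0"
      using ric_zero_quad[OF E(1), of t v] by (simp add: E(2) Ev \<alpha>_def)
    have 2: "\<kappa> - quad (Q t) v - 2 * \<alpha> = 0"
      using ric_zero_quad[OF E'(1), of t v] by (simp add: E'(2) \<kappa>_def \<alpha>_def)
    \<comment> \<open>The first equation minus \<open>l\<close> times the second: the drift term
      \<open>\<alpha>\<close> cancels and what remains has a definite sign.\<close>
    have "l * ((l - 1) * \<kappa>) + (l - 1) * quad (Q t) v
        = (l * l * \<kappa> - quad (Q t) v - 2 * (l * \<alpha>)) - l * (\<kappa> - quad (Q t) v - 2 * \<alpha>)"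
      by (simp add: algebra_simps)
    also have "\<dots> = 0" unfolding 1 2 by simp
    finally have "l * ((l - 1) * \<kappa>) + (l - 1) * quad (Q t) v = 0" .
    moreover have "0 \<le> l * ((l - 1) * \<kappa>)"
      using l sym_pd_inverse_quad_nonneg[OF R_pd] by (simp add: \<kappa>_def)
    moreover have "0 < (l - 1) * quad (Q t) v"
      using l sym_pd_pos[OF Q v(1)] by simp
    ultimately show False by linarith
  qed
  then have "l * quad E' x \<le> 1 * quad E' x"
    by (intro mult_right_mono sym_psd_nonneg E'(1))
  with v(3)[of x] show ?thesis by simp
qed

text \<open>The integrand is continuous, nonnegative and positive at the left end, where the state
  is still \<open>x\<close>.\<close>

lemma stage_cost_pos:
  assumes Q: "Q s \<in> sym_pd" and st: "s < t" and x: "x \<noteq> 0"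
  shows "0 < stage_cost s t x u"
proof -
  let ?f = "\<lambda>\<tau>. quad (Q \<tau>) (state s x u \<tau>) + quad (R \<tau>) u"
  have nonneg: "0 \<le> ?f \<tau>" for \<tau>
    by (intro add_nonneg_nonneg sym_psd_nonneg Q_psd sym_pd_imp_psd R_pd)
  have "stage_cost s t x u \<noteq> 0"
  proof
    assume "stage_cost s t x u = 0"
    moreover have "continuous_on {s..t} ?f"
      by (intro continuous_intros state_continuous_on)
    ultimately have "\<forall>\<tau>\<in>{s..t}. ?f \<tau> = 0"
      using integral_eq_0_iff[of s t ?f] st nonneg by (simp add: stage_cost_def)
    then have "?f s = 0" using st by simp
    then show False
      using sym_pd_pos[OF Q x] sym_psd_nonneg[OF sym_pd_imp_psd[OF R_pd], of s u] by (simp add: state_refl)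
  qed
  then show ?thesis using stage_cost_nonneg[of s t x u] by simp
qed

text \<open>The discrete counterpart of \<open>stationary_le\<close>. Here no kernel argument is
  made: at the maximising \<open>v\<close>, the control optimal for \<open>E'\<close> is admissible
  for \<open>E\<close>, and for \<open>l > 1\<close> its positive stage cost makes the resulting
  chain strict.\<close>

lemma fixed_step_le:
  assumes E: "E \<in> sym_psd" "\<F> t E h = 0" and E': "E' \<in> sym_psd" "\<F> t E' h = 0"
    and Q: "Q (t - h) \<in> sym_pd" and h: "0 < h"
  shows "quad E x \<le> quad E' x"
proof -
  have fixed: "back t h E = E" "back t h E' = E'" using E E' by (simp_all add: back_def)
  have "0 < quad E' y" if "y \<noteq> 0" for y
  proof -
    obtain u where "quad (back t h E') y = stage_cost (t - h) t y u + quad E' (state (t - h) y u t)"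
      using back_attained[OF h E'(1)] by blast
    then show ?thesis
      using stage_cost_pos[OF Q _ that, of t u] sym_psd_nonneg[OF E'(1), of "state (t - h) y u t"] h
      by (simp add: fixed)
  qed
  then have pd: "E' \<in> sym_pd" using E'(1) by (simp add: sym_pd_def sym_psd_transpose)
  obtain l v where v: "v \<noteq> 0" "quad E v = l * quad E' v" "\<And>x. quad E x \<le> l * quad E' x"
    by (rule quad_ratio_max[OF pd, of E]) (rule that)
  have "l \<le> 1"
  proof (rule ccontr)
    assume "\<not> l \<le> 1"
    then have l: "1 < l" by simp
    obtain u where u: "quad (back t h E') v = stage_cost (t - h) t v u + quad E' (state (t - h) v u t)"
      using back_attained[OF h E'(1)] by blast
    let ?y = "state (t - h) v u t" and ?J = "stage_cost (t - h) t v u"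
    have J: "0 < ?J" using stage_cost_pos[OF Q _ v(1)] h by simp
    have "quad E v \<le> ?J + quad E ?y"
      using back_le[OF h E(1), of t v u] by (simp add: fixed)
    also have "\<dots> \<le> ?J + l * quad E' ?y" using v(3)[of ?y] by simp
    also have "\<dots> < l * (?J + quad E' ?y)"
      using mult_strict_right_mono[OF l J] by (simp add: distrib_left)
    also have "\<dots> = quad E v" using u v(2) by (simp add: fixed)
    finally show False by simp
  qed
  then have "l * quad E' x \<le> 1 * quad E' x"
    by (intro mult_right_mono sym_psd_nonneg E'(1))
  with v(3)[of x] show ?thesis by simp
qed

end

section \<open>Autonomous data and translation in time\<close>

locale lq_autonomous = lq A B Q R
  for A :: "real \<Rightarrow> real^'n^'n" and B :: "real \<Rightarrow> real^'m^'n"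
    and Q :: "real \<Rightarrow> real^'n^'n" and R :: "real \<Rightarrow> real^'m^'m" +
  assumes autonomous: "autonomous A B Q R"
begin

lemma const: "A t = A 0" "B t = B 0" "Q t = Q 0" "R t = R 0"
  using autonomous unfolding autonomous_def by blast+

text \<open>For constant \<open>A\<close> the shifted flow solves the same equation, so both
  coincide with the one transition matrix.\<close>

lemma Phi_shift: "\<Phi> (t + c) (s + c) = \<Phi> t s"
proof -
  obtain X Z :: "real \<Rightarrow> real^'n^'n" where "\<And>t. (X has_vector_derivative A t ** X t) (at t)"
    and Z: "\<And>t. (Z has_vector_derivative - (Z t ** A t)) (at t)"
    and XZ: "\<And>t. X t ** Z t = mat 1" and "\<And>t. Z t ** X t = mat 1"
    by (rule fundamental_matrix_exists[OF A_continuous]) (rule that)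
  have deriv: "((\<lambda>\<tau>. \<Phi> (\<tau> + c) (s + c)) has_vector_derivative A t ** \<Phi> (t + c) (s + c)) (at t)" for t s
  proof -
    have "((\<lambda>\<tau>. \<tau> + c) has_vector_derivative 1) (at t)"
      by (auto intro!: derivative_eq_intros simp: has_real_derivative_iff_has_vector_derivative[symmetric])
    from vector_diff_chain_at[OF this Phi_has_vector_derivative[of "s + c" "t + c" UNIV]]
    show ?thesis by (simp add: o_def const[of "t + c"] const[of t])
  qed
  have "\<Phi> t s = X t ** Z s"
    by (rule transition_matrix_unique[OF Z XZ Phi_refl Phi_has_vector_derivative])
  moreover have "\<Phi> (t + c) (s + c) = X t ** Z s"
    by (rule transition_matrix_unique[OF Z XZ _ deriv]) (rule Phi_refl)
  ultimately show ?thesis by simp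
qed

lemma Gamma_shift: "\<Gamma> (s + c) (t + c) = \<Gamma> s t"
proof -
  have "B (\<xi> + c) = B \<xi>" for \<xi> using const(2)[of "\<xi> + c"] const(2)[of \<xi>] by simp
  then show ?thesis
    using integral_shift_real_ivl[of "s + c" c "t + c" "\<lambda>\<xi>. \<Phi> (t + c) \<xi> ** B \<xi>"]
    by (simp add: input_map_def Phi_shift)
qed

lemma ric_time_invariant: "\<F> t E h = \<F> 0 E h"
proof -
  have Phi: "\<Phi> (\<tau> + t) (t - h) = \<Phi> \<tau> (- h)" "\<Phi> t (t - h) = \<Phi> 0 (- h)" for \<tau>
    using Phi_shift[of \<tau> t "- h"] Phi_shift[of 0 t "- h"] by simp_all
  have Gamma: "\<Gamma> (t - h) (\<tau> + t) = \<Gamma> (- h) \<tau>" "\<Gamma> (t - h) t = \<Gamma> (- h) 0" for \<tau>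
    using Gamma_shift[of "- h" t \<tau>] Gamma_shift[of "- h" t 0] by simp_all
  have int: "integral {t - h..t} f = integral {- h..0} (\<lambda>\<tau>. f (\<tau> + t))" for f :: "real \<Rightarrow> 'c::real_normed_vector"
    using integral_shift_real_ivl[of "t - h" t t f] by simp
  have c: "A (\<tau> + t) = A \<tau>" "B (\<tau> + t) = B \<tau>" "Q (\<tau> + t) = Q \<tau>" "R (\<tau> + t) = R \<tau>"
    "A t = A 0" "B t = B 0" "Q t = Q 0" "R t = R 0" for \<tau>
    using const[of "\<tau> + t"] const[of \<tau>] const[of t] by simp_all
  have "ricM1 A B t E h = ricM1 A B 0 E h"
    by (simp add: ricM1_def Phi Gamma c)
  moreover have "ricM2 A B Q t E h = ricM2 A B Q 0 E h"
    by (simp add: ricM2_def int Phi Gamma c)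
  moreover have "ricN1 R t E h = ricN1 R 0 E h"
    by (simp add: ricN1_def int c)
  moreover have "ricN2 A B Q t E h = ricN2 A B Q 0 E h"
    by (simp add: ricN2_def transpose_Gamma int Gamma c)
  moreover have "ricN3 A B t E h = ricN3 A B 0 E h"
    by (simp add: ricN3_def transpose_Gamma Gamma)
  moreover have "ricG1 A Q t E h = ricG1 A Q 0 E h"
    by (simp add: ricG1_def int Phi c)
  moreover have "ricG2 A t E h = ricG2 A 0 E h"
    by (simp add: ricG2_def Phi c)
  ultimately show ?thesis by (simp add: ric_def)
qed

lemma back_time_invariant: "back t h E = back 0 h E"
  by (simp add: back_def ric_time_invariant[of t])

text \<open>The discrete Riccati matrix with zero final cost and \<open>k\<close> steps to go. It
  replaces a family indexed by horizon and node by one sequence.\<close>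

definition "steps h k = (back 0 h ^^ k) 0"

lemma steps_0 [simp]: "steps h 0 = 0" and steps_Suc: "steps h (Suc k) = back 0 h (steps h k)"
  by (simp_all add: steps_def)

lemma steps_psd: "0 < h \<Longrightarrow> steps h k \<in> sym_psd"
  by (induction k) (simp_all add: steps_Suc back_psd)

text \<open>The zero matrix is below every positive semi-definite one, and \<open>back_mono\<close>
  propagates the comparison of the first two terms.\<close>

lemma steps_mono: "0 < h \<Longrightarrow> quad (steps h k) x \<le> quad (steps h (Suc k)) x"
proof (induction k arbitrary: x)
  case 0
  then show ?case using sym_psd_nonneg[OF steps_psd, of h "Suc 0"] by simp
next
  case (Suc k)
  then show ?case
    unfolding steps_Suc[of h "Suc k"] by (subst steps_Suc) (intro back_mono steps_psd)
qed

lemma discrete_riccati_steps: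
  assumes h: "0 < h" and i: "i \<le> N"
  shows "E_disc 0 N (\<lambda>j. real j * h) i = steps h (N - i)"
proof -
  let ?E = "E_disc 0 N (\<lambda>j. real j * h)"
  have E: "backward N (\<lambda>j. real j * h) 0 ?E"
    using h by (intro backward_discrete_riccati) simp_all
  show ?thesis using i
  proof (induction i rule: inc_induct)
    case base
    then show ?case using E by (simp add: backward_def)
  next
    case (step i)
    have "?E i = back (real (Suc i) * h) (real (Suc i) * h - real i * h) (?E (Suc i))"
      using E step(2) unfolding backward_def by blast
    also have "\<dots> = back 0 h (steps h (N - Suc i))"
      unfolding step.IH by (subst back_time_invariant) (simp add: algebra_simps)
    also have "\<dots> = steps h (N - i)"
      using step(2) by (simp add: steps_Suc[symmetric] Suc_diff_Suc)
    finally show ?case .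
  qed
qed

text \<open>Dynamic programming along the given trajectory: its control on each step competes in the
  minimum behind \<open>back\<close>. After \<open>k\<close> steps the final cost is 0 and only the
  cost incurred remains, which the cost on the half-line bounds for all \<open>k\<close>.\<close>

lemma steps_le_cost:
  assumes h: "0 < h" and traj: "trajectory A B x0 x u" and u: "u \<in> PC h"
    and cost: "cost Q R x u \<le> ennreal c" and c: "0 \<le> c"
  shows "quad (steps h k) x0 \<le> c"
proof -
  define l where "l t = quad (Q t) (x t) + quad (R t) (u t)" for t
  obtain v where v: "\<And>i t. t \<in> {real i * h..<real (Suc i) * h} \<Longrightarrow> u t = v i"
    using u unfolding PC_def by blast
  have claim: "\<exists>I. (l has_integral I) {0..real i * h} \<and> quad (steps h k) x0 \<le> I + quad (steps h (k - i)) (x (real i * h))"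
    if "i \<le> k" for i
    using that
  proof (induction i)
    case 0
    have "(l has_integral 0) {0..real 0 * h}" using has_integral_refl(2)[of l 0] by simp
    then show ?case using traj by (intro exI[of _ 0]) (simp add: trajectory_def)
  next
    case (Suc i)
    let ?s = "real i * h" and ?t = "real (Suc i) * h"
    let ?y = "state ?s (x ?s) (v i)"
    obtain I where I: "(l has_integral I) {0..?s}" "quad (steps h k) x0 \<le> I + quad (steps h (k - i)) (x ?s)"
      using Suc by auto
    have s: "0 \<le> ?s" "?s < ?t" "?t - h = ?s" using h by (simp_all add: algebra_simps)
    have x: "x \<tau> = ?y \<tau>" if "\<tau> \<in> {?s..?t}" for \<tau>
      using s(1,2) traj v that by (rule state_unique)
    have "((\<lambda>\<tau>. quad (Q \<tau>) (?y \<tau>) + quad (R \<tau>) (v i)) has_integral stage_cost ?s ?t (x ?s) (v i)) {?s..?t}"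
      unfolding stage_cost_def by (rule integrable_integral[OF stage_cost_integrable])
    then have "(l has_integral stage_cost ?s ?t (x ?s) (v i)) {?s..?t}"
    \<comment> \<open>At \<open>?t\<close> the control already has its next value, so this point is
      excluded.\<close>
    proof (rule has_integral_spike_finite[of "{?t}", rotated 2])
      fix \<tau> assume \<tau>: "\<tau> \<in> {?s..?t} - {?t}"
      then have "u \<tau> = v i" by (intro v) simp
      with x[of \<tau>] \<tau> show "l \<tau> = quad (Q \<tau>) (?y \<tau>) + quad (R \<tau>) (v i)" by (simp add: l_def)
    qed simp
    with s I(1) have int: "(l has_integral (I + stage_cost ?s ?t (x ?s) (v i))) {0..?t}"
      by (intro has_integral_combine[of 0 ?s ?t]) simp_all
    have "k - i = Suc (k - Suc i)" using Suc.prems by simp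
    then have "quad (steps h (k - i)) (x ?s) = quad (back ?t h (steps h (k - Suc i))) (x ?s)"
      by (simp only: steps_Suc back_time_invariant[of ?t])
    also have "\<dots> \<le> stage_cost ?s ?t (x ?s) (v i) + quad (steps h (k - Suc i)) (x ?t)"
      using back_le[OF h steps_psd[OF h], of ?t "k - Suc i" "x ?s" "v i"] x[of ?t] s by (simp only: s(3)) simp
    finally show ?case using int I(2) by (intro exI conjI) (assumption, linarith)
  qed
  obtain I where I: "(l has_integral I) {0..real k * h}"
      "quad (steps h k) x0 \<le> I + quad (steps h (k - k)) (x (real k * h))"
    using claim[OF order_refl] by (elim exE conjE)
  have l: "0 \<le> l t" for t
    unfolding l_def by (intro add_nonneg_nonneg sym_psd_nonneg Q_psd sym_pd_imp_psd R_pd)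
  \<comment> \<open>The gauge integral of a nonnegative function is turned into a nonnegative
    Lebesgue integral, which can be enlarged to the half-line and compared with
    \<open>cost\<close>.\<close>
  have "ennreal I = (\<integral>\<^sup>+t. ennreal (l t) * indicator {0..real k * h} t \<partial>lborel)"
    using nn_integral_has_integral_lebesgue'[OF l I(1)] by simp
  also have "\<dots> \<le> (\<integral>\<^sup>+t. ennreal (l t) * indicator {0..} t \<partial>lborel)"
    by (intro nn_integral_mono) (auto simp: indicator_def)
  also have "\<dots> = cost Q R x u"
    by (simp add: cost_def l_def nn_integral_completion)
  finally have "ennreal I \<le> ennreal c" using cost by (rule order_trans)
  then have "I \<le> c" using c by (simp add: ennreal_le_iff)
  with I(2) show ?thesis by simp
qed

text \<open>The limit of the increasing iterates is a fixed point because \<open>\<F>\<close> is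
  continuous in \<open>E\<close>, and two-sided comparison makes it the only one. The pointwise
  bound \<open>b\<close> is kept for the limit, where the passage to small steps will need
  it.\<close>

lemma infinite_riccati_step:
  assumes h: "0 < h" and Q: "Q 0 \<in> sym_pd" and b: "\<And>k x. quad (steps h k) x \<le> b x"
  shows "E_inf h \<in> sym_psd" "\<F> 0 (E_inf h) h = 0"
    "steps h \<longlonglongrightarrow> E_inf h" "quad (E_inf h) x \<le> b x"
proof -
  obtain E where E: "E \<in> sym_psd" "steps h \<longlonglongrightarrow> E" "\<And>k x. quad (steps h k) x \<le> quad E x"
      "\<And>x. quad E x \<le> b x"
    using steps_psd[OF h] steps_mono[OF h] b by (rule sym_psd_incseq_converges[of "steps h" b]) (rule that)
  have "(\<lambda>k. steps h k - h *\<^sub>R \<F> 0 (steps h k) h) \<longlonglongrightarrow> E - h *\<^sub>R \<F> 0 E h"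
    using steps_psd[OF h] by (intro tendsto_intros ric_tendsto_fixed_step E h always_eventually allI)
  moreover have "(\<lambda>k. steps h k - h *\<^sub>R \<F> 0 (steps h k) h) \<longlonglongrightarrow> E"
    using LIMSEQ_Suc[OF E(2)] by (simp add: steps_Suc back_def)
  ultimately have "E - h *\<^sub>R \<F> 0 E h = E" by (rule LIMSEQ_unique)
  then have E0: "\<F> 0 E h = 0" using h by simp
  have "E_inf h = E"
    unfolding infinite_riccati_def
  proof (rule the_equality)
    show "E \<in> sym_psd \<and> \<F> 0 E h = 0" using E(1) E0 by simp
    fix E' assume E': "E' \<in> sym_psd \<and> \<F> 0 E' h = 0"
    have Qh: "Q (0 - h) \<in> sym_pd" using Q const(3)[of "0 - h"] by simp
    show "E' = E"
    proof (rule sym_quad_eqI)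
      show "quad E' x = quad E x" for x
        using fixed_step_le[OF _ _ E(1) E0 Qh h, of E' x] fixed_step_le[OF E(1) E0 _ _ Qh h, of E' x] E'
        by (intro antisym) simp_all
    qed (use E(1) E' in \<open>simp_all add: sym_psd_transpose\<close>)
  qed
  with E E0 show "E_inf h \<in> sym_psd" "\<F> 0 (E_inf h) h = 0"
    "steps h \<longlonglongrightarrow> E_inf h" "quad (E_inf h) x \<le> b x"
    by simp_all
qed

lemma infinite_riccati_zero_eq:
  assumes E: "E \<in> sym_psd" "\<F> 0 E 0 = 0" and Q: "Q 0 \<in> sym_pd"
  shows "E_inf 0 = E"
  unfolding infinite_riccati_def
proof (rule the_equality)
  show "E \<in> sym_psd \<and> \<F> 0 E 0 = 0" using E by simp
  fix E' assume E': "E' \<in> sym_psd \<and> \<F> 0 E' 0 = 0"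
  show "E' = E"
  proof (rule sym_quad_eqI)
    show "quad E' x = quad E x" for x
      using stationary_le[OF _ _ E Q, of E' x] stationary_le[OF E _ _ Q, of E' x] E'
      by (intro antisym) simp_all
  qed (use E(1) E' in \<open>simp_all add: sym_psd_transpose\<close>)
qed

text \<open>The cost is an extended nonnegative integral, the comparison with Riccati solutions uses
  gauge integrals on \<open>[0, T]\<close>. The passage rests on measurability of the integrand:
  \<open>x\<close> is continuous, \<open>u\<close> is measurable by membership in \<open>L2\<close>,
  and \<open>Q\<close>, \<open>R\<close> are constant.\<close>

lemma cost_has_integral:
  assumes traj: "trajectory A B x0 x u" and u: "u \<in> L2" and fin: "cost Q R x u < \<infinity>"
  obtains c where "\<And>T. \<exists>I\<le>c. ((\<lambda>t. quad (Q t) (x t) + quad (R t) (u t)) has_integral I) {0..T}"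
proof -
  define l where "l t = quad (Q t) (x t) + quad (R t) (u t)" for t
  define f where "f t = (if t \<in> {0..} then l t else 0)" for t :: real
  have l: "0 \<le> l t" for t
    unfolding l_def by (intro add_nonneg_nonneg sym_psd_nonneg Q_psd sym_pd_imp_psd R_pd)
  then have f: "0 \<le> f t" for t by (simp add: f_def)
  have "continuous_on {0..} x"
    unfolding continuous_on_eq_continuous_within
  proof
    fix t :: real assume t: "t \<in> {0..}"
    have "continuous_on {0..t+1} x"
      using trajectory_abs_cont_on[OF traj order_refl] by (rule abs_cont_on_imp_continuous_on)
    then have "continuous (at t within {0..t+1}) x"
      using t by (auto simp: continuous_on_eq_continuous_within)
    moreover have "at t within {0..t+1} = at t within {0..}"
      by (rule at_within_nhd[of _ "{..<t+1}"]) auto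
    ultimately show "continuous (at t within {0..}) x" by simp
  qed
  then have "(\<lambda>t. indicator {0..} t *\<^sub>R x t) \<in> borel_measurable borel"
    by (intro borel_measurable_continuous_on_indicator) simp_all
  then have x_meas: "(\<lambda>t. indicator {0..} t *\<^sub>R x t) \<in> borel_measurable lebesgue"
    by (intro measurable_completion) simp
  have u_meas: "(\<lambda>t. indicator {0..} t *\<^sub>R u t) \<in> borel_measurable lebesgue"
    using u by (simp add: L2_def set_borel_measurable_def)
  have q_meas: "(\<lambda>y. quad M y) \<in> borel_measurable borel" for M :: "real^'k^'k"
    by (intro borel_measurable_continuous_onI continuous_intros)
  \<comment> \<open>The cut-off can be placed inside the forms because they vanish at 0; this gives
    compositions of measurable functions with fixed continuous ones.\<close>
  have "(\<lambda>t. quad (Q 0) (indicator {0..} t *\<^sub>R x t) + quad (R 0) (indicator {0..} t *\<^sub>R u t)) \<in> borel_measurable lebesgue"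
    by (intro borel_measurable_add measurable_compose[OF x_meas q_meas] measurable_compose[OF u_meas q_meas])
  also have "(\<lambda>t. quad (Q 0) (indicator {0..} t *\<^sub>R x t) + quad (R 0) (indicator {0..} t *\<^sub>R u t)) = f"
  proof
    fix t show "quad (Q 0) (indicator {0..} t *\<^sub>R x t) + quad (R 0) (indicator {0..} t *\<^sub>R u t) = f t"
      using const(3)[of t] const(4)[of t] by (simp add: f_def l_def indicator_def)
  qed
  finally have f_meas: "f \<in> borel_measurable lebesgue" .
  define c where "c = enn2real (cost Q R x u)"
  have "(\<integral>\<^sup>+t. ennreal (f t) \<partial>lebesgue) = cost Q R x u"
    unfolding cost_def by (intro nn_integral_cong) (simp add: f_def l_def indicator_def)
  then have "(\<integral>\<^sup>+t. ennreal (f t) \<partial>lebesgue) = ennreal c"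
    using fin by (simp add: c_def)
  then have int: "(f has_integral c) UNIV"
    unfolding has_integral_iff_nn_integral_lebesgue[OF f] using f_meas by (simp add: c_def)
  show ?thesis
  proof (rule that[of c])
    fix T
    have fT: "f integrable_on {0..T}"
      using integrable_on_subcbox[OF has_integral_integrable[OF int], of 0 T] by simp
    have "integral {0..T} f \<le> integral UNIV f"
      using f fT has_integral_integrable[OF int] by (intro integral_subset_le) auto
    also have "\<dots> = c" using int by (rule integral_unique)
    finally have "integral {0..T} f \<le> c" .
    moreover have "((\<lambda>t. quad (Q t) (x t) + quad (R t) (u t)) has_integral integral {0..T} f) {0..T}"
      by (rule has_integral_eq[OF _ integrable_integral[OF fT]]) (simp add: f_def l_def)
    ultimately show "\<exists>I\<le>c. ((\<lambda>t. quad (Q t) (x t) + quad (R t) (u t)) has_integral I) {0..T}" by blast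
  qed
qed

section \<open>Long horizons in continuous time\<close>

lemma riccati_solution_shift:
  assumes "riccati_solution P T E" "0 \<le> c" "c \<le> T"
  shows "riccati_solution P (T - c) (\<lambda>t. E (t + c))"
proof -
  have "((\<lambda>t. E (t + c)) has_vector_derivative \<F> t (E (t + c)) 0) (at t within {0..T - c})"
    if t: "t \<in> {0..T - c}" for t
  proof -
    have "((E \<circ> (\<lambda>t. t + c)) has_vector_derivative 1 *\<^sub>R \<F> (t + c) (E (t + c)) 0) (at t within {0..T - c})"
    proof (rule vector_diff_chain_within)
      show "((\<lambda>t. t + c) has_vector_derivative 1) (at t within {0..T - c})"
        by (auto intro!: derivative_eq_intros simp: has_real_derivative_iff_has_vector_derivative[symmetric])
      have "(E has_vector_derivative \<F> (t + c) (E (t + c)) 0) (at (t + c) within {0..T})"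
        using assms t by (simp add: riccati_solution_def)
      then show "(E has_vector_derivative \<F> (t + c) (E (t + c)) 0) (at (t + c) within (\<lambda>t. t + c) ` {0..T - c})"
        by (rule has_vector_derivative_within_subset) (use assms in auto)
    qed
    then show ?thesis
      by (simp add: o_def ric_time_invariant[of "t + c"] ric_time_invariant[of t])
  qed
  then show ?thesis using assms by (simp add: riccati_solution_def)
qed

text \<open>The value matrix as a function of the time to go. By time invariance it yields
  \<open>E_fin 0 T t\<close> for all \<open>t < T\<close>, so the limits in (ii) for different
  \<open>t\<close> reduce to one.\<close>

definition "V T = E_fin 0 T 0"

lemma finite_riccati_V:
  assumes "0 \<le> t" "t < T"
  shows "E_fin 0 T t = V (T - t)"
proof -
  have "riccati_solution 0 (T - t) (\<lambda>s. E_fin 0 T (s + t))"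
    using assms by (intro riccati_solution_shift riccati_solution_finite_riccati) simp_all
  from finite_riccati_eq[OF this, of 0] show ?thesis using assms by (simp add: V_def)
qed

lemma V_psd: "0 < T \<Longrightarrow> V T \<in> sym_psd"
  using riccati_solution_finite_riccati[OF zero_sym_psd, of T] by (simp add: V_def riccati_solution_def)

text \<open>The solution with horizon \<open>T\<close>, restricted to \<open>[0, S]\<close>, has a
  final value at \<open>S\<close> that is at least 0; comparison of final matrices does the
  rest.\<close>

lemma V_mono:
  assumes "0 < S" "S \<le> T"
  shows "quad (V S) x \<le> quad (V T) x"
proof -
  let ?E = "E_fin 0 T"
  have E: "riccati_solution 0 T ?E" using assms by (intro riccati_solution_finite_riccati) simp_all
  have psd: "?E S \<in> sym_psd" using E assms by (simp add: riccati_solution_def)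
  have "quad (V S) x \<le> quad (E_fin (?E S) S 0) x"
    unfolding V_def using assms sym_psd_nonneg[OF psd] by (intro finite_riccati_mono psd) simp_all
  also have "E_fin (?E S) S 0 = V T"
    unfolding V_def using assms psd E
    by (intro finite_riccati_eq riccati_solution_restrict[of 0 T]) simp_all
  finally show ?thesis .
qed

lemma V_bounded:
  assumes opt: "optimizable A B Q R"
  obtains c where "\<And>T. 0 < T \<Longrightarrow> quad (V T) x0 \<le> c"
proof -
  obtain x u where u: "u \<in> L2" and traj: "trajectory A B x0 x u" and fin: "cost Q R x u < \<infinity>"
    using opt unfolding optimizable_def by blast
  obtain c where c: "\<And>T. \<exists>I\<le>c. ((\<lambda>t. quad (Q t) (x t) + quad (R t) (u t)) has_integral I) {0..T}"
    by (rule cost_has_integral[OF traj u fin]) (rule that)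
  show ?thesis
  proof (rule that[of c])
    fix T :: real assume T: "0 < T"
    obtain I where I: "I \<le> c" "((\<lambda>t. quad (Q t) (x t) + quad (R t) (u t)) has_integral I) {0..T}"
      using c by blast
    have "quad (V T) x0 \<le> I + quad 0 (x T)"
      unfolding V_def
      by (rule riccati_solution_le_cost[OF riccati_solution_finite_riccati[OF zero_sym_psd T] zero_sym_psd T traj I(2)])
    with I(1) show "quad (V T) x0 \<le> c" by simp
  qed
qed

text \<open>Convergence along the integers extends to all horizons by monotonicity. For
  stationarity, \<open>V T - V (T + 1)\<close> tends to 0, but it is also the integral over unit
  time of a right-hand side that tends to \<open>\<F> 0 E 0\<close>.\<close>

lemma V_tendsto_stationary:
  assumes opt: "optimizable A B Q R"
  obtains E where "E \<in> sym_psd" "\<F> 0 E 0 = 0" "(V \<longlongrightarrow> E) at_top"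
proof -
  have "\<exists>c. \<forall>T>0. quad (V T) x \<le> c" for x
    using V_bounded[OF opt, of x] by metis
  then obtain b where b: "\<And>T x. 0 < T \<Longrightarrow> quad (V T) x \<le> b x" by metis
  obtain E where E: "E \<in> sym_psd" "(\<lambda>k. V (real (Suc k))) \<longlonglongrightarrow> E"
      "\<And>k x. quad (V (real (Suc k))) x \<le> quad E x" "\<And>x. quad E x \<le> b x"
  proof (rule sym_psd_incseq_converges[of "\<lambda>k. V (real (Suc k))" b])
    show "V (real (Suc k)) \<in> sym_psd" for k by (rule V_psd) simp
    show "quad (V (real (Suc k))) x \<le> quad (V (real (Suc (Suc k)))) x" for k x by (rule V_mono) simp_all
    show "quad (V (real (Suc k))) x \<le> b x" for k x by (rule b) simp
  qed (rule that)
  have V_le: "quad (V T) x \<le> quad E x" if "0 < T" for T x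
  proof -
    obtain k where "T < real k" using reals_Archimedean2 by blast
    then have "quad (V T) x \<le> quad (V (real (Suc k))) x" using that by (intro V_mono) simp_all
    with E(3)[of k x] show ?thesis by simp
  qed
  have lim: "(V \<longlongrightarrow> E) at_top"
  proof (rule tendstoI)
    fix e :: real assume e: "0 < e"
    \<comment> \<open>The dimension factor of \<open>sym_psd_norm_le\<close>. Since
      \<open>E - V T\<close> lies between 0 and \<open>E - V (k + 1)\<close>, closeness at one
      integer gives closeness at all later times.\<close>
    define n2 where "n2 = real CARD('n) * real CARD('n)"
    have n2: "0 < n2" by (simp add: n2_def)
    obtain k where k: "norm (V (real (Suc k)) - E) < e / n2"
      using LIMSEQ_D[OF E(2), of "e / n2"] e n2 by auto
    have "dist (V T) E < e" if T: "real (Suc k) \<le> T" for T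
    proof -
      have T0: "0 < T" using T by simp
      have "norm (E - V T) \<le> n2 * norm (E - V (real (Suc k)))"
        unfolding n2_def
      proof (rule sym_psd_norm_le)
        show "E - V T \<in> sym_psd"
          using E(1) V_psd[OF T0] V_le[OF T0]
          by (intro sym_psdI) (simp_all add: transpose_diff sym_psd_transpose quad_diff)
        have "quad (V (real (Suc k))) x \<le> quad (V T) x" for x
          using T by (intro V_mono) simp_all
        then show "quad (E - V T) x \<le> norm (E - V (real (Suc k))) * (norm x)\<^sup>2" for x
          using quad_le_norm[of "E - V (real (Suc k))" x] by (simp add: quad_diff) (meson diff_left_mono order_trans)
      qed
      also have "\<dots> < e" using k n2 by (simp add: norm_minus_commute field_simps)
      finally show ?thesis by (simp add: dist_norm norm_minus_commute)
    qed
    then show "\<forall>\<^sub>F T in at_top. dist (V T) E < e"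
      unfolding eventually_at_top_linorder by blast
  qed
  have "\<F> 0 E 0 = 0"
  proof -
    have small: "norm (\<F> 0 E 0) \<le> e" if e: "0 < e" for e
    proof -
      have "\<forall>\<^sub>F T in at_top. dist (V T) E < e / 3" "\<forall>\<^sub>F T in at_top. dist (\<F> 0 (V T) 0) (\<F> 0 E 0) < e / 3"
        using tendstoD[OF lim, of "e / 3"] tendstoD[OF ric_zero_tendsto[OF tendsto_const lim, of 0], of "e / 3"] e
        by simp_all
      then have "\<forall>\<^sub>F T in at_top. dist (V T) E < e / 3 \<and> dist (\<F> 0 (V T) 0) (\<F> 0 E 0) < e / 3"
        by (rule eventually_conj)
      then obtain T0 where T0: "\<And>T. T0 \<le> T \<Longrightarrow> dist (V T) E < e / 3 \<and> dist (\<F> 0 (V T) 0) (\<F> 0 E 0) < e / 3"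
        unfolding eventually_at_top_linorder by blast
      define T where "T = max T0 1"
      \<comment> \<open>For \<open>t\<close> in \<open>[0, 1]\<close> this solution takes the value
        \<open>V (T + 1 - t)\<close>, whose argument is at least \<open>T\<close> and hence in the
        range where \<open>V\<close> is close to \<open>E\<close>.\<close>
      let ?Y = "E_fin 0 (T + 1)"
      have Y: "riccati_solution 0 (T + 1) ?Y" by (intro riccati_solution_finite_riccati) (simp_all add: T_def)
      have YV: "?Y t = V (T + 1 - t)" if "t \<in> {0..1}" for t
        using that by (intro finite_riccati_V) (auto simp: T_def)
      have "norm ((?Y 1 - 1 *\<^sub>R \<F> 0 E 0) - (?Y 0 - 0 *\<^sub>R \<F> 0 E 0)) \<le> e / 3 * \<bar>1 - 0\<bar>"
      proof (rule bounded_derivative_lipschitz[of 0 1 "\<lambda>t. ?Y t - t *\<^sub>R \<F> 0 E 0" "\<lambda>t. \<F> 0 (?Y t) 0 - \<F> 0 E 0"])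
        fix t :: real assume t: "t \<in> {0..1}"
        have "(?Y has_vector_derivative \<F> t (?Y t) 0) (at t within {0..T+1})"
        proof -
          have "1 \<le> T" by (simp add: T_def)
          with t have "t \<in> {0..T+1}" by simp
          with Y show ?thesis unfolding riccati_solution_def by blast
        qed
        then have "(?Y has_vector_derivative \<F> 0 (?Y t) 0) (at t within {0..1})"
          unfolding ric_time_invariant[of t]
          by (rule has_vector_derivative_within_subset) (simp add: T_def)
        moreover have "((\<lambda>t. t *\<^sub>R \<F> 0 E 0) has_vector_derivative \<F> 0 E 0) (at t within {0..1})"
          using has_vector_derivative_scaleR[OF DERIV_ident[of "at t within {0..1}"]
              has_vector_derivative_const[of "\<F> 0 E 0"]] by simp
        ultimately show "((\<lambda>t. ?Y t - t *\<^sub>R \<F> 0 E 0) has_vector_derivative \<F> 0 (?Y t) 0 - \<F> 0 E 0) (at t within {0..1})"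
          by (rule has_vector_derivative_diff)
        have "T0 \<le> T" by (simp add: T_def)
        with t have "T0 \<le> T + 1 - t" by simp
        with T0[of "T + 1 - t"] show "norm (\<F> 0 (?Y t) 0 - \<F> 0 E 0) \<le> e / 3"
          by (simp add: YV[OF t] dist_norm)
      qed simp_all
      then have "norm (V T - V (T + 1) - \<F> 0 E 0) \<le> e / 3"
      proof -
        have "?Y 1 = V T" "?Y 0 = V (T + 1)" using YV[of 1] YV[of 0] by simp_all
        with \<open>norm ((?Y 1 - 1 *\<^sub>R \<F> 0 E 0) - (?Y 0 - 0 *\<^sub>R \<F> 0 E 0)) \<le> e / 3 * \<bar>1 - 0\<bar>\<close>
        show ?thesis by (simp add: algebra_simps)
      qed
      moreover have "norm (V T - V (T + 1)) \<le> 2 * (e / 3)"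
        using T0[of T] T0[of "T + 1"] dist_triangle_less_add[of "V T" E "e / 3" "V (T + 1)" "e / 3"]
        by (simp add: T_def dist_norm)
      moreover have "norm (\<F> 0 E 0) \<le> norm (V T - V (T + 1)) + norm (V T - V (T + 1) - \<F> 0 E 0)"
        using norm_triangle_ineq4[of "V T - V (T + 1)" "V T - V (T + 1) - \<F> 0 E 0"] by simp
      ultimately show ?thesis by simp
    qed
    have "norm (\<F> 0 E 0) \<le> 0"
      by (rule field_le_epsilon) (simp only: add_0_left, rule small)
    then show ?thesis by simp
  qed
  with E(1) show ?thesis using lim by (rule that)
qed

lemma finite_riccati_tendsto_infinite_riccati:
  assumes opt: "optimizable A B Q R" and Q: "Q 0 \<in> sym_pd" and t: "0 \<le> t"
  shows "((\<lambda>T. E_fin 0 T t) \<longlongrightarrow> E_inf 0) at_top"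
proof -
  obtain E where E: "E \<in> sym_psd" "\<F> 0 E 0 = 0" "(V \<longlongrightarrow> E) at_top"
    by (rule V_tendsto_stationary[OF opt]) (rule that)
  have "filterlim (\<lambda>T. - t + T) at_top at_top"
    by (rule filterlim_tendsto_add_at_top[OF tendsto_const filterlim_ident])
  from filterlim_compose[OF E(3) this] have "((\<lambda>T. V (- t + T)) \<longlongrightarrow> E) at_top" .
  then have "((\<lambda>T. E_fin 0 T t) \<longlongrightarrow> E) at_top"
  proof (rule Lim_transform_eventually)
    show "\<forall>\<^sub>F T in at_top. V (- t + T) = E_fin 0 T t"
      using eventually_gt_at_top[of t]
      by eventually_elim (simp add: finite_riccati_V[OF t])
  qed
  then show ?thesis by (simp only: infinite_riccati_zero_eq[OF E(1,2) Q])
qed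

lemma discrete_riccati_tendsto_infinite_riccati:
  assumes opt: "h_optimizable A B Q R h" and Q: "Q 0 \<in> sym_pd" and h: "0 < h"
  shows "(\<lambda>N. E_disc 0 N (\<lambda>j. real j * h) i) \<longlonglongrightarrow> E_inf h"
proof -
  have "\<exists>c. \<forall>k. quad (steps h k) x0 \<le> c" for x0
  proof -
    obtain x u where "u \<in> PC h" "trajectory A B x0 x u" "cost Q R x u < \<infinity>"
      using opt unfolding h_optimizable_def by blast
    then have "quad (steps h k) x0 \<le> enn2real (cost Q R x u)" for k
      by (intro steps_le_cost[OF h, of x0 x u]) simp_all
    then show ?thesis by blast
  qed
  then have "\<exists>b. \<forall>x k. quad (steps h k) x \<le> b x" by (rule choice[OF allI])
  then obtain b where "\<And>k x. quad (steps h k) x \<le> b x" by blast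
  from infinite_riccati_step(3)[OF h Q this]
  have lim: "steps h \<longlonglongrightarrow> E_inf h" .
  \<comment> \<open>With horizon index \<open>N + i\<close>, the number of steps left at node
    \<open>i\<close> is \<open>N\<close>.\<close>
  have "(\<lambda>N. E_disc 0 (N + i) (\<lambda>j. real j * h) i) = steps h"
    by (rule ext) (simp add: discrete_riccati_steps[OF h])
  then have "(\<lambda>N. E_disc 0 (N + i) (\<lambda>j. real j * h) i) \<longlonglongrightarrow> E_inf h"
    using lim by (simp only:)
  then show ?thesis by (rule LIMSEQ_offset)
qed

section \<open>Vanishing step on the infinite horizon\<close>

lemma infinite_riccati_tendsto_zero_step:
  assumes opt: "optimizable A B Q R" and Q: "Q 0 \<in> sym_pd" and thr: "uniform_threshold A B Q R hbar"
  shows "((\<lambda>h. E_inf h) \<longlongrightarrow> E_inf 0) (at_right 0)"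
proof -
  let ?E = "E_inf"
  obtain E0 where E0: "E0 \<in> sym_psd" "\<F> 0 E0 0 = 0"
    by (rule V_tendsto_stationary[OF opt]) (rule that)
  have psd0: "?E 0 \<in> sym_psd" using infinite_riccati_zero_eq[OF E0 Q] E0(1) by simp
  obtain c where c: "0 \<le> c" and hbar: "0 < hbar" and thr': "\<And>h x0. 0 < h \<Longrightarrow> h \<le> hbar \<Longrightarrow>
      \<exists>x. \<exists>u\<in>PC h. trajectory A B x0 x u \<and> cost Q R x u \<le> ennreal (c * quad (?E 0) x0)"
    using thr unfolding uniform_threshold_def by blast
  have steps: "quad (steps h k) x0 \<le> c * quad (?E 0) x0" if h: "0 < h" "h \<le> hbar" for h k x0
  proof -
    obtain x u where "u \<in> PC h" "trajectory A B x0 x u" "cost Q R x u \<le> ennreal (c * quad (?E 0) x0)"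
      using thr'[OF h] by blast
    then show ?thesis using h(1) c sym_psd_nonneg[OF psd0] by (intro steps_le_cost) simp_all
  qed
  \<comment> \<open>The bound \<open>b\<close> becomes \<open>c * quad (E_inf 0)\<close>, the same
    for all \<open>h\<close> up to the threshold.\<close>
  note E = infinite_riccati_step[OF _ Q steps]
  define C where "C = real CARD('n) * real CARD('n) * (c * norm (?E 0))"
  have bound: "norm (?E h) \<le> C" if h: "0 < h" "h \<le> hbar" for h
    unfolding C_def
  proof (rule sym_psd_norm_le)
    show "?E h \<in> sym_psd" using E(1) h by blast
    fix x
    have "quad (?E h) x \<le> c * quad (?E 0) x" using E(4)[of h x] h by blast
    also have "\<dots> \<le> c * (norm (?E 0) * (norm x)\<^sup>2)" using c by (intro mult_left_mono quad_le_norm)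
    finally show "quad (?E h) x \<le> c * norm (?E 0) * (norm x)\<^sup>2" by simp
  qed
  show ?thesis
  proof (rule ccontr)
    assume "\<not> ?thesis"
    then obtain e where e: "0 < e" "\<not> (\<forall>\<^sub>F h in at_right 0. dist (?E h) (?E 0) < e)"
      unfolding tendsto_iff by blast
    have far: "\<exists>h. 0 < h \<and> h < d \<and> e \<le> dist (?E h) (?E 0)" if d: "0 < d" for d
      using e(2) d unfolding eventually_at_right_field by (meson not_le)
    \<comment> \<open>The minimum keeps the bad steps below the threshold, where the bound applies,
      and also forces them to 0.\<close>
    have "\<exists>h. 0 < h \<and> h < min hbar (inverse (real (Suc k))) \<and> e \<le> dist (?E h) (?E 0)" for k
      using hbar by (intro far) simp
    then obtain h where h: "\<And>k. 0 < h k" "\<And>k. h k < min hbar (inverse (real (Suc k)))"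
      "\<And>k. e \<le> dist (?E (h k)) (?E 0)" by metis
    have hb: "h k \<le> hbar" "h k \<le> inverse (real (Suc k))" for k using h(2)[of k] by simp_all
    have "h \<longlonglongrightarrow> 0"
    proof (rule tendsto_sandwich[OF _ _ tendsto_const LIMSEQ_inverse_real_of_nat])
      show "\<forall>\<^sub>F k in sequentially. 0 \<le> h k" by (intro always_eventually allI less_imp_le h(1))
      show "\<forall>\<^sub>F k in sequentially. h k \<le> inverse (real (Suc k))" by (intro always_eventually allI hb)
    qed
    have "seq_compact (sym_psd \<inter> cball (0 :: real^'n^'n) C)"
      unfolding compact_eq_seq_compact_metric[symmetric]
      by (intro closed_Int_compact closed_sym_psd compact_cball)
    moreover have "\<forall>k. ?E (h k) \<in> sym_psd \<inter> cball 0 C"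
      using E(1)[OF h(1) h(1) hb(1)] bound[OF h(1) hb(1)] by simp
    ultimately obtain L r where L: "L \<in> sym_psd \<inter> cball 0 C" and r: "strict_mono (r :: nat \<Rightarrow> nat)"
      and lim: "((\<lambda>k. ?E (h k)) \<circ> r) \<longlonglongrightarrow> L"
      by (rule seq_compactE) (rule that)
    have hr: "(\<lambda>k. h (r k)) \<longlonglongrightarrow> 0"
      using LIMSEQ_subseq_LIMSEQ[OF \<open>h \<longlonglongrightarrow> 0\<close> r] by (simp add: o_def)
    have Er: "(\<lambda>k. ?E (h (r k))) \<longlonglongrightarrow> L" using lim by (simp add: o_def)
    have "(\<lambda>k. \<F> 0 (?E (h (r k))) (h (r k))) \<longlonglongrightarrow> \<F> 0 L 0"
      using h(1) E(1)[OF h(1) h(1) hb(1)]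
      by (intro ric_tendsto_zero_step[OF tendsto_const Er hr] always_eventually allI)
    moreover have "\<F> 0 (?E (h (r k))) (h (r k)) = 0" for k
      using E(2)[OF h(1) h(1) hb(1)] .
    ultimately have "\<F> 0 L 0 = 0" by (simp add: LIMSEQ_const_iff)
    then have "?E 0 = L" using L by (intro infinite_riccati_zero_eq Q) simp_all
    have "\<forall>\<^sub>F k in sequentially. dist (?E (h (r k))) L < e" using Er e(1) by (rule tendstoD)
    then obtain k where "dist (?E (h (r k))) L < e"
      using eventually_happens'[OF sequentially_bot] by blast
    with h(3)[of "r k"] \<open>?E 0 = L\<close> show False by simp
  qed
qed

end

theorem theorem1:
  fixes A :: "real \<Rightarrow> real^'n^'n" and B :: "real \<Rightarrow> real^'m^'n"
    and Q :: "real \<Rightarrow> real^'n^'n" and R :: "real \<Rightarrow> real^'m^'m"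
    and P :: "real^'n^'n"
  assumes "P \<in> sym_psd"
    and "continuous_on UNIV A" and "continuous_on UNIV B"
    and "continuous_on UNIV Q" and "continuous_on UNIV R"
    and "\<And>t. Q t \<in> sym_psd" and "\<And>t. R t \<in> sym_pd"
  shows
    "(\<forall>T>0. \<forall>\<epsilon>>0. \<exists>\<delta>>0. \<forall>N \<theta>.
        time_partition T N \<theta> \<and> 0 < mesh N \<theta> \<and> mesh N \<theta> \<le> \<delta> \<longrightarrow>
        (MAX i\<in>{0..N}. opnorm (finite_riccati A B Q R P T (\<theta> i)
                                - discrete_riccati A B Q R P N \<theta> i)) \<le> \<epsilon>)
     \<and>
     (P = 0 \<and> autonomous A B Q R \<and> (\<forall>t. Q t \<in> sym_pd) \<and> optimizable A B Q R \<longrightarrow>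
        (\<forall>t\<ge>0. ((\<lambda>T. finite_riccati A B Q R P T t) \<longlongrightarrow> infinite_riccati A B Q R 0) at_top))
     \<and>
     (P = 0 \<and> autonomous A B Q R \<longrightarrow>
        (\<forall>h>0. (\<forall>t. Q t \<in> sym_pd) \<and> h_optimizable A B Q R h \<longrightarrow>
          (\<forall>i. (\<lambda>N. discrete_riccati A B Q R P N (\<lambda>j. real j * h) i)
                 \<longlonglongrightarrow> infinite_riccati A B Q R h)))
     \<and>
     (autonomous A B Q R \<and> (\<forall>t. Q t \<in> sym_pd) \<and> optimizable A B Q R \<longrightarrow>
        (\<forall>hbar. uniform_threshold A B Q R hbar \<longrightarrow>
          ((\<lambda>h. infinite_riccati A B Q R h) \<longlongrightarrow> infinite_riccati A B Q R 0) (at_right 0)))"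
proof -
  interpret lq A B Q R
    using assms by unfold_locales auto
  have part1: "\<exists>\<delta>>0. \<forall>N \<theta>. time_partition T N \<theta> \<and> 0 < mesh N \<theta> \<and> mesh N \<theta> \<le> \<delta> \<longrightarrow>
      (MAX i\<in>{0..N}. opnorm (finite_riccati A B Q R P T (\<theta> i) - discrete_riccati A B Q R P N \<theta> i)) \<le> \<epsilon>"
    if T: "0 < T" and e: "0 < \<epsilon>" for T \<epsilon>
  proof -
    obtain d where d: "0 < d" "\<forall>N \<theta>. time_partition T N \<theta> \<and> mesh N \<theta> \<le> d \<longrightarrow>
        (\<forall>i\<le>N. norm (finite_riccati A B Q R P T (\<theta> i) - discrete_riccati A B Q R P N \<theta> i) \<le> \<epsilon>)"
      using discrete_riccati_converges[OF assms(1) T e] by blast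
    show ?thesis
    proof (intro exI[of _ d] conjI allI impI d(1))
      fix N \<theta> assume part: "time_partition T N \<theta> \<and> 0 < mesh N \<theta> \<and> mesh N \<theta> \<le> d"
      show "(MAX i\<in>{0..N}. opnorm (finite_riccati A B Q R P T (\<theta> i) - discrete_riccati A B Q R P N \<theta> i)) \<le> \<epsilon>"
      proof (rule Max.boundedI)
        fix y assume "y \<in> (\<lambda>i. opnorm (finite_riccati A B Q R P T (\<theta> i) - discrete_riccati A B Q R P N \<theta> i)) ` {0..N}"
        then obtain i where i: "i \<le> N" "y = opnorm (finite_riccati A B Q R P T (\<theta> i) - discrete_riccati A B Q R P N \<theta> i)"
          by auto
        have "norm (finite_riccati A B Q R P T (\<theta> i) - discrete_riccati A B Q R P N \<theta> i) \<le> \<epsilon>"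
          using d(2) part i(1) by blast
        then show "y \<le> \<epsilon>" unfolding i(2) by (rule order_trans[OF opnorm_le_norm])
      qed simp_all
    qed
  qed
  have aut: "lq_autonomous A B Q R" if "autonomous A B Q R"
    using that by unfold_locales
  show ?thesis
  proof (intro conjI allI impI; (elim conjE)?)
    fix t :: real assume "P = 0" "autonomous A B Q R" "\<forall>t. Q t \<in> sym_pd" "optimizable A B Q R" "0 \<le> t"
    then show "((\<lambda>T. finite_riccati A B Q R P T t) \<longlongrightarrow> infinite_riccati A B Q R 0) at_top"
      using lq_autonomous.finite_riccati_tendsto_infinite_riccati[OF aut] by blast
  next
    fix h :: real and i assume "P = 0" "autonomous A B Q R" "0 < h" "\<forall>t. Q t \<in> sym_pd" "h_optimizable A B Q R h"
    then show "(\<lambda>N. discrete_riccati A B Q R P N (\<lambda>j. real j * h) i) \<longlonglongrightarrow> infinite_riccati A B Q R h"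
      using lq_autonomous.discrete_riccati_tendsto_infinite_riccati[OF aut] by blast
  next
    fix hbar assume "autonomous A B Q R" "\<forall>t. Q t \<in> sym_pd" "optimizable A B Q R" "uniform_threshold A B Q R hbar"
    then show "((\<lambda>h. infinite_riccati A B Q R h) \<longlongrightarrow> infinite_riccati A B Q R 0) (at_right 0)"
      using lq_autonomous.infinite_riccati_tendsto_zero_step[OF aut] by blast
  qed (use part1 in blast)
qed

end
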